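(* Let $Z$ be a centered Pearson random variable with support $(a,+\infty)$ and parameters $\alpha,\beta,\gamma$, i.e. $g_*(z)=\alpha z^2+\beta z+\gamma$ for $z\in(a,\infty)$, and assume $\alpha<1/2$. Let $\Phi_*(z)=\mathbf{P}[Z>z]$. Let $X\in\mathbf{D}^{1,2}$ be a centered random variable with a density and with support contained in $(a,+\infty)$, and let $G=\langle DX;-DL^{-1}X\rangle_H$. If $G\le g_*(X)$ almost surely, then for any $K>\frac{1-\alpha}{1-2\alpha}$ there exists $z_0$ such that for all $z>z_0$, $$\mathbf{P}[X>z]\ \le\ K\,\Phi_*(z).$$
   Context: For a centered (integrable, mean zero) random variable $Z$ with density $\rho_*$, continuous on $\mathbf{R}$, positive and differentiable on the support $(a,b)$ and zero outside it, set $g_*(z)=\frac{\int_z^\infty y\rho_*(y)\,dy}{\rho_*(z)}\mathbf{1}_{(a,b)}(z)$. $Z$ is called a centered Pearson random variable with parameters $\alpha,\beta,\gamma\in\mathbf{R}$ if $g_*(z)=\alpha z^2+\beta z+\gamma$ for all $z\in(a,b)$; equivalently $\frac{\rho_*'(z)}{\rho_*(z)}=-\frac{(2\alpha+1)z+\beta}{\alpha z^2+\beta z+\gamma}$ on $(a,b)$. Malliavin calculus: let $W$ be an isonormal Gaussian process over a real separable Hilbert space $H$, on a probability space $(\Omega,\mathcal{F},\mathbf{P})$ with $\mathcal{F}$ generated by $W$ (one may take $H=L^2([0,1])$ and $W$ the white noise of a standard Brownian motion). Every $X\in L^2(\Omega,\mathcal{F},\mathbf{P})$ has a unique Wiener chaos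 decomposition $X=\sum_{n\ge0}I_n(f_n)$, with $f_n$ symmetric in $H^{\otimes n}$, $I_n$ the $n$-th multiple Wiener integral, $I_0(f_0)=f_0=\mathbf{E}[X]$. $\mathbf{D}^{1,2}$ is the set of such $X$ with $\sum_{n\ge1}n\,n!\|f_n\|^2_{H^{\otimes n}}<\infty$. The Malliavin derivative of $X\in\mathbf{D}^{1,2}$ is the $H$-valued random variable $DX=\sum_{n\ge1}nI_{n-1}(f_n(r,\cdot))$ (as a function of $r$). The pseudo-inverse of the Ornstein–Uhlenbeck generator is $-L^{-1}X=\sum_{n\ge1}\frac1nI_n(f_n)$. *)

theory Defs
  imports "HOL-Probability.Probability"
begin

definition stein_g :: "(real \<Rightarrow> real) \<Rightarrow> ereal \<Rightarrow> ereal \<Rightarrow> real \<Rightarrow> real" where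
  "stein_g \<rho> a b z =
     (if a < ereal z \<and> ereal z < b then (LINT y:{z..}|lborel. y * \<rho> y) / \<rho> z else 0)"

text \<open>The endpoints are extended reals, so that unbounded supports are included.\<close>

definition centered_with_density ::
  "'a measure \<Rightarrow> ('a \<Rightarrow> real) \<Rightarrow> (real \<Rightarrow> real) \<Rightarrow> ereal \<Rightarrow> ereal \<Rightarrow> bool" where
  "centered_with_density N Z \<rho> a b \<longleftrightarrow>
     integrable N Z \<and> (\<integral>w. Z w \<partial>N) = 0 \<and>
     distributed N lborel Z (\<lambda>z. ennreal (\<rho> z)) \<and>
     continuous_on UNIV \<rho> \<and>
     (\<forall>z. a < ereal z \<and> ereal z < b \<longrightarrow> 0 < \<rho> z \<and> \<rho> differentiable (at z)) \<and>
     (\<forall>z. \<not> (a < ereal z \<and> ereal z < b) \<longrightarrow> \<rho> z = 0)"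

definition centered_pearson ::
  "'a measure \<Rightarrow> ('a \<Rightarrow> real) \<Rightarrow> (real \<Rightarrow> real) \<Rightarrow> ereal \<Rightarrow> ereal \<Rightarrow> real \<Rightarrow> real \<Rightarrow> real \<Rightarrow> bool"
  where
  "centered_pearson N Z \<rho> a b \<alpha> \<beta> \<gamma> \<longleftrightarrow>
     centered_with_density N Z \<rho> a b \<and>
     (\<forall>z. a < ereal z \<and> ereal z < b \<longrightarrow> stein_g \<rho> a b z = \<alpha> * z\<^sup>2 + \<beta> * z + \<gamma>)"

text \<open>The zero variable is included as the centered Gaussian of variance 0.\<close>

definition centered_gaussian :: "'a measure \<Rightarrow> ('a \<Rightarrow> real) \<Rightarrow> bool" where
  "centered_gaussian M Y \<longleftrightarrow>
     Y \<in> borel_measurable M \<and>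
     ((AE w in M. Y w = 0) \<or>
      (\<exists>\<sigma>>0. distributed M lborel Y (\<lambda>x. ennreal (normal_density 0 \<sigma> x))))"

definition isonormal_process :: "'a measure \<Rightarrow> ('h::real_inner \<Rightarrow> 'a \<Rightarrow> real) \<Rightarrow> bool" where
  "isonormal_process M W \<longleftrightarrow>
     (\<forall>S c. finite S \<longrightarrow> centered_gaussian M (\<lambda>w. \<Sum>h\<in>S. c h * W h w)) \<and>
     (\<forall>h k. (\<integral>w. W h w * W k w \<partial>M) = h \<bullet> k)"

definition generated_by :: "'a measure \<Rightarrow> ('h \<Rightarrow> 'a \<Rightarrow> real) \<Rightarrow> bool" where
  "generated_by M W \<longleftrightarrow>
     sets M = sigma_sets (space M) {W h -` A \<inter> space M | h A. A \<in> sets borel}"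

definition L2 :: "'a measure \<Rightarrow> ('a \<Rightarrow> 'b::real_normed_vector) set" where
  "L2 M = {Y \<in> borel_measurable M. integrable M (\<lambda>w. (norm (Y w))\<^sup>2)}"

definition L2_tendsto ::
  "'a measure \<Rightarrow> (nat \<Rightarrow> 'a \<Rightarrow> 'b::real_normed_vector) \<Rightarrow> ('a \<Rightarrow> 'b) \<Rightarrow> bool" where
  "L2_tendsto M Y Y' \<longleftrightarrow>
     (\<forall>k. Y k \<in> L2 M) \<and> Y' \<in> L2 M \<and>
     (\<lambda>k. \<integral>w. (norm (Y k w - Y' w))\<^sup>2 \<partial>M) \<longlonglongrightarrow> 0"

text \<open>
  The \<open>n\<close>-th Hilbert space tensor power of \<open>H\<close> is realised as the space of \<open>n\<close>-linear
  Hilbert-Schmidt forms on \<open>H\<close>: a tensor \<open>f\<close> is identified with the form sending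
  \<open>[h\<^sub>1, \<dots>, h\<^sub>n]\<close> to the inner product of \<open>f\<close> with \<open>h\<^sub>1 \<otimes> \<dots> \<otimes> h\<^sub>n\<close>. Only the values on
  lists of length \<open>n\<close> matter. For \<open>H = L\<^sup>2([0,1])\<close> the form of a kernel \<open>f\<close> is integration
  of \<open>f\<close> against \<open>h\<^sub>1(r\<^sub>1) \<cdots> h\<^sub>n(r\<^sub>n)\<close>.

  The squared norm is the sum of the squared coefficients in any orthonormal basis, that is,
  the supremum of the corresponding sums over all finite orthonormal systems.
\<close>

definition orthonormal :: "'h::real_inner set \<Rightarrow> bool" where
  "orthonormal B \<longleftrightarrow> pairwise orthogonal B \<and> (\<forall>b\<in>B. norm b = 1)"

definition tensor_norm_sq :: "nat \<Rightarrow> ('h::real_inner list \<Rightarrow> real) \<Rightarrow> ennreal" where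
  "tensor_norm_sq n f =
     (SUP B\<in>{B. finite B \<and> orthonormal B}.
        \<Sum>hs\<in>{hs. set hs \<subseteq> B \<and> length hs = n}. ennreal ((f hs)\<^sup>2))"

definition sym_tensor :: "nat \<Rightarrow> ('h::real_inner list \<Rightarrow> real) \<Rightarrow> bool" where
  "sym_tensor n f \<longleftrightarrow>
     (\<forall>hs i. length hs = n \<longrightarrow> i < n \<longrightarrow> linear (\<lambda>x. f (hs[i := x]))) \<and>
     (\<forall>hs ks. length hs = n \<longrightarrow> mset ks = mset hs \<longrightarrow> f ks = f hs) \<and>
     tensor_norm_sq n f < \<infinity>"

text \<open>The tensor power \<open>h \<otimes> \<dots> \<otimes> h\<close>, on lists of any length.\<close>

definition pow_tensor :: "'h::real_inner \<Rightarrow> 'h list \<Rightarrow> real" where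
  "pow_tensor h hs = (\<Prod>x\<leftarrow>hs. h \<bullet> x)"

text \<open>Probabilists' (monic) Hermite polynomials.\<close>

fun hermite :: "nat \<Rightarrow> real \<Rightarrow> real" where
  "hermite 0 x = 1"
| "hermite (Suc 0) x = x"
| "hermite (Suc (Suc n)) x = x * hermite (Suc n) x - real (Suc n) * hermite n x"

text \<open>
  \<open>multiple_integral M W n f Y\<close> means that \<open>Y\<close> is a version of \<open>I\<^sub>n(f)\<close>. As usual, \<open>I\<^sub>n\<close> is the
  continuous linear extension to all symmetric tensors of the map sending the \<open>n\<close>-th tensor power
  of a unit vector \<open>h\<close> to \<open>hermite n (W h)\<close>. By homogeneity the tensor power of an arbitrary \<open>h\<close> is
  sent to \<open>norm h ^ n * hermite n (W h / norm h)\<close>; with the conventions \<open>x / 0 = 0\<close> and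
  \<open>0 ^ 0 = 1\<close> this is also right for \<open>h = 0\<close>. Finite linear combinations of
  tensor powers are given as lists of pairs of a coefficient and a vector. For \<open>n = 0\<close> this says
  that \<open>Y\<close> is almost surely the constant \<open>f []\<close>.
\<close>

definition multiple_integral ::
  "'a measure \<Rightarrow> ('h::real_inner \<Rightarrow> 'a \<Rightarrow> real) \<Rightarrow> nat \<Rightarrow> ('h list \<Rightarrow> real) \<Rightarrow> ('a \<Rightarrow> real) \<Rightarrow> bool"
  where
  "multiple_integral M W n f Y \<longleftrightarrow>
     sym_tensor n f \<and>
     (\<exists>T :: nat \<Rightarrow> (real \<times> 'h) list.
        (\<lambda>k. tensor_norm_sq n (\<lambda>hs. (\<Sum>(c, h)\<leftarrow>T k. c * pow_tensor h hs) - f hs)) \<longlonglongrightarrow> 0 \<and>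
        L2_tendsto M
          (\<lambda>k w. \<Sum>(c, h)\<leftarrow>T k. c * (norm h ^ n * hermite n (W h w / norm h))) Y)"

definition chaos_decomposition ::
  "'a measure \<Rightarrow> ('h::real_inner \<Rightarrow> 'a \<Rightarrow> real) \<Rightarrow> ('a \<Rightarrow> real) \<Rightarrow>
   (nat \<Rightarrow> 'h list \<Rightarrow> real) \<Rightarrow> (nat \<Rightarrow> 'a \<Rightarrow> real) \<Rightarrow> bool" where
  "chaos_decomposition M W X f J \<longleftrightarrow>
     (\<forall>n. multiple_integral M W n (f n) (J n)) \<and>
     L2_tendsto M (\<lambda>N w. \<Sum>n\<le>N. J n w) X"

definition D12 :: "'a measure \<Rightarrow> ('h::real_inner \<Rightarrow> 'a \<Rightarrow> real) \<Rightarrow> ('a \<Rightarrow> real) set" where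
  "D12 M W =
     {X. \<exists>f J. chaos_decomposition M W X f J \<and>
           (\<Sum>n. of_nat n * fact n * tensor_norm_sq n (f n)) < \<infinity>}"

text \<open>
  \<open>D n\<close> below is the \<open>H\<close>-valued random variable \<open>I\<^sub>n(f\<^sub>n\<^sub>+\<^sub>1(r, \<cdot>))\<close>, where \<open>r\<close> is the \<open>H\<close>-variable:
  its inner product with \<open>h\<close> is the multiple integral of the contraction of \<open>f\<^sub>n\<^sub>+\<^sub>1\<close> with \<open>h\<close>
  in the first slot.
\<close>

definition malliavin_derivative ::
  "'a measure \<Rightarrow> ('h::real_inner \<Rightarrow> 'a \<Rightarrow> real) \<Rightarrow> ('a \<Rightarrow> real) \<Rightarrow> ('a \<Rightarrow> 'h) \<Rightarrow> bool" where
  "malliavin_derivative M W X DX \<longleftrightarrow>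
     X \<in> D12 M W \<and>
     (\<exists>f J D. chaos_decomposition M W X f J \<and>
        (\<forall>n h. multiple_integral M W n (\<lambda>hs. f (Suc n) (h # hs)) (\<lambda>w. h \<bullet> D n w)) \<and>
        L2_tendsto M (\<lambda>N w. \<Sum>n<N. real (Suc n) *\<^sub>R D n w) DX)"

text \<open>\<open>OU_pseudo_inverse M W X Y\<close> means that \<open>Y\<close> is a version of \<open>L\<^sup>-\<^sup>1 X\<close>.\<close>

definition OU_pseudo_inverse ::
  "'a measure \<Rightarrow> ('h::real_inner \<Rightarrow> 'a \<Rightarrow> real) \<Rightarrow> ('a \<Rightarrow> real) \<Rightarrow> ('a \<Rightarrow> real) \<Rightarrow> bool" where
  "OU_pseudo_inverse M W X Y \<longleftrightarrow>
     (\<exists>f J. chaos_decomposition M W X f J \<and>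
        L2_tendsto M (\<lambda>N w. \<Sum>n=1..N. J n w / real n) (\<lambda>w. - Y w))"

end

theory Submission
  imports Defs
begin

text \<open>
  For Lipschitz \<open>C\<^sup>1\<close> functions \<open>\<phi>\<close> the integration by parts formula
  \<open>E[X \<phi>(X)] = E[\<phi>'(X) G]\<close> holds. It is first proved for \<open>\<phi>\<close> of a polynomial in finitely many
  Gaussian variables, by conditioning on the variables orthogonal to a direction \<open>h\<close> and integrating by
  parts in the variable \<open>W h\<close>, and then passes to the closure in the space \<open>D12\<close>.

  Hence \<open>E[X \<phi>(X)] \<le> E[\<phi>'(X) g\<^sub>*(X)]\<close> for increasing \<open>\<phi>\<close>. Write \<open>F\<close> for the distribution function
  of \<open>Z\<close> and \<open>q(z) = E[Z; Z > z] = g\<^sub>*(z) \<rho>(z)\<close>. The function \<open>f = F / q\<close> is increasing on the support of \<open>Z\<close> and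
  satisfies \<open>g\<^sub>* f' = 1 + x f\<close>, so the choice of \<open>f(min x z)\<close> for \<open>\<phi>\<close> gives \<open>E[X; X \<ge> z] F(z) \<le> q(z)\<close>, and
  therefore \<open>z P[X > z] F(z) \<le> q(z)\<close>. Finally \<open>q(z) \<le> \<kappa> z P[Z > z]\<close> for large \<open>z\<close> whenever
  \<open>\<kappa> > 1 + \<alpha>\<close>, because the derivative of \<open>- q(z) / (\<kappa> z)\<close> is \<open>\<rho>(z) (1 + g\<^sub>*(z) / z\<^sup>2) / \<kappa>\<close>; and
  \<open>1 + \<alpha> \<le> (1 - \<alpha>) / (1 - 2\<alpha>)\<close>.
\<close>

section \<open>Square-integrable functions\<close>

text \<open>The two copies of \<open>X\<close> in \<open>X \<phi>(X)\<close> are treated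
  differently. The outer factor enters linearly, so it is expanded chaos by chaos, where
  \<open>- L\<close> is multiplication by the degree, while the argument of \<open>\<phi>\<close> is
  still a polynomial; the argument is approximated only afterwards. The definition of the derivative
  controls inner products with fixed vectors only, so the gradients of the polynomial approximations
  converge weakly. They stay bounded in L2 by the isometry on each chaos, and a weak limit paired
  with a strong one suffices. On the Stein side, \<open>f(min x z)\<close> is in general not C^1,
  and nothing bounds the derivative of \<open>f\<close> near \<open>a\<close>. So \<open>f\<close>
  is clamped to a compact interval from \<open>c\<close> to \<open>z\<close>, its derivative is cut
  off continuously at both ends, and \<open>c\<close> tends to \<open>a\<close>. The boundary term
  at \<open>c\<close> disappears in the limit because \<open>F / q\<close> stays bounded at the left
  end, even if \<open>F\<close> and \<open>q\<close> both vanish there. The factor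
  \<open>F(z)\<close> in the resulting bound tends to 1 and costs only an arbitrarily small part of
  the constant, which is why the constant has to lie strictly above
  \<open>1 + \<alpha>\<close>.\<close>

lemma L2D:
  assumes "f \<in> L2 M"
  shows "f \<in> borel_measurable M" "integrable M (\<lambda>w. (norm (f w))\<^sup>2)"
  using assms by (auto simp: L2_def)

lemma L2_inner_integrable:
  fixes f g :: "'a \<Rightarrow> 'b::{real_inner,second_countable_topology}"
  assumes "f \<in> L2 M" "g \<in> L2 M"
  shows "integrable M (\<lambda>w. f w \<bullet> g w)"
proof (rule Bochner_Integration.integrable_bound)
  note [measurable] = L2D(1)[OF assms(1)] L2D(1)[OF assms(2)]
  show "integrable M (\<lambda>w. (norm (f w))\<^sup>2 + (norm (g w))\<^sup>2)"
    using assms by (auto simp: L2_def)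
  show "(\<lambda>w. f w \<bullet> g w) \<in> borel_measurable M" by simp
  show "AE w in M. norm (f w \<bullet> g w) \<le> norm ((norm (f w))\<^sup>2 + (norm (g w))\<^sup>2)"
  proof (rule AE_I2)
    fix w
    have "norm (f w \<bullet> g w) \<le> norm (f w) * norm (g w)"
      using Cauchy_Schwarz_ineq2 by auto
    also have "\<dots> \<le> (norm (f w))\<^sup>2 + (norm (g w))\<^sup>2"
      using sum_squares_bound[of "norm (f w)" "norm (g w)"]
        mult_nonneg_nonneg[OF norm_ge_zero norm_ge_zero, of "f w" "g w"] by linarith
    finally show "norm (f w \<bullet> g w) \<le> norm ((norm (f w))\<^sup>2 + (norm (g w))\<^sup>2)" by simp
  qed
qed

lemma L2_add:
  fixes f g :: "'a \<Rightarrow> 'b::{real_inner,second_countable_topology}"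
  assumes "f \<in> L2 M" "g \<in> L2 M"
  shows "(\<lambda>w. f w + g w) \<in> L2 M"
proof -
  note [measurable] = L2D(1)[OF assms(1)] L2D(1)[OF assms(2)]
  have "(\<lambda>w. (norm (f w + g w))\<^sup>2) = (\<lambda>w. (norm (f w))\<^sup>2 + 2 * (f w \<bullet> g w) + (norm (g w))\<^sup>2)"
    by (auto simp: power2_norm_eq_inner inner_add inner_commute)
  then show ?thesis
    using L2_inner_integrable[OF assms] L2D[OF assms(1)] L2D[OF assms(2)]
    by (simp add: L2_def)
qed

lemma L2_scaleR:
  fixes f :: "'a \<Rightarrow> 'b::{real_inner,second_countable_topology}"
  assumes "f \<in> L2 M"
  shows "(\<lambda>w. c *\<^sub>R f w) \<in> L2 M"
proof -
  note [measurable] = L2D(1)[OF assms(1)]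
  show ?thesis using L2D(2)[OF assms(1)] by (simp add: L2_def power_mult_distrib)
qed

lemma L2_mult: "f \<in> L2 M \<Longrightarrow> (\<lambda>w. c * f w) \<in> L2 M" for f :: "'a \<Rightarrow> real"
  using L2_scaleR[of f M c] by simp

lemma L2_uminus:
  fixes f :: "'a \<Rightarrow> 'b::{real_inner,second_countable_topology}"
  shows "f \<in> L2 M \<Longrightarrow> (\<lambda>w. - f w) \<in> L2 M"
  using L2_scaleR[of f M "-1"] by simp

lemma L2_diff:
  fixes f g :: "'a \<Rightarrow> 'b::{real_inner,second_countable_topology}"
  assumes "f \<in> L2 M" "g \<in> L2 M"
  shows "(\<lambda>w. f w - g w) \<in> L2 M"
  using L2_add[OF assms(1) L2_uminus[OF assms(2)]] by simp

lemma L2_zero: "(\<lambda>w. 0) \<in> L2 M"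
  by (simp add: L2_def)

lemma L2_sum:
  fixes f :: "'i \<Rightarrow> 'a \<Rightarrow> 'b::{real_inner,second_countable_topology}"
  assumes "\<And>i. i \<in> I \<Longrightarrow> f i \<in> L2 M"
  shows "(\<lambda>w. \<Sum>i\<in>I. f i w) \<in> L2 M"
  using assms
proof (induction I rule: infinite_finite_induct)
  case (insert x F)
  then show ?case using L2_add[of "f x" M "\<lambda>w. \<Sum>i\<in>F. f i w"] by simp
qed (simp_all add: L2_zero)

lemma L2_norm: "f \<in> L2 M \<Longrightarrow> (\<lambda>w. norm (f w)) \<in> L2 M"
  for f :: "'a \<Rightarrow> 'b::{real_inner,second_countable_topology}"
  by (auto simp: L2_def)

lemma L2_dominated:
  fixes f :: "'a \<Rightarrow> 'b::{real_inner,second_countable_topology}"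
    and g :: "'a \<Rightarrow> 'c::{real_inner,second_countable_topology}"
  assumes "g \<in> L2 M" "f \<in> borel_measurable M" "AE w in M. norm (f w) \<le> C * norm (g w)"
  shows "f \<in> L2 M"
proof -
  note [measurable] = assms(2)
  have "integrable M (\<lambda>w. (norm (f w))\<^sup>2)"
  proof (rule Bochner_Integration.integrable_bound)
    show "integrable M (\<lambda>w. C\<^sup>2 * (norm (g w))\<^sup>2)" using assms by (auto simp: L2_def)
    show "AE w in M. norm ((norm (f w))\<^sup>2) \<le> norm (C\<^sup>2 * (norm (g w))\<^sup>2)"
      using assms(3)
    proof (eventually_elim)
      case (elim w)
      then have "(norm (f w))\<^sup>2 \<le> (C * norm (g w))\<^sup>2" by (intro power_mono) auto
      then show ?case by (simp add: power_mult_distrib)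
    qed
  qed simp
  then show ?thesis using assms by (simp add: L2_def)
qed

lemma (in finite_measure) L2_const: "(\<lambda>w. c) \<in> L2 M"
  by (simp add: L2_def)

lemma (in finite_measure) L2_integrable:
  fixes f :: "'a \<Rightarrow> real"
  shows "f \<in> L2 M \<Longrightarrow> integrable M f"
  using L2_inner_integrable[of f M "\<lambda>w. 1"] L2_const[of "1::real"] by simp

text \<open>The integral of \<open>(norm (f w - t *\<^sub>R g w))\<^sup>2\<close> is a quadratic
  polynomial in \<open>t\<close> that is never negative.\<close>

lemma L2_Cauchy_Schwarz:
  fixes f g :: "'a \<Rightarrow> 'b::{real_inner,second_countable_topology}"
  assumes f: "f \<in> L2 M" and g: "g \<in> L2 M"
  shows "\<bar>\<integral>w. f w \<bullet> g w \<partial>M\<bar> \<le> sqrt (LINT w|M. (norm (f w))\<^sup>2) * sqrt (LINT w|M. (norm (g w))\<^sup>2)"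
proof -
  define A B C where "A = (LINT w|M. (norm (f w))\<^sup>2)" and "B = (LINT w|M. f w \<bullet> g w)"
    and "C = (LINT w|M. (norm (g w))\<^sup>2)"
  note i = L2_inner_integrable[OF f g] L2D(2)[OF f] L2D(2)[OF g]
  have "0 \<le> C * t\<^sup>2 - 2 * B * t + A" for t
  proof -
    have "0 \<le> (LINT w|M. (norm (f w - t *\<^sub>R g w))\<^sup>2)" by simp
    also have "(\<lambda>w. (norm (f w - t *\<^sub>R g w))\<^sup>2) =
       (\<lambda>w. (norm (f w))\<^sup>2 - (2 * t) * (f w \<bullet> g w) + t\<^sup>2 * (norm (g w))\<^sup>2)"
      unfolding power2_norm_eq_inner
      by (simp add: inner_diff inner_commute power2_eq_square algebra_simps)
    also have "(\<integral>w. \<dots> w \<partial>M) = A - 2 * t * B + t\<^sup>2 * C"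
      using i by (simp add: A_def B_def C_def)
    finally show ?thesis by (simp add: algebra_simps)
  qed
  note q = this
  have A: "A \<ge> 0" and C: "C \<ge> 0" by (simp_all add: A_def C_def)
  have "B\<^sup>2 \<le> A * C"
  proof (cases "C = 0")
    case True
    have "B = 0"
    proof (rule ccontr)
      assume "B \<noteq> 0"
      \<comment> \<open>With \<open>C = 0\<close> the polynomial is affine, and at this
        \<open>t\<close> its value would be -1.\<close>
      then show False using q[of "(A + 1) / (2 * B)"] True by (simp add: field_simps)
    qed
    then show ?thesis using A C by simp
  next
    case False
    then show ?thesis using q[of "B / C"] C by (simp add: field_simps power2_eq_square)
  qed
  then have "sqrt (B\<^sup>2) \<le> sqrt (A * C)" by (rule real_sqrt_le_mono)
  then show ?thesis by (simp add: real_sqrt_mult A_def B_def C_def)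
qed

lemma L2_tendsto_inner:
  fixes F G :: "nat \<Rightarrow> 'a \<Rightarrow> 'b::{real_inner,second_countable_topology}"
  assumes F: "L2_tendsto M F f" and G: "L2_tendsto M G g"
  shows "(\<lambda>k. LINT w|M. F k w \<bullet> G k w) \<longlonglongrightarrow> (LINT w|M. f w \<bullet> g w)"
proof -
  have L: "\<And>k. F k \<in> L2 M" "f \<in> L2 M" "\<And>k. G k \<in> L2 M" "g \<in> L2 M"
    using F G by (auto simp: L2_tendsto_def)
  have d: "(\<lambda>w. F k w - f w) \<in> L2 M" "(\<lambda>w. G k w - g w) \<in> L2 M" for k
    using L L2_diff by blast+
  let ?n = "\<lambda>h. sqrt (LINT w|M. (norm (h w))\<^sup>2)"
  have z: "(\<lambda>k. ?n (\<lambda>w. F k w - f w)) \<longlonglongrightarrow> 0" "(\<lambda>k. ?n (\<lambda>w. G k w - g w)) \<longlonglongrightarrow> 0"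
    using tendsto_real_sqrt[of "\<lambda>k. LINT w|M. (norm (F k w - f w))\<^sup>2" 0]
      tendsto_real_sqrt[of "\<lambda>k. LINT w|M. (norm (G k w - g w))\<^sup>2" 0] F G
    by (simp_all add: L2_tendsto_def)
  have eq: "(LINT w|M. F k w \<bullet> G k w) - (LINT w|M. f w \<bullet> g w) =
    (LINT w|M. (F k w - f w) \<bullet> (G k w - g w)) + (LINT w|M. (F k w - f w) \<bullet> g w) +
    (LINT w|M. f w \<bullet> (G k w - g w))" for k
  proof -
    have "(LINT w|M. F k w \<bullet> G k w) = (LINT w|M. (F k w - f w) \<bullet> (G k w - g w) + (F k w - f w) \<bullet> g w +
        f w \<bullet> (G k w - g w) + f w \<bullet> g w)"
      by (intro Bochner_Integration.integral_cong) (auto simp: inner_diff)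
    also have "\<dots> = (LINT w|M. (F k w - f w) \<bullet> (G k w - g w)) + (LINT w|M. (F k w - f w) \<bullet> g w) +
        (LINT w|M. f w \<bullet> (G k w - g w)) + (LINT w|M. f w \<bullet> g w)"
      using L d by (simp add: L2_inner_integrable)
    finally show ?thesis by simp
  qed
  have "(\<lambda>k. (LINT w|M. F k w \<bullet> G k w) - (LINT w|M. f w \<bullet> g w)) \<longlonglongrightarrow> 0"
  proof (rule Lim_null_comparison)
    show "\<forall>\<^sub>F k in sequentially. norm ((LINT w|M. F k w \<bullet> G k w) - (LINT w|M. f w \<bullet> g w)) \<le>
      ?n (\<lambda>w. F k w - f w) * ?n (\<lambda>w. G k w - g w) + ?n (\<lambda>w. F k w - f w) * ?n g
       + ?n f * ?n (\<lambda>w. G k w - g w)"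
    proof (rule always_eventually, rule allI)
      fix k
      show "norm ((LINT w|M. F k w \<bullet> G k w) - (LINT w|M. f w \<bullet> g w)) \<le>
      ?n (\<lambda>w. F k w - f w) * ?n (\<lambda>w. G k w - g w) + ?n (\<lambda>w. F k w - f w) * ?n g
       + ?n f * ?n (\<lambda>w. G k w - g w)"
        using L2_Cauchy_Schwarz[OF d(1)[of k] d(2)[of k]] L2_Cauchy_Schwarz[OF d(1)[of k] L(4)]
          L2_Cauchy_Schwarz[OF L(2) d(2)[of k]] unfolding eq real_norm_def by linarith
    qed
    show "(\<lambda>k. ?n (\<lambda>w. F k w - f w) * ?n (\<lambda>w. G k w - g w) + ?n (\<lambda>w. F k w - f w) * ?n g
       + ?n f * ?n (\<lambda>w. G k w - g w)) \<longlonglongrightarrow> 0"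
      using tendsto_add[OF tendsto_add[OF tendsto_mult[OF z] tendsto_mult_right[OF z(1)]]
          tendsto_mult_left[OF z(2)], of "?n g" "?n f"] by simp
  qed
  then show ?thesis using LIM_zero_iff by blast
qed

lemma L2_tendsto_const: "f \<in> L2 M \<Longrightarrow> L2_tendsto M (\<lambda>k. f) f"
  by (simp add: L2_tendsto_def)

lemma L2_tendsto_norm2:
  fixes F :: "nat \<Rightarrow> 'a \<Rightarrow> 'b::{real_inner,second_countable_topology}"
  assumes "L2_tendsto M F f"
  shows "(\<lambda>k. LINT w|M. (norm (F k w))\<^sup>2) \<longlonglongrightarrow> (LINT w|M. (norm (f w))\<^sup>2)"
  using L2_tendsto_inner[OF assms assms] by (simp add: power2_norm_eq_inner)

lemma norm_add_sq_le:
  fixes x y :: "'b::real_inner"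
  shows "(norm (x + y))\<^sup>2 \<le> 2 * (norm x)\<^sup>2 + 2 * (norm y)\<^sup>2"
proof -
  have "0 \<le> (norm (x - y))\<^sup>2" by simp
  then show ?thesis unfolding power2_norm_eq_inner
    by (simp add: inner_add inner_diff inner_commute)
qed

lemma L2_tendsto_zeroI:
  fixes F :: "nat \<Rightarrow> 'a \<Rightarrow> 'b::{real_inner,second_countable_topology}"
  assumes "L2_tendsto M F f" "\<And>k. G k \<in> L2 M" "(\<lambda>k. LINT w|M. (norm (G k w - F k w))\<^sup>2) \<longlonglongrightarrow> 0"
  shows "L2_tendsto M G f"
proof -
  have L: "\<And>k. F k \<in> L2 M" "f \<in> L2 M" using assms by (auto simp: L2_tendsto_def)
  have "(\<lambda>k. LINT w|M. (norm (G k w - f w))\<^sup>2) \<longlonglongrightarrow> 0"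
  proof (rule Lim_null_comparison)
    show "\<forall>\<^sub>F k in sequentially. norm (LINT w|M. (norm (G k w - f w))\<^sup>2) \<le>
        2 * (LINT w|M. (norm (G k w - F k w))\<^sup>2) + 2 * (LINT w|M. (norm (F k w - f w))\<^sup>2)"
    proof (rule always_eventually, rule allI)
      fix k
      have i: "integrable M (\<lambda>w. (norm (G k w - F k w))\<^sup>2)" "integrable M (\<lambda>w. (norm (F k w - f w))\<^sup>2)"
         "integrable M (\<lambda>w. (norm (G k w - f w))\<^sup>2)"
        using L assms(2) L2D(2) L2_diff by blast+
      have "(LINT w|M. (norm (G k w - f w))\<^sup>2) \<le>
         (LINT w|M. 2 * (norm (G k w - F k w))\<^sup>2 + 2 * (norm (F k w - f w))\<^sup>2)"
        using i norm_add_sq_le[of "G k w - F k w" "F k w - f w" for w]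
        by (intro integral_mono) auto
      then show "norm (LINT w|M. (norm (G k w - f w))\<^sup>2) \<le>
        2 * (LINT w|M. (norm (G k w - F k w))\<^sup>2) + 2 * (LINT w|M. (norm (F k w - f w))\<^sup>2)"
        using i by simp
    qed
    show "(\<lambda>k. 2 * (LINT w|M. (norm (G k w - F k w))\<^sup>2) + 2 * (LINT w|M. (norm (F k w - f w))\<^sup>2)) \<longlonglongrightarrow> 0"
      using assms(1,3) by (auto simp: L2_tendsto_def intro!: tendsto_eq_intros)
  qed
  then show ?thesis using assms L by (simp add: L2_tendsto_def)
qed

lemma L2_tendsto_add:
  fixes F G :: "nat \<Rightarrow> 'a \<Rightarrow> 'b::{real_inner,second_countable_topology}"
  assumes F: "L2_tendsto M F f" and G: "L2_tendsto M G g"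
  shows "L2_tendsto M (\<lambda>k w. F k w + G k w) (\<lambda>w. f w + g w)"
proof (rule L2_tendsto_zeroI)
  have L: "\<And>k. F k \<in> L2 M" "f \<in> L2 M" "\<And>k. G k \<in> L2 M" "g \<in> L2 M"
    using F G by (auto simp: L2_tendsto_def)
  show "\<And>k. (\<lambda>w. F k w + G k w) \<in> L2 M" using L L2_add by blast
  show "L2_tendsto M (\<lambda>k w. F k w + g w) (\<lambda>w. f w + g w)"
    using F L by (auto simp: L2_tendsto_def L2_add)
  show "(\<lambda>k. LINT w|M. (norm (F k w + G k w - (F k w + g w)))\<^sup>2) \<longlonglongrightarrow> 0"
    using G by (auto simp: L2_tendsto_def)
qed

lemma L2_tendsto_bounded:
  fixes F :: "nat \<Rightarrow> 'a \<Rightarrow> 'b::{real_inner,second_countable_topology}"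
  assumes "L2_tendsto M F f"
  obtains K where "\<And>k. (LINT w|M. (norm (F k w))\<^sup>2) \<le> K"
proof -
  have "Bseq (\<lambda>k. LINT w|M. (norm (F k w))\<^sup>2)"
    by (rule convergent_imp_Bseq[OF convergentI[OF L2_tendsto_norm2[OF assms]]])
  from this[unfolded Bseq_def] obtain K where "\<forall>k. norm (LINT w|M. (norm (F k w))\<^sup>2) \<le> K" by auto
  then show thesis using that[of K] by simp
qed

lemma L2_tendsto_scaleR:
  fixes F :: "nat \<Rightarrow> 'a \<Rightarrow> 'b::{real_inner,second_countable_topology}"
  assumes "L2_tendsto M F f"
  shows "L2_tendsto M (\<lambda>k w. c *\<^sub>R F k w) (\<lambda>w. c *\<^sub>R f w)"
proof -
  have "(\<lambda>k. c\<^sup>2 * (LINT w|M. (norm (F k w - f w))\<^sup>2)) \<longlonglongrightarrow> 0"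
    using assms by (auto simp: L2_tendsto_def intro!: tendsto_eq_intros)
  then show ?thesis using assms
    by (auto simp: L2_tendsto_def L2_scaleR scaleR_diff_right[symmetric] power_mult_distrib)
qed

lemma L2_tendsto_cong_AE:
  fixes F G :: "nat \<Rightarrow> 'a \<Rightarrow> 'b::{real_inner,second_countable_topology}"
  assumes "L2_tendsto M F f" "\<And>k. AE w in M. F k w = G k w" "\<And>k. G k \<in> borel_measurable M"
  shows "L2_tendsto M G f"
proof (rule L2_tendsto_zeroI[OF assms(1)])
  have L: "\<And>k. F k \<in> L2 M" using assms by (auto simp: L2_tendsto_def)
  show G: "G k \<in> L2 M" for k
  proof (rule L2_dominated[OF L[of k] assms(3)[of k]])
    show "AE w in M. norm (G k w) \<le> 1 * norm (F k w)"
      using assms(2)[of k] by eventually_elim simp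
  qed
  have m1[measurable]: "F k \<in> borel_measurable M" and m2[measurable]: "G k \<in> borel_measurable M" for k
    using assms(3) L2D(1)[OF L] by auto
  have "(LINT w|M. (norm (G k w - F k w))\<^sup>2) = 0" for k
  proof -
    have "(LINT w|M. (norm (G k w - F k w))\<^sup>2) = (LINT w|M. 0)"
      by (intro integral_cong_AE)
         (use assms(2)[of k] m1[of k] m2[of k] in auto)
    then show ?thesis by simp
  qed
  then show "(\<lambda>k. LINT w|M. (norm (G k w - F k w))\<^sup>2) \<longlonglongrightarrow> 0" by simp
qed

lemma L2_tendsto_subseq: "L2_tendsto M F f \<Longrightarrow> strict_mono r \<Longrightarrow> L2_tendsto M (\<lambda>k. F (r k)) f"
  using LIMSEQ_subseq_LIMSEQ[of "\<lambda>k. LINT w|M. (norm (F k w - f w))\<^sup>2" 0 r]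
  by (auto simp: L2_tendsto_def o_def)

lemma L2_tendsto_AE_subseq:
  fixes F :: "nat \<Rightarrow> 'a \<Rightarrow> real"
  assumes "L2_tendsto M F f"
  shows "\<exists>r. strict_mono r \<and> (AE w in M. (\<lambda>k. F (r k) w) \<longlonglongrightarrow> f w)"
proof -
  have L: "\<And>k. (\<lambda>w. F k w - f w) \<in> L2 M" using assms L2_diff by (auto simp: L2_tendsto_def)
  obtain r :: "nat \<Rightarrow> nat" where r: "strict_mono r" "AE w in M. (\<lambda>k. (norm (F (r k) w - f w))\<^sup>2) \<longlonglongrightarrow> 0"
    using tendsto_L1_AE_subseq[of M "\<lambda>k w. (norm (F k w - f w))\<^sup>2"] assms L2D(2)[OF L]
    by (auto simp: L2_tendsto_def)
  have "AE w in M. (\<lambda>k. F (r k) w) \<longlonglongrightarrow> f w"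
    using r(2)
  proof eventually_elim
    case (elim w)
    then have "(\<lambda>k. F (r k) w - f w) \<longlonglongrightarrow> 0"
      using tendsto_real_sqrt[OF elim] by (simp add: tendsto_rabs_zero_iff)
    then show ?case using LIM_zero_iff by blast
  qed
  with r(1) show ?thesis by blast
qed

text \<open>The scalar products with fixed vectors determine weak convergence of a bounded sequence,
  since the simple functions are dense.\<close>

lemma L2_weak_tendsto:
  fixes F :: "nat \<Rightarrow> 'a \<Rightarrow> 'b::{real_inner,second_countable_topology}"
  assumes M: "finite_measure M"
    and F: "\<And>k. F k \<in> L2 M" and f: "f \<in> L2 M" and V: "V \<in> L2 M"
    and h: "\<And>h. L2_tendsto M (\<lambda>k w. h \<bullet> F k w) (\<lambda>w. h \<bullet> f w)"
    and bd: "\<And>k. (LINT w|M. (norm (F k w))\<^sup>2) \<le> C"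
  shows "(\<lambda>k. LINT w|M. F k w \<bullet> V w) \<longlonglongrightarrow> (LINT w|M. f w \<bullet> V w)"
proof -
  interpret finite_measure M by fact
  note [measurable] = L2D(1)[OF F] L2D(1)[OF f] L2D(1)[OF V]
  obtain S where S: "\<And>i. simple_function M (S i)" "\<And>w. w \<in> space M \<Longrightarrow> (\<lambda>i. S i w) \<longlonglongrightarrow> V w"
     "\<And>i w. w \<in> space M \<Longrightarrow> norm (S i w) \<le> 2 * norm (V w)"
    using borel_measurable_implies_sequence_metric[of V M 0] by (auto simp: dist_norm) metis
  note [measurable] = borel_measurable_simple_function[OF S(1)]
  have SL: "S i \<in> L2 M" for i
    by (rule L2_dominated[OF V, where C=2]) (use S(3) in auto)
  have dL: "(\<lambda>w. S i w - V w) \<in> L2 M" for i using SL V L2_diff by blast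
  \<comment> \<open>The constant 9 below is (2 + 1)^2, from
    \<open>norm (S i w) \<le> 2 * norm (V w)\<close>.\<close>
  have S0: "(\<lambda>i. LINT w|M. (norm (S i w - V w))\<^sup>2) \<longlonglongrightarrow> (LINT w|M. 0)"
  proof (rule integral_dominated_convergence[where w="\<lambda>w. 9 * (norm (V w))\<^sup>2"])
    show "integrable M (\<lambda>w. 9 * (norm (V w))\<^sup>2)" using L2D(2)[OF V] by simp
    show "AE w in M. (\<lambda>i. (norm (S i w - V w))\<^sup>2) \<longlonglongrightarrow> 0"
    proof (rule AE_I2)
      fix w assume "w \<in> space M"
      then have "(\<lambda>i. norm (S i w - V w)) \<longlonglongrightarrow> 0" using S(2) tendsto_norm_zero LIM_zero by blast
      then show "(\<lambda>i. (norm (S i w - V w))\<^sup>2) \<longlonglongrightarrow> 0" by (auto intro!: tendsto_eq_intros)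
    qed
    show "AE w in M. norm ((norm (S i w - V w))\<^sup>2) \<le> 9 * (norm (V w))\<^sup>2" for i
    proof (rule AE_I2)
      fix w assume "w \<in> space M"
      then have "norm (S i w - V w) \<le> 3 * norm (V w)"
        using S(3)[of w i] norm_triangle_ineq4[of "S i w" "V w"] by simp
      then have "(norm (S i w - V w))\<^sup>2 \<le> (3 * norm (V w))\<^sup>2" by (rule power_mono) simp
      then show "norm ((norm (S i w - V w))\<^sup>2) \<le> 9 * (norm (V w))\<^sup>2" by (simp add: power_mult_distrib)
    qed
  qed simp_all
  have simple: "(\<lambda>k. LINT w|M. F k w \<bullet> S i w) \<longlonglongrightarrow> (LINT w|M. f w \<bullet> S i w)" for i
  proof -
    define R where "R = S i ` space M"
    have fin: "finite R" using S(1) by (simp add: R_def simple_function_def)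
    have sets: "S i -` {v} \<inter> space M \<in> sets M" for v by measurable
    have IL: "(\<lambda>w. indicator (S i -` {v} \<inter> space M) w :: real) \<in> L2 M" for v
      by (rule L2_dominated[OF L2_const[of "1::real"], where C=1]) (use sets in \<open>auto simp: indicator_def\<close>)
    \<comment> \<open>Splitting by the finitely many values of \<open>S i\<close> leaves scalar
      products with fixed vectors, the only ones that the hypothesis controls.\<close>
    have rep: "g w \<bullet> S i w = (\<Sum>v\<in>R. (v \<bullet> g w) * indicator (S i -` {v} \<inter> space M) w)"
      if "w \<in> space M" for w and g :: "'a \<Rightarrow> 'b"
    proof -
      have "(\<Sum>v\<in>R. (v \<bullet> g w) * indicator (S i -` {v} \<inter> space M) w) =
          (\<Sum>v\<in>R. if S i w = v then v \<bullet> g w else 0)"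
        by (intro sum.cong) (auto simp: indicator_def that)
      also have "\<dots> = S i w \<bullet> g w" using fin that by (simp add: sum.delta R_def)
      finally show ?thesis by (simp add: inner_commute)
    qed
    have int: "(LINT w|M. g w \<bullet> S i w) = (\<Sum>v\<in>R. LINT w|M. (v \<bullet> g w) * indicator (S i -` {v} \<inter> space M) w)"
      if g: "g \<in> L2 M" for g
    proof -
      have "(\<lambda>w. v \<bullet> g w) \<in> L2 M" for v
        by (rule L2_dominated[OF g, where C="norm v"]) (use L2D(1)[OF g] in \<open>auto simp: Cauchy_Schwarz_ineq2\<close>)
      then have "integrable M (\<lambda>w. (v \<bullet> g w) * indicator (S i -` {v} \<inter> space M) w)" for v
        using L2_inner_integrable[OF _ IL[of v], of "\<lambda>w. v \<bullet> g w"] by simp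
      then have "(LINT w|M. (\<Sum>v\<in>R. (v \<bullet> g w) * indicator (S i -` {v} \<inter> space M) w)) =
          (\<Sum>v\<in>R. LINT w|M. (v \<bullet> g w) * indicator (S i -` {v} \<inter> space M) w)"
        by (intro Bochner_Integration.integral_sum)
      moreover have "(LINT w|M. g w \<bullet> S i w) =
          (LINT w|M. (\<Sum>v\<in>R. (v \<bullet> g w) * indicator (S i -` {v} \<inter> space M) w))"
        by (rule Bochner_Integration.integral_cong[OF refl]) (rule rep)
      ultimately show ?thesis by simp
    qed
    show ?thesis unfolding int[OF F] int[OF f]
    proof (rule tendsto_sum)
      fix v
      show "(\<lambda>k. LINT w|M. (v \<bullet> F k w) * indicator (S i -` {v} \<inter> space M) w) \<longlonglongrightarrow>
         (LINT w|M. (v \<bullet> f w) * indicator (S i -` {v} \<inter> space M) w)"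
        using L2_tendsto_inner[OF h[of v] L2_tendsto_const[OF IL[of v]]] by simp
    qed
  qed
  have "0 \<le> (LINT w|M. (norm (F 0 w))\<^sup>2)" by simp
  then have C: "C \<ge> 0" using bd[of 0] by linarith
  \<comment> \<open>The two errors made by replacing \<open>V\<close> by \<open>S i\<close> have
    this common factor, which is uniform in \<open>k\<close> by \<open>bd\<close>.\<close>
  define D where "D = sqrt C + sqrt (LINT w|M. (norm (f w))\<^sup>2)"
  have D: "D \<ge> 0" using C by (simp add: D_def)
  show ?thesis
  proof (rule LIMSEQ_I)
    fix e :: real assume e: "e > 0"
    have "(\<lambda>i. sqrt (LINT w|M. (norm (S i w - V w))\<^sup>2)) \<longlonglongrightarrow> 0"
      using tendsto_real_sqrt[OF S0] by simp
    then have "(\<lambda>i. D * sqrt (LINT w|M. (norm (S i w - V w))\<^sup>2)) \<longlonglongrightarrow> 0"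
      by (rule tendsto_mult_right_zero)
    then have "\<forall>\<^sub>F i in sequentially. D * sqrt (LINT w|M. (norm (S i w - V w))\<^sup>2) < e / 2"
      using e by (intro order_tendstoD) auto
    then obtain i where i: "D * sqrt (LINT w|M. (norm (S i w - V w))\<^sup>2) < e / 2"
      by (auto simp: eventually_sequentially)
    obtain n where n: "\<And>k. k \<ge> n \<Longrightarrow>
        norm ((LINT w|M. F k w \<bullet> S i w) - (LINT w|M. f w \<bullet> S i w)) < e / 2"
      using LIMSEQ_D[OF simple[of i], of "e / 2"] e by auto
    show "\<exists>no. \<forall>k\<ge>no. norm ((LINT w|M. F k w \<bullet> V w) - (LINT w|M. f w \<bullet> V w)) < e"
    proof (intro exI allI impI)
      fix k assume k: "k \<ge> n"
      have split: "(LINT w|M. g w \<bullet> V w) = (LINT w|M. g w \<bullet> S i w) - (LINT w|M. g w \<bullet> (S i w - V w))"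
        if "g \<in> L2 M" for g
        using L2_inner_integrable[OF that SL[of i]] L2_inner_integrable[OF that V]
        by (simp add: inner_diff)
      have "\<bar>\<integral>w. F k w \<bullet> (S i w - V w) \<partial>M\<bar> \<le> sqrt C * sqrt (LINT w|M. (norm (S i w - V w))\<^sup>2)"
      proof -
        have "sqrt (LINT w|M. (norm (F k w))\<^sup>2) * sqrt (LINT w|M. (norm (S i w - V w))\<^sup>2) \<le>
            sqrt C * sqrt (LINT w|M. (norm (S i w - V w))\<^sup>2)"
          using bd[of k] by (intro mult_right_mono) auto
        then show ?thesis using L2_Cauchy_Schwarz[OF F dL, of k i] by linarith
      qed
      moreover have "\<bar>\<integral>w. f w \<bullet> (S i w - V w) \<partial>M\<bar> \<le> 
        sqrt (LINT w|M. (norm (f w))\<^sup>2) * sqrt (LINT w|M. (norm (S i w - V w))\<^sup>2)"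
        using L2_Cauchy_Schwarz[OF f dL] .
      ultimately have "\<bar>\<integral>w. F k w \<bullet> (S i w - V w) \<partial>M\<bar> + \<bar>\<integral>w. f w \<bullet> (S i w - V w) \<partial>M\<bar> < e / 2"
        using i unfolding D_def by (simp add: algebra_simps)
      then show "norm ((LINT w|M. F k w \<bullet> V w) - (LINT w|M. f w \<bullet> V w)) < e"
        using n[OF k] unfolding split[OF F] split[OF f] real_norm_def by linarith
    qed
  qed
qed

section \<open>Isonormal Gaussian processes\<close>

text \<open>At \<open>t = 0\<close> the hypothesis says that both weights have the same mass
  \<open>m\<close>. If \<open>m > 0\<close>, then \<open>w1 / m\<close> and \<open>w2 / m\<close>
  are probability densities under which \<open>V\<close> has the same characteristic function, hence
  the same law. If \<open>m = 0\<close>, both weights vanish almost surely.\<close>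

lemma (in prob_space) integral_weight_eqI_char:
  fixes V w1 w2 :: "'a \<Rightarrow> real"
  assumes [measurable]: "V \<in> borel_measurable M" "w1 \<in> borel_measurable M" "w2 \<in> borel_measurable M"
    and w1: "\<And>x. 0 \<le> w1 x" "\<And>x. w1 x \<le> C" and w2: "\<And>x. 0 \<le> w2 x" "\<And>x. w2 x \<le> C"
    and char: "\<And>t. (LINT x|M. w1 x * iexp (t * V x)) = (LINT x|M. w2 x * iexp (t * V x))"
    and A[measurable]: "A \<in> sets borel"
  shows "(LINT x|M. w1 x * indicator A (V x)) = (LINT x|M. w2 x * indicator A (V x))"
proof -
  have int: "integrable M w1" "integrable M w2"
    using w1 w2 by (auto intro!: integrable_const_bound[where B=C])
  define m where "m = (LINT x|M. w1 x)"
  have m2: "m = (LINT x|M. w2 x)"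
  proof -
    have "complex_of_real (LINT x|M. w1 x) = complex_of_real (LINT x|M. w2 x)"
      using char[of 0] by simp
    then show ?thesis unfolding m_def of_real_eq_iff .
  qed
  have m0: "m \<ge> 0" using w1 by (simp add: m_def)
  show ?thesis
  proof (cases "m = 0")
    case True
    have "AE x in M. w1 x = 0" "AE x in M. w2 x = 0"
      using integral_nonneg_eq_0_iff_AE[OF int(1)] integral_nonneg_eq_0_iff_AE[OF int(2)] w1 w2 True m2
      by (auto simp: m_def)
    then have "AE x in M. w1 x * indicator A (V x) = 0" "AE x in M. w2 x * indicator A (V x) = 0"
      by (eventually_elim, simp)+
    then have "(LINT x|M. w1 x * indicator A (V x)) = 0" "(LINT x|M. w2 x * indicator A (V x)) = 0"
      by (auto intro: integral_eq_zero_AE)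
    then show ?thesis by simp
  next
    case False
    with m0 have m: "m > 0" by simp
    define D where "D w = distr (density M (\<lambda>x. ennreal (w x / m))) borel V" for w
    have rd: "real_distribution (D w)" if [measurable]: "w \<in> borel_measurable M"
      and w: "\<And>x. 0 \<le> w x" "integrable M w" "m = (LINT x|M. w x)" for w
    proof -
      have "(\<integral>\<^sup>+x. ennreal (w x / m) \<partial>M) = ennreal (LINT x|M. w x / m)"
        using w m by (intro nn_integral_eq_integral) auto
      also have "\<dots> = 1" using w(3) m by simp
      finally have "prob_space (density M (\<lambda>x. ennreal (w x / m)))"
        by (intro prob_spaceI) (simp add: emeasure_density cong: nn_integral_cong)
      then show ?thesis unfolding D_def
        by (intro prob_space.real_distribution_distr) auto
    qed
    have ch: "char (D w) t = (LINT x|M. w x * iexp (t * V x)) / m"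
      if [measurable]: "w \<in> borel_measurable M" and w: "\<And>x. 0 \<le> w x" for w t
    proof -
      have "char (D w) t = (LINT x|M. (w x / m) *\<^sub>R iexp (t * V x))"
        using w m unfolding char_def D_def
        by (subst integral_distr) (auto simp: integral_density)
      also have "\<dots> = (LINT x|M. w x * iexp (t * V x) / m)"
        by (simp add: scaleR_conv_of_real)
      finally show ?thesis by simp
    qed
    have me: "measure (D w) A = (LINT x|M. w x * indicator A (V x)) / m"
      if [measurable]: "w \<in> borel_measurable M" and w: "\<And>x. 0 \<le> w x" for w
    proof -
      have "measure (D w) A = (LINT x|(D w). indicator A x)"
        by (simp add: D_def)
      also have "\<dots> = (LINT x|M. (w x / m) * indicator A (V x))"
        using w m unfolding D_def
        by (subst integral_distr) (auto simp: integral_density)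
      finally show ?thesis by simp
    qed
    have "D w1 = D w2"
      using rd[of w1] rd[of w2] int w1 w2 m2 char
      by (intro Levy_uniqueness) (auto simp: m_def ch fun_eq_iff)
    then show ?thesis using me[of w1] me[of w2] w1 w2 m by simp
  qed
qed

text \<open>Reduction to nonnegative weights: a real weight bounded by \<open>C\<close> becomes
  nonnegative after adding \<open>C\<close>. The real part of a complex weight is reached through
  its conjugate, whose transform at \<open>t\<close> is the conjugate of the transform at
  \<open>- t\<close>; the imaginary part is the real part after multiplication by
  \<open>- \<i>\<close>.\<close>

lemma (in prob_space) integral_bounded_eqI_char:
  fixes V :: "'a \<Rightarrow> real" and u v :: "'a \<Rightarrow> complex"
  assumes [measurable]: "V \<in> borel_measurable M" "u \<in> borel_measurable M" "v \<in> borel_measurable M"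
    and u: "\<And>x. norm (u x) \<le> C" and v: "\<And>x. norm (v x) \<le> C"
    and char: "\<And>t. (LINT x|M. u x * iexp (t * V x)) = (LINT x|M. v x * iexp (t * V x))"
    and A[measurable]: "A \<in> sets borel"
  shows "(LINT x|M. u x * indicator A (V x)) = (LINT x|M. v x * indicator A (V x))"
proof -
  have int: "integrable M (\<lambda>x. f x * iexp (t * V x))" "integrable M (\<lambda>x. cnj (f x) * iexp (t * V x))"
     "integrable M (\<lambda>x. f x * indicator A (V x))"
    if [measurable]: "f \<in> borel_measurable M" and f: "\<And>x. norm (f x) \<le> C" for f :: "'a \<Rightarrow> complex" and t
  proof -
    have [measurable]: "(\<lambda>x. cnj (f x)) \<in> borel_measurable M"
      by (rule borel_measurable_continuous_on[where f=cnj]) (auto intro: continuous_intros)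
    show "integrable M (\<lambda>x. f x * iexp (t * V x))" "integrable M (\<lambda>x. cnj (f x) * iexp (t * V x))"
        "integrable M (\<lambda>x. f x * indicator A (V x))"
      using f order_trans[OF norm_ge_zero f]
      by (auto intro!: integrable_const_bound[where B=C] simp: norm_mult indicator_def)
  qed
  have rint: "integrable M g" if "g \<in> borel_measurable M" "\<And>x. \<bar>g x\<bar> \<le> C" for g :: "'a \<Rightarrow> real"
    using that by (auto intro!: integrable_const_bound[where B=C])
  have cnj: "(LINT x|M. cnj (f x) * iexp (t * V x)) = cnj (LINT x|M. f x * iexp (- t * V x))"
    for f :: "'a \<Rightarrow> complex" and t
  proof -
    have "cnj (LINT x|M. f x * iexp (- t * V x)) = (LINT x|M. cnj (f x * iexp (- t * V x)))"
      by (subst Bochner_Integration.integral_cnj) (rule refl)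
    also have "\<dots> = (LINT x|M. cnj (f x) * iexp (t * V x))"
      by (simp add: exp_cnj)
    finally show ?thesis by simp
  qed
  have real: "(LINT x|M. f x * indicator A (V x)) = (LINT x|M. g x * indicator A (V x))"
    if [measurable]: "f \<in> borel_measurable M" "g \<in> borel_measurable M"
    and f: "\<And>x. \<bar>f x\<bar> \<le> C" and g: "\<And>x. \<bar>g x\<bar> \<le> C"
    and fg: "\<And>t. (LINT x|M. f x * iexp (t * V x)) = (LINT x|M. g x * iexp (t * V x))" for f g :: "'a \<Rightarrow> real"
  proof -
    have C: "C \<ge> 0" using f[of undefined] by linarith
    have i: "integrable M (\<lambda>x. of_real (f x) * iexp (t * V x))" "integrable M (\<lambda>x. of_real (g x) * iexp (t * V x))"
       "integrable M (\<lambda>x. of_real C * iexp (t * V x))" for t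
      using int(1)[of "\<lambda>x. of_real (f x)" t] int(1)[of "\<lambda>x. of_real (g x)" t]
        int(1)[of "\<lambda>x. of_real C" t] f g C by simp_all
    have ir: "integrable M (\<lambda>x. h x * indicator A (V x))"
      if [measurable]: "h \<in> borel_measurable M" and h: "\<And>x. \<bar>h x\<bar> \<le> C" for h
    proof (rule rint)
      show "\<bar>h x * indicator A (V x)\<bar> \<le> C" for x using h[of x] C by (simp add: indicator_def)
    qed measurable
    have "(LINT x|M. (f x + C) * indicator A (V x)) = (LINT x|M. (g x + C) * indicator A (V x))"
    proof (rule integral_weight_eqI_char[where C="2 * C"])
      show "0 \<le> f x + C" "0 \<le> g x + C" "f x + C \<le> 2 * C" "g x + C \<le> 2 * C" for x
        using f[of x] g[of x] by auto
      show "(LINT x|M. complex_of_real (f x + C) * iexp (t * V x)) =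
            (LINT x|M. complex_of_real (g x + C) * iexp (t * V x))" for t
        using i[of t] fg[of t] by (simp add: distrib_right)
    qed measurable
    then show ?thesis using ir[of f] ir[of g] ir[of "\<lambda>_. C"] f g C by (simp add: distrib_right)
  qed
  have re: "(LINT x|M. Re (f x) * indicator A (V x)) = (LINT x|M. Re (g x) * indicator A (V x))"
    if f: "f \<in> borel_measurable M" "\<And>x. norm (f x) \<le> C" and g: "g \<in> borel_measurable M" "\<And>x. norm (g x) \<le> C"
    and fg: "\<And>t. (LINT x|M. f x * iexp (t * V x)) = (LINT x|M. g x * iexp (t * V x))" for f g
  proof (rule real)
    note [measurable] = f(1) g(1)
    show "(\<lambda>x. Re (f x)) \<in> borel_measurable M" "(\<lambda>x. Re (g x)) \<in> borel_measurable M" by measurable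
    show "\<bar>Re (f x)\<bar> \<le> C" "\<bar>Re (g x)\<bar> \<le> C" for x
      using f(2)[of x] g(2)[of x] abs_Re_le_cmod[of "f x"] abs_Re_le_cmod[of "g x"] by auto
    have *: "(LINT x|M. complex_of_real (Re (h x)) * iexp (t * V x)) =
       ((LINT x|M. h x * iexp (t * V x)) + (LINT x|M. cnj (h x) * iexp (t * V x))) / 2"
      if h: "h \<in> borel_measurable M" "\<And>x. norm (h x) \<le> C" for h t
    proof -
      have z: "complex_of_real (Re z) = (z + cnj z) / 2" for z
        by (simp add: complex_add_cnj)
      have "(LINT x|M. complex_of_real (Re (h x)) * iexp (t * V x)) =
         (LINT x|M. (h x * iexp (t * V x) + cnj (h x) * iexp (t * V x)) / 2)"
        by (intro Bochner_Integration.integral_cong refl) (simp only: z distrib_right times_divide_eq_left)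
      then show ?thesis
        using int(1,2)[OF h, of t] by simp
    qed
    show "(LINT x|M. complex_of_real (Re (f x)) * iexp (t * V x)) =
       (LINT x|M. complex_of_real (Re (g x)) * iexp (t * V x))" for t
      unfolding *[OF f] *[OF g] cnj fg ..
  qed
  have im: "(LINT x|M. Im (u x) * indicator A (V x)) = (LINT x|M. Im (v x) * indicator A (V x))"
    using re[of "\<lambda>x. - \<i> * u x" "\<lambda>x. - \<i> * v x"] u v char by (simp add: norm_mult mult.assoc)
  have "Re (LINT x|M. f x * indicator A (V x)) = (LINT x|M. Re (f x) * indicator A (V x))"
    "Im (LINT x|M. f x * indicator A (V x)) = (LINT x|M. Im (f x) * indicator A (V x))"
    if "f \<in> borel_measurable M" "\<And>x. norm (f x) \<le> C" for f :: "'a \<Rightarrow> complex"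
  proof -
    have *: "Re (f x * indicator A (V x)) = Re (f x) * indicator A (V x)"
      "Im (f x * indicator A (V x)) = Im (f x) * indicator A (V x)" for x
      by (simp_all add: indicator_def)
    show "Re (LINT x|M. f x * indicator A (V x)) = (LINT x|M. Re (f x) * indicator A (V x))"
      "Im (LINT x|M. f x * indicator A (V x)) = (LINT x|M. Im (f x) * indicator A (V x))"
      using integral_Re[OF int(3)[OF that]] integral_Im[OF int(3)[OF that]] by (simp_all only: *)
  qed
  from this[OF assms(2) u] this[OF assms(3) v] re[OF assms(2) u assms(3) v char] im show ?thesis
    by (simp add: complex_eq_iff)
qed

lemma (in prob_space) expectation_indicator:
  assumes [measurable]: "f \<in> measurable M N" "B \<in> sets N"
  shows "(LINT w|M. indicator B (f w)) = prob {w\<in>space M. f w \<in> B}"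
proof -
  have "(LINT w|M. indicator B (f w)) = (\<integral>w. indicator {w\<in>space M. f w \<in> B} w \<partial>M :: real)"
    by (intro Bochner_Integration.integral_cong) (auto simp: indicator_def)
  also have "\<dots> = prob ({w\<in>space M. f w \<in> B} \<inter> space M)" by simp
  also have "{w\<in>space M. f w \<in> B} \<inter> space M = {w\<in>space M. f w \<in> B}" by auto
  finally show ?thesis .
qed

section \<open>Gaussian laws, almost sure linearity, and independence of orthogonal
  directions\<close>

locale isonormal = prob_space M
  for M :: "'a measure" +
  fixes W :: "'h::{real_inner,second_countable_topology} \<Rightarrow> 'a \<Rightarrow> real"
  assumes isonormal: "isonormal_process M W"
begin

lemma centered_gaussian_W: "centered_gaussian M (W h)"
proof -
  have "finite S \<Longrightarrow> centered_gaussian M (\<lambda>w. \<Sum>h\<in>S. c h * W h w)" for S c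
    using isonormal by (simp add: isonormal_process_def)
  from this[of "{h}" "\<lambda>_. 1"] show ?thesis by simp
qed

lemma measurable_W[measurable]: "W h \<in> borel_measurable M"
  using centered_gaussian_W[of h] unfolding centered_gaussian_def by (rule conjunct1)

lemma W_cases:
  obtains "AE w in M. W h w = 0"
  | \<sigma> where "\<sigma> > 0" "distributed M lborel (W h) (\<lambda>x. ennreal (normal_density 0 \<sigma> x))"
proof -
  have "(AE w in M. W h w = 0) \<or>
      (\<exists>\<sigma>>0. distributed M lborel (W h) (\<lambda>x. ennreal (normal_density 0 \<sigma> x)))"
    using centered_gaussian_W[of h] unfolding centered_gaussian_def by (rule conjunct2)
  then show thesis
  proof (elim disjE exE conjE)
    assume "AE w in M. W h w = 0"
    then show thesis by (rule that(1))
  next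
    fix \<sigma> :: real
    assume "\<sigma> > 0" "distributed M lborel (W h) (\<lambda>x. ennreal (normal_density 0 \<sigma> x))"
    then show thesis by (rule that(2))
  qed
qed

lemma integrable_W_power: "integrable M (\<lambda>w. \<bar>W h w\<bar> ^ p)"
proof (cases rule: W_cases[of h])
  case 1
  then have "integrable M (\<lambda>w. \<bar>W h w\<bar> ^ p) \<longleftrightarrow> integrable M (\<lambda>w. 0 ^ p :: real)"
    by (intro integrable_cong_AE) auto
  then show ?thesis by simp
next
  case (2 s)
  have "integrable lborel (\<lambda>x. normal_density 0 s x * \<bar>x\<bar> ^ p)"
    using integrable_normal_moment_abs[OF 2(1), of 0 p] by simp
  then show ?thesis
    using distributed_integrable[OF 2(2), of "\<lambda>x. \<bar>x\<bar> ^ p"] by simp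
qed

lemma W_L2: "W h \<in> L2 M"
proof -
  have "integrable M (\<lambda>w. (norm (W h w))\<^sup>2)" using integrable_W_power[of h 2] by simp
  then show ?thesis using measurable_W[of h] by (simp add: L2_def)
qed

lemma W_cov: "(LINT w|M. W h w * W k w) = h \<bullet> k"
  using isonormal unfolding isonormal_process_def by (elim conjE allE)

lemma integrable_W_W: "integrable M (\<lambda>w. W h w * W k w)"
  using L2_inner_integrable[OF W_L2 W_L2] by simp

text \<open>Expanding the square by the covariance shows that the difference of the two sides has
  second moment zero. Linearity thus holds almost surely, with an exceptional set that depends on
  the combination.\<close>

lemma W_linear: "AE w in M. W (r + s *\<^sub>R h) w = W r w + s * W h w"
proof -
  let ?d = "\<lambda>w. W (r + s *\<^sub>R h) w - W r w - s * W h w"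
  have "(\<lambda>w. (?d w)\<^sup>2) = (\<lambda>w. W (r + s *\<^sub>R h) w * W (r + s *\<^sub>R h) w + W r w * W r w + s * s * (W h w * W h w)
     - 2 * (W (r + s *\<^sub>R h) w * W r w) - 2 * s * (W (r + s *\<^sub>R h) w * W h w) + 2 * s * (W r w * W h w))"
    by (auto simp: power2_eq_square algebra_simps)
  then have i: "integrable M (\<lambda>w. (?d w)\<^sup>2)" "(LINT w|M. (?d w)\<^sup>2) = 0"
    by (simp_all add: integrable_W_W W_cov inner_add inner_commute algebra_simps)
  then have "AE w in M. (?d w)\<^sup>2 = 0"
    using integral_nonneg_eq_0_iff_AE[OF i(1)] by simp
  then show ?thesis by eventually_elim simp
qed

lemma W_zero: "AE w in M. W 0 w = 0"
proof -
  have "AE w in M. W 0 w * W 0 w = 0"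
    using integral_nonneg_eq_0_iff_AE[OF integrable_W_W[of 0 0]] W_cov[of 0 0] by simp
  then show ?thesis by eventually_elim simp
qed

text \<open>The degenerate alternative would give variance 0 for a nonzero \<open>h\<close>; in the
  other one the covariance identifies the standard deviation as \<open>norm h\<close>.\<close>

lemma W_distributed:
  assumes "h \<noteq> 0"
  shows "distributed M lborel (W h) (\<lambda>x. ennreal (normal_density 0 (norm h) x))"
proof (cases rule: W_cases[of h])
  case 1
  then have "AE w in M. W h w * W h w = 0"
    by eventually_elim simp
  then have "(LINT w|M. W h w * W h w) = 0"
    by (rule integral_eq_zero_AE)
  then show ?thesis using assms by (simp add: W_cov)
next
  case (2 s)
  have "variance (W h) = s\<^sup>2" "expectation (W h) = 0"
    using normal_distributed_variance[OF 2] normal_distributed_expectation[OF 2] by auto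
  then have "(LINT w|M. (W h w)\<^sup>2) = s\<^sup>2" by simp
  moreover have "(LINT w|M. (W h w)\<^sup>2) = (norm h)\<^sup>2"
    unfolding power2_norm_eq_inner using W_cov[of h h] by (simp only: power2_eq_square)
  ultimately have "s = norm h" using 2(1) by simp
  then show ?thesis using 2 by simp
qed

lemma W_char: "(LINT w|M. iexp (W h w)) = exp (- (norm h)\<^sup>2 / 2)"
proof (cases "h = 0")
  case True
  have "AE w in M. iexp (W h w) = 1"
    using W_zero unfolding True by eventually_elim simp
  then have "(LINT w|M. iexp (W h w)) = (LINT w|M. 1)"
    by (intro integral_cong_AE) auto
  then show ?thesis using True by (simp add: prob_space)
next
  case False
  let ?s = "norm h"
  have "distributed M lborel (\<lambda>w. (W h w - 0) / ?s) (\<lambda>x. ennreal (std_normal_density x))"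
    using W_distributed[OF False] False by (subst (asm) normal_standard_normal_convert) auto
  then have d: "distr M lborel (\<lambda>w. W h w / ?s) = std_normal_distribution"
    by (simp add: distributed_def)
  have "(LINT w|M. iexp (W h w)) = (LINT x|(distr M lborel (\<lambda>w. W h w / ?s)). iexp (?s * x))"
    using False by (subst integral_distr) auto
  also have "\<dots> = exp (- ?s\<^sup>2 / 2)"
    using fun_cong[OF char_std_normal_distribution, of ?s] unfolding d char_def .
  finally show ?thesis .
qed


text \<open>Orthogonality implies independence: by uniqueness of characteristic functions, the exponentials
  of the variables \<open>W (rr i)\<close> can be replaced by indicators one at a time.\<close>

lemma integral_prod_indicator_iexp:
  assumes "finite K" "\<And>i. i \<in> K \<Longrightarrow> rr i \<bullet> h = 0" "\<And>i. A i \<in> sets borel" "r \<bullet> h = 0"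
  shows "(LINT w|M. of_real (\<Prod>i\<in>K. indicator (A i) (W (rr i) w)) * iexp (W (r + s *\<^sub>R h) w)) =
    of_real (exp (- (norm (s *\<^sub>R h))\<^sup>2 / 2)) *
      (LINT w|M. of_real (\<Prod>i\<in>K. indicator (A i) (W (rr i) w)) * iexp (W r w))"
  using assms
proof (induction K arbitrary: r rule: finite_induct)
  case empty
  have "(norm (r + s *\<^sub>R h))\<^sup>2 = (norm (s *\<^sub>R h))\<^sup>2 + (norm r)\<^sup>2"
    unfolding power2_norm_eq_inner using empty.prems(3)
    by (simp add: inner_add inner_commute)
  then have "exp (- (norm (r + s *\<^sub>R h))\<^sup>2 / 2) = exp (- (norm (s *\<^sub>R h))\<^sup>2 / 2) * exp (- (norm r)\<^sup>2 / 2)"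
    by (simp add: exp_add[symmetric] diff_divide_distrib[symmetric])
  then show ?case
    by (simp only: prod.empty of_real_1 mult_1_left W_char of_real_mult)
next
  case (insert x K)
  note [measurable] = insert.prems(2)
  define c :: "'a \<Rightarrow> real" where "c w = (\<Prod>i\<in>K. indicator (A i) (W (rr i) w))" for w
  have [measurable]: "c \<in> borel_measurable M" unfolding c_def by measurable
  have c: "\<bar>c w\<bar> \<le> 1" for w
    unfolding c_def by (auto intro!: prod_le_1 simp: abs_prod indicator_def)
  define e where "e = exp (- (norm (s *\<^sub>R h))\<^sup>2 / 2)"
  have e: "0 \<le> e" "e \<le> 1" by (auto simp: e_def)
  \<comment> \<open>The induction leaves \<open>r\<close> free, so it applies to
    \<open>r + t *\<^sub>R rr x\<close> for every \<open>t\<close>. As a function of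
    \<open>t\<close> this compares the transforms of \<open>W (rr x)\<close> under two complex
    weights.\<close>
  have IH: "(LINT w|M. c w * iexp (W (r' + s *\<^sub>R h) w)) = e * (LINT w|M. c w * iexp (W r' w))"
    if "r' \<bullet> h = 0" for r'
    using insert.IH[OF _ insert.prems(2) that] insert.prems(1) by (simp add: c_def e_def)
  have "(LINT w|M. (c w * iexp (W (r + s *\<^sub>R h) w)) * indicator (A x) (W (rr x) w)) =
      (LINT w|M. (e * (c w * iexp (W r w))) * indicator (A x) (W (rr x) w))"
  proof (rule integral_bounded_eqI_char[where C=1])
    fix t
    have eq: "r + t *\<^sub>R rr x + s *\<^sub>R h = r + s *\<^sub>R h + t *\<^sub>R rr x" by simp
    have "AE w in M. W (r + t *\<^sub>R rr x + s *\<^sub>R h) w = W (r + s *\<^sub>R h) w + t * W (rr x) w"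
      unfolding eq by (rule W_linear)
    then have "(LINT w|M. c w * iexp (W (r + s *\<^sub>R h) w) * iexp (t * W (rr x) w)) =
       (LINT w|M. c w * iexp (W (r + t *\<^sub>R rr x + s *\<^sub>R h) w))"
      by (intro integral_cong_AE) (auto simp: exp_add[symmetric] distrib_left)
    also have "\<dots> = e * (LINT w|M. c w * iexp (W (r + t *\<^sub>R rr x) w))"
      using insert.prems by (intro IH) (simp add: inner_add)
    also have "(LINT w|M. c w * iexp (W (r + t *\<^sub>R rr x) w)) =
         (LINT w|M. c w * iexp (W r w) * iexp (t * W (rr x) w))"
      using W_linear[of r t "rr x"]
      by (intro integral_cong_AE) (auto simp: exp_add[symmetric] distrib_left)
    also have "e * \<dots> = (LINT w|M. e * (c w * iexp (W r w)) * iexp (t * W (rr x) w))"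
      by (simp add: mult.assoc)
    finally show "(LINT w|M. c w * iexp (W (r + s *\<^sub>R h) w) * iexp (t * W (rr x) w)) =
       (LINT w|M. e * (c w * iexp (W r w)) * iexp (t * W (rr x) w))" .
  qed (use c e in \<open>auto simp: norm_mult intro: mult_le_one\<close>)
  moreover have ins: "complex_of_real (\<Prod>i\<in>insert x K. indicator (A i) (W (rr i) w)) =
      complex_of_real (c w) * indicator (A x) (W (rr x) w)" for w
    using insert.hyps by (simp add: c_def indicator_def)
  moreover have "(LINT w|M. (e * (c w * iexp (W r w))) * indicator (A x) (W (rr x) w)) =
      e * (LINT w|M. complex_of_real (c w) * indicator (A x) (W (rr x) w) * iexp (W r w))"
  proof -
    have "(LINT w|M. (e * (c w * iexp (W r w))) * indicator (A x) (W (rr x) w)) =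
      (LINT w|M. e * (complex_of_real (c w) * indicator (A x) (W (rr x) w) * iexp (W r w)))"
      by (intro Bochner_Integration.integral_cong refl) (simp only: mult_ac)
    then show ?thesis by (simp only: integral_mult_right_zero)
  qed
  moreover have "(LINT w|M. (c w * iexp (W (r + s *\<^sub>R h) w)) * indicator (A x) (W (rr x) w)) =
     (LINT w|M. complex_of_real (c w) * indicator (A x) (W (rr x) w) * iexp (W (r + s *\<^sub>R h) w))"
    by (intro Bochner_Integration.integral_cong refl) (simp only: mult_ac)
  ultimately show ?case unfolding ins e_def by metis
qed

text \<open>With \<open>r = 0\<close> the previous identity says that the transform of
  \<open>W h\<close> under the weight \<open>c\<close> is the one under the constant weight
  \<open>m\<close>, the mean of \<open>c\<close>. Uniqueness then turns the exponential into the
  indicator of \<open>B\<close>.\<close>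

lemma integral_prod_indicator_indep:
  assumes K: "finite K" "\<And>i. i \<in> K \<Longrightarrow> rr i \<bullet> h = 0"
    and A[measurable]: "\<And>i. A i \<in> sets borel" and B[measurable]: "B \<in> sets borel"
  shows "(LINT w|M. (\<Prod>i\<in>K. indicat_real (A i) (W (rr i) w)) * indicator B (W h w)) =
    (LINT w|M. (\<Prod>i\<in>K. indicator (A i) (W (rr i) w))) * (LINT w|M. indicator B (W h w))"
proof -
  define c :: "'a \<Rightarrow> real" where "c w = (\<Prod>i\<in>K. indicator (A i) (W (rr i) w))" for w
  have [measurable]: "c \<in> borel_measurable M" unfolding c_def by measurable
  have c: "0 \<le> c w" "c w \<le> 1" for w
    unfolding c_def by (auto intro!: prod_le_1 prod_nonneg simp: indicator_def)
  define m where "m = (LINT w|M. c w)"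
  have ic: "integrable M c" using c by (auto intro!: integrable_const_bound[where B=1])
  have m: "0 \<le> m" "m \<le> 1"
    using c ic integral_mono[of M c "\<lambda>_. 1"] by (auto simp: m_def prob_space)
  have "(LINT w|M. complex_of_real (c w) * indicator B (W h w)) =
      (LINT w|M. complex_of_real m * indicator B (W h w))"
  proof (rule integral_bounded_eqI_char[where C=1])
    fix t
    have th: "AE w in M. W (t *\<^sub>R h) w = t * W h w"
      using W_linear[of 0 t h] W_zero by eventually_elim simp
    have "(LINT w|M. c w * iexp (t * W h w)) = (LINT w|M. c w * iexp (W (0 + t *\<^sub>R h) w))"
      using th by (intro integral_cong_AE) auto
    also have "\<dots> = of_real (exp (- (norm (t *\<^sub>R h))\<^sup>2 / 2)) * (LINT w|M. c w * iexp (W 0 w))"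
      using integral_prod_indicator_iexp[OF K A, where r=0 and s=t] by (simp add: c_def)
    also have "(LINT w|M. c w * iexp (W 0 w)) = (LINT w|M. of_real (c w))"
      using W_zero by (intro integral_cong_AE) auto
    also have "\<dots> = of_real m" by (simp add: m_def)
    also have "of_real (exp (- (norm (t *\<^sub>R h))\<^sup>2 / 2)) = (LINT w|M. iexp (W (t *\<^sub>R h) w))"
      by (simp only: W_char)
    also have "(LINT w|M. iexp (W (t *\<^sub>R h) w)) = (LINT w|M. iexp (t * W h w))"
      using th by (intro integral_cong_AE) auto
    finally show "(LINT w|M. complex_of_real (c w) * iexp (t * W h w)) = (LINT w|M. complex_of_real m * iexp (t * W h w))"
      by simp
  qed (use c m in auto)
  moreover have "complex_of_real y * indicator B x = complex_of_real (y * indicator B x)" for x y :: real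
    by (simp add: indicator_def)
  ultimately have "complex_of_real (LINT w|M. c w * indicator B (W h w)) =
      complex_of_real (LINT w|M. m * indicator B (W h w))"
    by (simp only: integral_complex_of_real)
  then show ?thesis unfolding of_real_eq_iff by (simp add: c_def m_def)
qed

lemma distr_pair_orthogonal:
  assumes K: "finite K" "\<And>i. i \<in> K \<Longrightarrow> rr i \<bullet> h = 0"
  defines "V \<equiv> (\<lambda>w. \<lambda>i\<in>K. W (rr i) w)"
  shows "distr M borel (W h) \<Otimes>\<^sub>M distr M (Pi\<^sub>M K (\<lambda>_. borel)) V =
    distr M (borel \<Otimes>\<^sub>M Pi\<^sub>M K (\<lambda>_. borel)) (\<lambda>w. (W h w, V w))"
proof -
  let ?P = "Pi\<^sub>M K (\<lambda>_. borel :: real measure)"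
  have V[measurable]: "V \<in> measurable M ?P" unfolding V_def by measurable
  interpret X: prob_space "distr M borel (W h)" by (rule prob_space_distr) simp
  interpret Y: prob_space "distr M ?P V" by (rule prob_space_distr) simp
  interpret XY: pair_prob_space "distr M borel (W h)" "distr M ?P V" ..
  have *: "emeasure M ({w\<in>space M. W h w \<in> B} \<inter> {w\<in>space M. V w \<in> E}) =
      emeasure M {w\<in>space M. W h w \<in> B} * emeasure M {w\<in>space M. V w \<in> E}"
    if B[measurable]: "B \<in> sets borel" and E[measurable]: "E \<in> sets ?P" for B E
  proof -
    define p :: real where "p = (LINT w|M. indicator B (W h w))"
    have p: "p = prob {w\<in>space M. W h w \<in> B}"
      unfolding p_def by (rule expectation_indicator) measurable
    have p0: "p \<ge> 0" by (simp add: p)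
    define D where "D f = distr (density M (\<lambda>w. ennreal (f w))) ?P V" for f
    have D: "emeasure (D f) E = ennreal (LINT w|M. f w * indicator E (V w))"
      if [measurable]: "f \<in> borel_measurable M" "E \<in> sets ?P" and f: "\<And>w. 0 \<le> f w" "\<And>w. f w \<le> 1" for f E
    proof -
      have "emeasure (D f) E = (\<integral>\<^sup>+w. ennreal (f w) * indicator (V -` E \<inter> space M) w \<partial>M)"
        unfolding D_def by (subst emeasure_distr) (auto simp: emeasure_density)
      also have "\<dots> = (\<integral>\<^sup>+w. ennreal (f w * indicator E (V w)) \<partial>M)"
        by (intro nn_integral_cong) (auto simp: indicator_def)
      also have "\<dots> = ennreal (LINT w|M. f w * indicator E (V w))"
        by (intro nn_integral_eq_integral integrable_const_bound[where B=1])
           (use f in \<open>auto simp: indicator_def\<close>)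
      finally show ?thesis .
    qed
    \<comment> \<open>For fixed \<open>B\<close> these are finite measures on the product space that
      agree on boxes, so they agree on every measurable \<open>E\<close>.\<close>
    have "D (\<lambda>w. indicator B (W h w)) = D (\<lambda>w. p)"
    proof (rule measure_eqI_PiM_finite[OF K(1)])
      show "sets (D (\<lambda>w. indicator B (W h w))) = sets ?P" "sets (D (\<lambda>w. p)) = sets ?P"
        by (simp_all add: D_def)
      fix A :: "'b \<Rightarrow> real set" assume A: "\<And>i. i \<in> K \<Longrightarrow> A i \<in> sets borel"
      \<comment> \<open>The values of \<open>A\<close> off \<open>K\<close> are arbitrary; the empty
        set makes every index measurable and leaves the box unchanged.\<close>
      define A' where "A' i = (if i \<in> K then A i else {})" for i
      have A'[measurable]: "A' i \<in> sets borel" for i using A by (simp add: A'_def)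
      have AA: "Pi\<^sub>E K A = Pi\<^sub>E K A'" by (auto simp: A'_def PiE_def Pi_def)
      have "indicator (Pi\<^sub>E K A') (V w) = (\<Prod>i\<in>K. indicator (A' i) (W (rr i) w) :: real)" for w
        using K(1) by (auto simp: V_def indicator_def PiE_def Pi_def)
      then show "emeasure (D (\<lambda>w. indicator B (W h w))) (Pi\<^sub>E K A) = emeasure (D (\<lambda>w. p)) (Pi\<^sub>E K A)"
        unfolding AA using K p p0 integral_prod_indicator_indep[OF K A' B]
        by (subst (1 2) D) (auto simp: p_def mult.commute intro!: sets_PiM_I_finite)
    next
      show "range (\<lambda>_::nat. \<Pi>\<^sub>E i\<in>K. UNIV) \<subseteq> prod_algebra K (\<lambda>_. borel :: real measure)"
        using K(1) by (auto simp: prod_algebra_eq_finite)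
      show "(\<Union>i::nat. \<Pi>\<^sub>E i\<in>K. UNIV) = space ?P" by (simp add: space_PiM)
      show "emeasure (D (\<lambda>w. indicator B (W h w))) (\<Pi>\<^sub>E i\<in>K. UNIV) \<noteq> \<infinity>"
        using K(1) by (subst D) (auto intro!: sets_PiM_I_finite)
    qed
    then have "emeasure (D (\<lambda>w. indicator B (W h w))) E = emeasure (D (\<lambda>w. p)) E" by simp
    then have "ennreal (LINT w|M. indicator B (W h w) * indicator E (V w)) = ennreal (p * (LINT w|M. indicator E (V w)))"
      using p0 p by (subst (asm) (1 2) D) auto
    moreover have "(LINT w|M. indicator B (W h w) * indicator E (V w)) =
       prob ({w\<in>space M. W h w \<in> B} \<inter> {w\<in>space M. V w \<in> E})"
    proof -
      have "(LINT w|M. indicator B (W h w) * indicator E (V w)) = (\<integral>w. indicator (B \<times> E) (W h w, V w) \<partial>M :: real)"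
        by (simp add: indicator_times)
      also have "\<dots> = prob {w\<in>space M. (W h w, V w) \<in> B \<times> E}"
        by (rule expectation_indicator[where N="borel \<Otimes>\<^sub>M ?P"]) measurable
      finally show ?thesis by (simp add: Int_def conj_ac cong: conj_cong)
    qed
    moreover have "(LINT w|M. indicator E (V w)) = prob {w\<in>space M. V w \<in> E}"
      by (rule expectation_indicator) measurable
    ultimately show ?thesis
      using p0 by (simp add: emeasure_eq_measure p ennreal_mult)
  qed
  show ?thesis
  proof (rule pair_measure_eqI)
    show "sigma_finite_measure (distr M borel (W h))" "sigma_finite_measure (distr M ?P V)" ..
    fix B E assume [measurable]: "B \<in> sets (distr M borel (W h))" "E \<in> sets (distr M ?P V)"
    then have m: "B \<in> sets borel" "E \<in> sets ?P" by auto
    have s: "(\<lambda>w. (W h w, V w)) -` (B \<times> E) \<inter> space M = {w\<in>space M. W h w \<in> B} \<inter> {w\<in>space M. V w \<in> E}"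
      "W h -` B \<inter> space M = {w\<in>space M. W h w \<in> B}" "V -` E \<inter> space M = {w\<in>space M. V w \<in> E}"
      by auto
    show "emeasure (distr M borel (W h)) B * emeasure (distr M ?P V) E =
       emeasure (distr M (borel \<Otimes>\<^sub>M ?P) (\<lambda>w. (W h w, V w))) (B \<times> E)"
      using m *[OF m] by (subst (1 2 3) emeasure_distr) (auto simp: s)
  qed simp
qed

text \<open>Conditioning on \<open>V\<close> is Fubini's theorem for the product law. The inner
  integral is against a Gaussian density on the line, so a one-dimensional formula can be applied
  for almost every frozen \<open>v\<close>.\<close>

lemma expectation_orthogonal:
  fixes \<Phi> :: "real \<times> ('i \<Rightarrow> real) \<Rightarrow> real"
  assumes K: "finite K" "\<And>i. i \<in> K \<Longrightarrow> rr i \<bullet> h = 0" and h: "h \<noteq> 0"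
    and \<Phi>[measurable]: "\<Phi> \<in> borel_measurable (borel \<Otimes>\<^sub>M Pi\<^sub>M K (\<lambda>_. borel))"
  defines "V \<equiv> (\<lambda>w. \<lambda>i\<in>K. W (rr i) w)"
  assumes int: "integrable M (\<lambda>w. \<Phi> (W h w, V w))"
  shows "AE v in distr M (Pi\<^sub>M K (\<lambda>_. borel)) V. integrable lborel (\<lambda>x. normal_density 0 (norm h) x * \<Phi> (x, v))"
    and "(LINT w|M. \<Phi> (W h w, V w)) =
      (LINT v|(distr M (Pi\<^sub>M K (\<lambda>_. borel)) V). (LINT x|lborel. normal_density 0 (norm h) x * \<Phi> (x, v)))"
proof -
  let ?P = "Pi\<^sub>M K (\<lambda>_. borel :: real measure)"
  have V[measurable]: "V \<in> measurable M ?P" unfolding V_def by measurable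
  interpret X: prob_space "distr M borel (W h)" by (rule prob_space_distr) simp
  interpret Y: prob_space "distr M ?P V" by (rule prob_space_distr) simp
  interpret XY: pair_prob_space "distr M borel (W h)" "distr M ?P V" ..
  have law: "distr M borel (W h) = density lborel (\<lambda>x. ennreal (normal_density 0 (norm h) x))"
    using W_distributed[OF h] unfolding distributed_def
    by (metis distr_cong sets_lborel)
  have pair: "distr M borel (W h) \<Otimes>\<^sub>M distr M ?P V = distr M (borel \<Otimes>\<^sub>M ?P) (\<lambda>w. (W h w, V w))"
    unfolding V_def by (rule distr_pair_orthogonal[OF K])
  have i: "integrable (distr M borel (W h) \<Otimes>\<^sub>M distr M ?P V) \<Phi>"
    unfolding pair
    using int by (subst integrable_distr_eq) auto
  have ce: "(LINT x|(distr M borel (W h)). \<Phi> (x, v)) = (LINT x|lborel. normal_density 0 (norm h) x * \<Phi> (x, v))"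
    "integrable (distr M borel (W h)) (\<lambda>x. \<Phi> (x, v)) = integrable lborel (\<lambda>x. normal_density 0 (norm h) x * \<Phi> (x, v))"
    if "v \<in> space ?P" for v
  proof -
    have [measurable]: "(\<lambda>x. \<Phi> (x, v)) \<in> borel_measurable borel"
      using that by measurable
    show "(LINT x|(distr M borel (W h)). \<Phi> (x, v)) = (LINT x|lborel. normal_density 0 (norm h) x * \<Phi> (x, v))"
    "integrable (distr M borel (W h)) (\<lambda>x. \<Phi> (x, v)) = integrable lborel (\<lambda>x. normal_density 0 (norm h) x * \<Phi> (x, v))"
      unfolding law by (auto simp: integral_density integrable_density)
  qed
  have "AE v in distr M ?P V. integrable (distr M borel (W h)) (\<lambda>x. \<Phi> (x, v))"
    using XY.AE_integrable_snd[of "\<lambda>x v. \<Phi> (x, v)"] i by simp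
  then show "AE v in distr M ?P V. integrable lborel (\<lambda>x. normal_density 0 (norm h) x * \<Phi> (x, v))"
    using AE_space[of "distr M ?P V"] by eventually_elim (simp add: ce(2))
  have "(LINT w|M. \<Phi> (W h w, V w)) = (LINT y|(distr M borel (W h) \<Otimes>\<^sub>M distr M ?P V). \<Phi> y)"
    unfolding pair
    by (subst integral_distr) auto
  also have "\<dots> = (LINT v|(distr M ?P V). (LINT x|(distr M borel (W h)). \<Phi> (x, v)))"
    using XY.integral_snd[of "\<lambda>x v. \<Phi> (x, v)"] i by simp
  also have "\<dots> = (LINT v|(distr M ?P V). (LINT x|lborel. normal_density 0 (norm h) x * \<Phi> (x, v)))"
    by (intro Bochner_Integration.integral_cong refl ce) simp
  finally show "(LINT w|M. \<Phi> (W h w, V w)) =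
      (LINT v|(distr M ?P V). (LINT x|lborel. normal_density 0 (norm h) x * \<Phi> (x, v)))" .
qed

end

section \<open>Gaussian integration by parts\<close>

lemma integrable_tendsto_at_top_imp_zero:
  fixes G :: "real \<Rightarrow> real"
  assumes G: "integrable lborel G" and L: "(G \<longlongrightarrow> L) at_top"
  shows "L = 0"
proof (rule ccontr)
  assume "L \<noteq> 0"
  then have "\<forall>\<^sub>F x in at_top. \<bar>L\<bar> / 2 < \<bar>G x\<bar>"
    using tendsto_rabs[OF L] by (intro order_tendstoD) auto
  then obtain x0 where x0: "\<And>x. x \<ge> x0 \<Longrightarrow> \<bar>L\<bar> / 2 < \<bar>G x\<bar>"
    by (auto simp: eventually_at_top_linorder)
  have "real n * (\<bar>L\<bar> / 2) \<le> (LINT x|lborel. \<bar>G x\<bar>)" for n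
  proof -
    have "real n * (\<bar>L\<bar> / 2) = (LINT x|lborel. (\<bar>L\<bar> / 2) * indicator {x0..x0 + real n} x)"
      by simp
    also have "\<dots> \<le> (LINT x|lborel. \<bar>G x\<bar>)"
    proof (rule integral_mono)
      show "integrable lborel (\<lambda>x. (\<bar>L\<bar> / 2) * indicator {x0..x0 + real n} x)"
        by (intro integrable_mult_right integrable_real_indicator) auto
      show "(\<bar>L\<bar> / 2) * indicator {x0..x0 + real n} x \<le> \<bar>G x\<bar>" for x
        using x0[of x] by (auto simp: indicator_def)
    qed (use G in auto)
    finally show ?thesis .
  qed
  moreover obtain n where "(LINT x|lborel. \<bar>G x\<bar>) < real n * (\<bar>L\<bar> / 2)"
    using reals_Archimedean3[of "\<bar>L\<bar> / 2"] \<open>L \<noteq> 0\<close> by auto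
  ultimately show False by (meson not_le)
qed

text \<open>The boundary term \<open>F y - F (- y)\<close> converges to the integral of
  \<open>f\<close>. Being itself integrable in \<open>y\<close>, it can converge only to 0;
  integrability of \<open>F\<close> thus takes the place of decay at infinity.\<close>

lemma integral_derivative_eq_0:
  fixes F f :: "real \<Rightarrow> real"
  assumes F: "integrable lborel F" and f: "integrable lborel f"
    and D: "\<And>x. (F has_real_derivative f x) (at x)" and c: "continuous_on UNIV f"
  shows "(LINT x|lborel. f x) = 0"
proof -
  have "((\<lambda>y. LINT x|lborel. f x * indicator {-y..y} x) \<longlongrightarrow> (LINT x|lborel. f x)) at_top"
  proof (rule integral_dominated_convergence_at_top[where w="\<lambda>x. \<bar>f x\<bar>"])
    show "AE x in lborel. ((\<lambda>y. f x * indicator {-y..y} x) \<longlongrightarrow> f x) at_top"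
    proof (rule AE_I2)
      fix x
      have "\<forall>\<^sub>F y in at_top. f x * indicator {-y..y} x = f x"
        using eventually_ge_at_top[of "\<bar>x\<bar>"] by eventually_elim (auto simp: indicator_def)
      then show "((\<lambda>y. f x * indicator {-y..y} x) \<longlongrightarrow> f x) at_top"
        by (rule tendsto_eventually)
    qed
    show "\<forall>\<^sub>F y in at_top. AE x in lborel. norm (f x * indicator {-y..y} x) \<le> \<bar>f x\<bar>"
      by (auto simp: indicator_def)
  qed (use f in auto)
  moreover have "\<forall>\<^sub>F y in at_top. (LINT x|lborel. f x * indicator {-y..y} x) = F y - F (- y)"
    using eventually_ge_at_top[of "0::real"]
  proof eventually_elim
    case (elim y)
    then show ?case
      using D c by (intro integral_FTC_Icc_real) (auto simp: continuous_on_eq_continuous_at)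
  qed
  ultimately have "((\<lambda>y. F y - F (- y)) \<longlongrightarrow> (LINT x|lborel. f x)) at_top"
    by (rule Lim_transform_eventually)
  moreover have "integrable lborel (\<lambda>y. F (- y))"
    using lborel_integrable_real_affine[OF F, of "-1" 0] by simp
  ultimately show ?thesis
    using F by (intro integrable_tendsto_at_top_imp_zero[of "\<lambda>y. F y - F (- y)"]) auto
qed

lemma normal_density_integration_by_parts:
  fixes u u' :: "real \<Rightarrow> real"
  assumes \<sigma>: "\<sigma> > 0"
    and D: "\<And>x. (u has_real_derivative u' x) (at x)" and c: "continuous_on UNIV u'"
    and i1: "integrable lborel (\<lambda>x. normal_density 0 \<sigma> x * (x * u x))"
    and i2: "integrable lborel (\<lambda>x. normal_density 0 \<sigma> x * u' x)"
  shows "(LINT x|lborel. normal_density 0 \<sigma> x * (x * u x)) =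
    \<sigma>\<^sup>2 * (LINT x|lborel. normal_density 0 \<sigma> x * u' x)"
proof -
  let ?n = "normal_density 0 \<sigma>"
  have cu: "continuous_on UNIV u"
    by (rule DERIV_continuous_on[OF has_field_derivative_at_within[OF D]])
  have Dn: "(?n has_real_derivative (- x / \<sigma>\<^sup>2 * ?n x)) (at x)" for x
    unfolding normal_density_def using \<sigma>
    by (auto intro!: derivative_eq_intros simp: field_simps)
  have cn: "continuous_on A ?n" for A
    by (rule DERIV_continuous_on[OF has_field_derivative_at_within[OF Dn]])
  have [measurable]: "u \<in> borel_measurable borel" by (rule borel_measurable_continuous_onI[OF cu])
  have [measurable]: "u' \<in> borel_measurable borel" by (rule borel_measurable_continuous_onI[OF c])
  \<comment> \<open>Off \<open>{-1..1}\<close> the factor \<open>x\<close> in \<open>i1\<close> only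
    enlarges the integrand, and on this compact interval the integrand is continuous.\<close>
  have iu: "integrable lborel (\<lambda>x. ?n x * u x)"
  proof (rule Bochner_Integration.integrable_bound)
    have "integrable lborel (\<lambda>x. indicator {-1..1} x *\<^sub>R (?n x * u x))"
      by (intro borel_integrable_compact compact_Icc continuous_on_mult[OF cn continuous_on_subset[OF cu]] subset_UNIV)
    then show "integrable lborel (\<lambda>x. \<bar>?n x * (x * u x)\<bar> + \<bar>indicator {-1..1} x *\<^sub>R (?n x * u x)\<bar>)"
      by (intro Bochner_Integration.integrable_add integrable_abs i1)
    show "AE x in lborel. norm (?n x * u x) \<le>
        norm (\<bar>?n x * (x * u x)\<bar> + \<bar>indicator {-1..1} x *\<^sub>R (?n x * u x)\<bar>)"
    proof (rule AE_I2)
      fix x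
      show "norm (?n x * u x) \<le> norm (\<bar>?n x * (x * u x)\<bar> + \<bar>indicator {-1..1} x *\<^sub>R (?n x * u x)\<bar>)"
      proof (cases "x \<in> {-1..1}")
        case False
        then have "1 \<le> \<bar>x\<bar>" by auto
        then have "\<bar>?n x * u x\<bar> * 1 \<le> \<bar>?n x * u x\<bar> * \<bar>x\<bar>" by (intro mult_left_mono) auto
        then show ?thesis using False by (simp add: abs_mult mult_ac)
      qed simp
    qed
  qed measurable
  let ?f = "\<lambda>x. ?n x * u' x - (1 / \<sigma>\<^sup>2) * (?n x * (x * u x))"
  have "(LINT x|lborel. ?f x) = 0"
  proof (rule integral_derivative_eq_0[OF iu])
    show "((\<lambda>x. ?n x * u x) has_real_derivative ?f x) (at x)" for x
    proof -
      have "((\<lambda>x. ?n x * u x) has_real_derivative (- x / \<sigma>\<^sup>2 * ?n x) * u x + u' x * ?n x) (at x)"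
        by (rule DERIV_mult[OF Dn D])
      moreover have "(- x / \<sigma>\<^sup>2 * ?n x) * u x + u' x * ?n x = ?f x" by (simp add: algebra_simps)
      ultimately show ?thesis by (simp only:)
    qed
    show "continuous_on UNIV ?f"
      by (intro continuous_intros cn c cu)
  qed (use i1 i2 in auto)
  then have "(LINT x|lborel. ?n x * u' x) = (1 / \<sigma>\<^sup>2) * (LINT x|lborel. ?n x * (x * u x))"
    using i1 i2 by simp
  then show ?thesis using \<sigma> by simp
qed

text \<open>\<open>shermite n s\<close> is the \<open>n\<close>-th Hermite polynomial of variance \<open>s\<close>, so that
  \<open>shermite n (h \<bullet> h) (W h)\<close> is the multiple integral of the \<open>n\<close>-th tensor power of \<open>h\<close>.\<close>

fun shermite :: "nat \<Rightarrow> real \<Rightarrow> real \<Rightarrow> real" where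
  "shermite 0 s x = 1"
| "shermite (Suc 0) s x = x"
| "shermite (Suc (Suc n)) s x = x * shermite (Suc n) s x - real (Suc n) * s * shermite n s x"

text \<open>A form of the recurrence that is uniform in \<open>n\<close>: for \<open>n = 0\<close>
  the truncated index \<open>n - 1\<close> does no harm because its coefficient is zero.\<close>

lemma shermite_Suc: "shermite (Suc n) s x = x * shermite n s x - real n * s * shermite (n - 1) s x"
  by (cases n) auto

text \<open>The Appell property. Differentiating the recurrence leaves one copy of
  \<open>shermite (Suc n)\<close> and \<open>Suc n\<close> times the right-hand side of the
  recurrence one degree lower, which is \<open>shermite (Suc n)\<close> again.\<close>

lemma DERIV_shermite: "(shermite n s has_real_derivative real n * shermite (n - 1) s x) (at x)"
proof (induction n s x rule: shermite.induct)
  case (1 s x)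
  then show ?case by simp
next
  case (2 s x)
  then show ?case by simp
next
  case (3 n s x)
  have "((\<lambda>x. x * shermite (Suc n) s x - real (Suc n) * s * shermite n s x) has_real_derivative
     1 * shermite (Suc n) s x + real (Suc n) * shermite n s x * x
      - real (Suc n) * s * (real n * shermite (n - 1) s x)) (at x)"
    using 3 by (intro DERIV_diff DERIV_mult DERIV_ident DERIV_cmult) auto
  moreover have "1 * shermite (Suc n) s x + real (Suc n) * shermite n s x * x
      - real (Suc n) * s * (real n * shermite (n - 1) s x) = real (Suc (Suc n)) * shermite (Suc n) s x"
    unfolding shermite_Suc[of n] by (simp add: algebra_simps)
  ultimately show ?case by (simp del: of_nat_Suc)
qed

lemma continuous_on_shermite: "continuous_on A (shermite n s)"
  by (rule DERIV_continuous_on[OF has_field_derivative_at_within[OF DERIV_shermite]])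

lemma measurable_shermite[measurable]: "shermite n s \<in> borel_measurable borel"
  by (rule borel_measurable_continuous_onI[OF continuous_on_shermite])

lemma shermite_hermite:
  assumes "h \<noteq> 0"
  shows "norm h ^ n * hermite n (x / norm h) = shermite n (h \<bullet> h) x"
proof (induction n x rule: hermite.induct)
  case (3 n x)
  have "norm h ^ Suc (Suc n) * hermite (Suc (Suc n)) (x / norm h) =
    x * (norm h ^ Suc n * hermite (Suc n) (x / norm h)) - real (Suc n) * (norm h)\<^sup>2 * (norm h ^ n * hermite n (x / norm h))"
    using assms by (simp add: field_simps power2_eq_square)
  then show ?case using 3 by (simp only: shermite.simps power2_norm_eq_inner)
qed (use assms in auto)

text \<open>Variables with all absolute moments form an algebra that contains the polynomials in the
  process. Membership settles the integrability of every product in the computations with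
  polynomials.\<close>

definition moments :: "'a measure \<Rightarrow> ('a \<Rightarrow> real) set" where
  "moments M = {f \<in> borel_measurable M. \<forall>p. integrable M (\<lambda>w. \<bar>f w\<bar> ^ p)}"

lemma momentsD:
  assumes "f \<in> moments M"
  shows "f \<in> borel_measurable M" "integrable M (\<lambda>w. \<bar>f w\<bar> ^ p)" "f \<in> L2 M" "integrable M f"
proof -
  show "f \<in> borel_measurable M" and i: "\<And>p. integrable M (\<lambda>w. \<bar>f w\<bar> ^ p)"
    using assms by (auto simp: moments_def)
  then show "f \<in> L2 M" using i[of 2] by (simp add: L2_def)
  show "integrable M f"
    by (rule integrable_abs_cancel) (use i[of 1] \<open>f \<in> borel_measurable M\<close> in simp_all)
qed

lemma moments_bounded:
  assumes "g \<in> moments M" "f \<in> borel_measurable M" "\<And>w. \<bar>f w\<bar> \<le> \<bar>g w\<bar>"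
  shows "f \<in> moments M"
proof -
  have "integrable M (\<lambda>w. \<bar>f w\<bar> ^ p)" for p
    by (rule Bochner_Integration.integrable_bound[OF momentsD(2)[OF assms(1), of p]])
       (use assms in \<open>auto intro!: power_mono\<close>)
  then show ?thesis using assms by (simp add: moments_def)
qed

lemma moments_add:
  assumes "f \<in> moments M" "g \<in> moments M"
  shows "(\<lambda>w. f w + g w) \<in> moments M"
proof -
  note [measurable] = momentsD(1)[OF assms(1)] momentsD(1)[OF assms(2)]
  have "integrable M (\<lambda>w. \<bar>f w + g w\<bar> ^ p)" for p
  proof (rule Bochner_Integration.integrable_bound)
    show "integrable M (\<lambda>w. 2 ^ p * \<bar>f w\<bar> ^ p + 2 ^ p * \<bar>g w\<bar> ^ p)"
      using momentsD(2)[OF assms(1)] momentsD(2)[OF assms(2)] by simp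
    show "AE w in M. norm (\<bar>f w + g w\<bar> ^ p) \<le> norm (2 ^ p * \<bar>f w\<bar> ^ p + 2 ^ p * \<bar>g w\<bar> ^ p)"
    proof (rule AE_I2)
      fix w
      have "\<bar>f w + g w\<bar> ^ p \<le> (2 * max \<bar>f w\<bar> \<bar>g w\<bar>) ^ p" by (intro power_mono) auto
      also have "\<dots> \<le> 2 ^ p * \<bar>f w\<bar> ^ p + 2 ^ p * \<bar>g w\<bar> ^ p"
        by (auto simp: max_def power_mult_distrib)
      finally show "norm (\<bar>f w + g w\<bar> ^ p) \<le> norm (2 ^ p * \<bar>f w\<bar> ^ p + 2 ^ p * \<bar>g w\<bar> ^ p)" by simp
    qed
  qed measurable
  then show ?thesis by (simp add: moments_def)
qed

lemma moments_mult:
  assumes "f \<in> moments M" "g \<in> moments M"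
  shows "(\<lambda>w. f w * g w) \<in> moments M"
proof -
  note [measurable] = momentsD(1)[OF assms(1)] momentsD(1)[OF assms(2)]
  have "integrable M (\<lambda>w. \<bar>f w * g w\<bar> ^ p)" for p
  proof (rule Bochner_Integration.integrable_bound)
    show "integrable M (\<lambda>w. \<bar>f w\<bar> ^ (p * 2) + \<bar>g w\<bar> ^ (p * 2))"
      by (intro Bochner_Integration.integrable_add momentsD(2)[OF assms(1)] momentsD(2)[OF assms(2)])
    show "AE w in M. norm (\<bar>f w * g w\<bar> ^ p) \<le> norm (\<bar>f w\<bar> ^ (p * 2) + \<bar>g w\<bar> ^ (p * 2))"
    proof (rule AE_I2)
      fix w
      have "2 * (\<bar>f w\<bar> ^ p) * (\<bar>g w\<bar> ^ p) \<le> (\<bar>f w\<bar> ^ p)\<^sup>2 + (\<bar>g w\<bar> ^ p)\<^sup>2"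
        by (rule sum_squares_bound)
      moreover have "0 \<le> (\<bar>f w\<bar> ^ p) * (\<bar>g w\<bar> ^ p)" by simp
      ultimately have "(\<bar>f w\<bar> ^ p) * (\<bar>g w\<bar> ^ p) \<le> (\<bar>f w\<bar> ^ p)\<^sup>2 + (\<bar>g w\<bar> ^ p)\<^sup>2" by linarith
      then show "norm (\<bar>f w * g w\<bar> ^ p) \<le> norm (\<bar>f w\<bar> ^ (p * 2) + \<bar>g w\<bar> ^ (p * 2))"
        by (simp add: abs_mult power_mult_distrib power_mult)
    qed
  qed measurable
  then show ?thesis by (simp add: moments_def)
qed

lemma (in finite_measure) moments_const: "(\<lambda>w. c) \<in> moments M"
  by (simp add: moments_def)

lemma (in finite_measure) moments_bounded_compose:
  fixes h :: "real \<Rightarrow> real"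
  assumes [measurable]: "h \<in> borel_measurable borel" "f \<in> borel_measurable M" and h: "\<And>x. \<bar>h x\<bar> \<le> C"
  shows "(\<lambda>w. h (f w)) \<in> moments M"
proof (rule moments_bounded[OF moments_const[of C]])
  show "\<bar>h (f w)\<bar> \<le> \<bar>C\<bar>" for w using h[of "f w"] by linarith
qed measurable

section \<open>Polynomial functionals of the process and their gradients\<close>

context isonormal begin

lemma moments_W: "W h \<in> moments M"
  using integrable_W_power by (simp add: moments_def)

lemma moments_shermite: "(\<lambda>w. shermite n s (W h w)) \<in> moments M"
proof (induction n rule: induct_nat_012)
  case (ge2 n)
  have "(\<lambda>w. W h w * shermite (Suc n) s (W h w) + (- real (Suc n) * s) * shermite n s (W h w)) \<in> moments M"
    using ge2 by (intro moments_add moments_mult moments_const moments_W)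
  then show ?case unfolding shermite.simps by (simp only: mult_minus_left add_uminus_conv_diff)
qed (simp_all add: moments_const moments_W)

text \<open>An entry \<open>(m, c, k)\<close> stands for \<open>c\<close> times the multiple
  integral of the \<open>m\<close>-th tensor power of \<open>k\<close>. Mixed degrees in one list
  allow partial sums of a chaos expansion to be approximated by concatenation.\<close>

definition cyl :: "(nat \<times> real \<times> 'h) list \<Rightarrow> 'a \<Rightarrow> real" where
  "cyl L w = (\<Sum>(m, c, k)\<leftarrow>L. c * shermite m (k \<bullet> k) (W k w))"

text \<open>The Malliavin derivative of \<open>cyl L\<close>, by the Appell property. Entries of
  degree 0 drop out through the factor \<open>real m\<close>.\<close>

definition dcyl :: "(nat \<times> real \<times> 'h) list \<Rightarrow> 'a \<Rightarrow> 'h" where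
  "dcyl L w = (\<Sum>(m, c, k)\<leftarrow>L. (c * real m * shermite (m - 1) (k \<bullet> k) (W k w)) *\<^sub>R k)"

lemma cyl_simps[simp]:
  "cyl [] w = 0" "cyl ((m, c, k) # L) w = c * shermite m (k \<bullet> k) (W k w) + cyl L w"
  "dcyl [] w = 0"
  "dcyl ((m, c, k) # L) w = (c * real m * shermite (m - 1) (k \<bullet> k) (W k w)) *\<^sub>R k + dcyl L w"
  by (simp_all add: cyl_def dcyl_def)

lemma cyl_append: "cyl (L @ L') w = cyl L w + cyl L' w" "dcyl (L @ L') w = dcyl L w + dcyl L' w"
  by (simp_all add: cyl_def dcyl_def)

lemma moments_cyl: "cyl L \<in> moments M"
proof (induction L)
  case Nil
  have "cyl [] = (\<lambda>w. 0)" by auto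
  then show ?case by (simp only: moments_const)
next
  case (Cons p L)
  obtain m c k where p: "p = (m, c, k)" by (cases p)
  have "cyl (p # L) = (\<lambda>w. c * shermite m (k \<bullet> k) (W k w) + cyl L w)" by (auto simp: p)
  then show ?case using Cons by (simp only: moments_add moments_mult moments_const moments_shermite)
qed

lemma moments_dcyl: "(\<lambda>w. h \<bullet> dcyl L w) \<in> moments M"
proof (induction L)
  case Nil
  then show ?case by (simp add: moments_const)
next
  case (Cons p L)
  obtain m c k where p: "p = (m, c, k)" by (cases p)
  have "(\<lambda>w. h \<bullet> dcyl (p # L) w) =
      (\<lambda>w. (c * real m * (h \<bullet> k)) * shermite (m - 1) (k \<bullet> k) (W k w) + h \<bullet> dcyl L w)"
    by (auto simp: p inner_add mult_ac)
  then show ?case using Cons by (simp only: moments_add moments_mult moments_const moments_shermite)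
qed

lemma measurable_cyl[measurable]: "cyl L \<in> borel_measurable M"
  by (rule momentsD(1)[OF moments_cyl])

lemma L2_dcyl: "dcyl L \<in> L2 M"
proof (induction L)
  case Nil
  have "dcyl [] = (\<lambda>w. 0)" by auto
  then show ?case by (simp only: L2_zero)
next
  case (Cons p L)
  obtain m c k where p: "p = (m, c, k)" by (cases p)
  have "(\<lambda>w. (c * real m * shermite (m - 1) (k \<bullet> k) (W k w)) *\<^sub>R k) \<in> L2 M"
    by (rule L2_dominated[OF momentsD(3)[OF moments_shermite[of "m - 1" "k \<bullet> k" k]], where C="\<bar>c * real m\<bar> * norm k"])
       (auto simp: abs_mult)
  moreover have "dcyl (p # L) = (\<lambda>w. (c * real m * shermite (m - 1) (k \<bullet> k) (W k w)) *\<^sub>R k + dcyl L w)"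
    by (auto simp: p)
  ultimately show ?case using Cons by (simp only: L2_add)
qed

lemma measurable_dcyl[measurable]: "dcyl L \<in> borel_measurable M"
  by (rule L2D(1)[OF L2_dcyl])

lemma moments_lipschitz:
  fixes \<phi> \<phi>' :: "real \<Rightarrow> real"
  assumes D: "\<And>x. (\<phi> has_real_derivative \<phi>' x) (at x)" and B: "\<And>x. \<bar>\<phi>' x\<bar> \<le> C"
    and f: "f \<in> moments M"
  shows "(\<lambda>w. \<phi> (f w)) \<in> moments M"
proof -
  have "continuous_on UNIV \<phi>"
    by (rule DERIV_continuous_on[OF has_field_derivative_at_within[OF D]])
  then have [measurable]: "\<phi> \<in> borel_measurable borel" by (rule borel_measurable_continuous_onI)
  note [measurable] = momentsD(1)[OF f]
  have bound: "\<bar>\<phi> y\<bar> \<le> \<bar>\<phi> 0\<bar> + C * \<bar>y\<bar>" for y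
  proof -
    have "norm (\<phi> y - \<phi> 0) \<le> C * norm (y - 0)"
      by (rule field_differentiable_bound[of UNIV, where f'=\<phi>'])
         (auto intro: has_field_derivative_at_within[OF D] B)
    then show ?thesis by simp
  qed
  have C: "C \<ge> 0" using B[of 0] by linarith
  have "(\<lambda>w. \<bar>f w\<bar>) \<in> moments M" by (rule moments_bounded[OF f]) auto
  then have "(\<lambda>w. \<bar>\<phi> 0\<bar> + C * \<bar>f w\<bar>) \<in> moments M"
    by (intro moments_add moments_mult moments_const)
  then show ?thesis
    by (rule moments_bounded) (use bound C in \<open>auto simp: abs_of_nonneg\<close>)
qed

text \<open>Each direction splits as \<open>k = t k *\<^sub>R h + r k\<close> with
  \<open>r k\<close> orthogonal to \<open>h\<close>. With the variables \<open>W (r k)\<close>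
  frozen, integration by parts in \<open>x = W h\<close> for \<open>u = \<phi>(y) H_n\<close>
  differentiates both factors, and the term from the derivative of \<open>H_n\<close> is the one
  that the recurrence for \<open>H_(n+1)\<close> subtracts.\<close>

theorem cyl_integration_by_parts:
  fixes \<phi> \<phi>' :: "real \<Rightarrow> real"
  assumes D: "\<And>x. (\<phi> has_real_derivative \<phi>' x) (at x)" and c: "continuous_on UNIV \<phi>'"
    and B: "\<And>x. \<bar>\<phi>' x\<bar> \<le> C"
  shows "(LINT w|M. \<phi> (cyl L w) * shermite (Suc n) (h \<bullet> h) (W h w)) =
    (LINT w|M. \<phi>' (cyl L w) * (h \<bullet> dcyl L w) * shermite n (h \<bullet> h) (W h w))"
proof (cases "h = 0")
  case True
  \<comment> \<open>For \<open>h = 0\<close> the variance is 0 and \<open>W 0 = 0\<close>, so all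
    Hermite polynomials of positive degree vanish. The right-hand side vanishes through
    \<open>h \<bullet> dcyl L w\<close>.\<close>
  have "AE w in M. shermite (Suc n) (h \<bullet> h) (W h w) = 0"
    using W_zero unfolding True by eventually_elim (cases n, auto)
  then have "AE w in M. \<phi> (cyl L w) * shermite (Suc n) (h \<bullet> h) (W h w) = 0"
    by eventually_elim simp
  then have "(LINT w|M. \<phi> (cyl L w) * shermite (Suc n) (h \<bullet> h) (W h w)) = 0"
    by (rule integral_eq_zero_AE)
  then show ?thesis using True by simp
next
  case False
  define K where "K = (\<lambda>p. snd (snd p)) ` set L"
  define t where "t k = (k \<bullet> h) / (h \<bullet> h)" for k
  define r where "r k = k - t k *\<^sub>R h" for k
  define V where "V w = (\<lambda>k\<in>K. W (r k) w)" for w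
  have K: "finite K" by (simp add: K_def)
  have r: "r k \<bullet> h = 0" for k using False by (simp add: r_def t_def inner_diff)
  let ?P = "Pi\<^sub>M K (\<lambda>_. borel :: real measure)"
  define y where "y x v = (\<Sum>(m, c, k)\<leftarrow>L. c * shermite m (k \<bullet> k) (t k * x + v k))" for x and v :: "'h \<Rightarrow> real"
  define dy where "dy x v = (\<Sum>(m, c, k)\<leftarrow>L. c * real m * shermite (m - 1) (k \<bullet> k) (t k * x + v k) * t k)"
    for x and v :: "'h \<Rightarrow> real"
  let ?H = "\<lambda>n. shermite n (h \<bullet> h)"
  have Dy: "((\<lambda>x. y x v) has_real_derivative dy x v) (at x)" for x v
    unfolding y_def dy_def
  proof (induction L)
    case (Cons p L)
    obtain m c k where p: "p = (m, c, k)" by (cases p)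
    have "((\<lambda>x. c * shermite m (k \<bullet> k) (t k * x + v k)) has_real_derivative
      c * ((real m * shermite (m - 1) (k \<bullet> k) (t k * x + v k)) * t k)) (at x)"
      by (intro DERIV_cmult DERIV_chain2[OF DERIV_shermite]) (auto intro!: derivative_eq_intros)
    from DERIV_add[OF this Cons] show ?case by (simp add: p mult.assoc)
  qed simp
  have cdy: "continuous_on UNIV (\<lambda>x. dy x v)" for v
    unfolding dy_def
  proof (induction L)
    case (Cons p L)
    obtain m c k where p: "p = (m, c, k)" by (cases p)
    have "continuous_on UNIV (\<lambda>x. c * real m * shermite (m - 1) (k \<bullet> k) (t k * x + v k) * t k)"
      by (intro continuous_intros continuous_on_compose2[OF continuous_on_shermite]) auto
    from continuous_on_add[OF this Cons] show ?case by (simp add: p)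
  qed simp
  define u where "u x v = \<phi> (y x v) * ?H n x" for x v
  define u' where "u' x v = \<phi>' (y x v) * dy x v * ?H n x + \<phi> (y x v) * (real n * ?H (n - 1) x)" for x v
  have Du: "((\<lambda>x. u x v) has_real_derivative u' x v) (at x)" for x v
  proof -
    have "((\<lambda>x. \<phi> (y x v)) has_real_derivative \<phi>' (y x v) * dy x v) (at x)"
      by (rule DERIV_chain2[OF D Dy])
    from DERIV_mult[OF this DERIV_shermite[of n "h \<bullet> h" x]]
    show ?thesis unfolding u_def u'_def by (simp add: algebra_simps)
  qed
  have c\<phi>: "continuous_on UNIV \<phi>"
    by (rule DERIV_continuous_on[OF has_field_derivative_at_within[OF D]])
  have cy: "continuous_on UNIV (\<lambda>x. y x v)" for v
    by (rule DERIV_continuous_on[OF has_field_derivative_at_within[OF Dy]])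
  have cu': "continuous_on UNIV (\<lambda>x. u' x v)" for v
    unfolding u'_def
    by (intro continuous_intros cdy continuous_on_shermite continuous_on_compose2[OF c cy]
        continuous_on_compose2[OF c\<phi> cy]) auto
  have [measurable]: "\<phi> \<in> borel_measurable borel" "\<phi>' \<in> borel_measurable borel"
    using c c\<phi> borel_measurable_continuous_onI by blast+
  have my[measurable]: "(\<lambda>z. y (fst z) (snd z)) \<in> borel_measurable (borel \<Otimes>\<^sub>M ?P)"
    and mdy[measurable]: "(\<lambda>z. dy (fst z) (snd z)) \<in> borel_measurable (borel \<Otimes>\<^sub>M ?P)"
  proof -
    \<comment> \<open>The induction runs over lists with entries from \<open>L\<close>, because the
      index set \<open>K\<close> must remain that of the whole list.\<close>
    have "set L' \<subseteq> set L \<Longrightarrow> (\<lambda>z. \<Sum>(m, c, k)\<leftarrow>L'. c * shermite m (k \<bullet> k) (t k * fst z + snd z k))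
         \<in> borel_measurable (borel \<Otimes>\<^sub>M ?P) \<and>
       (\<lambda>z. \<Sum>(m, c, k)\<leftarrow>L'. c * real m * shermite (m - 1) (k \<bullet> k) (t k * fst z + snd z k) * t k)
         \<in> borel_measurable (borel \<Otimes>\<^sub>M ?P)" for L'
    proof (induction L')
      case (Cons p L')
      obtain m c k where p: "p = (m, c, k)" by (cases p)
      have k: "k \<in> K" using Cons.prems p by (force simp: K_def)
      have [measurable]: "(\<lambda>z. snd z k) \<in> borel_measurable (borel \<Otimes>\<^sub>M ?P)"
        using measurable_compose[OF measurable_snd measurable_component_singleton[OF k]] .
      show ?case using Cons by (auto simp: p intro!: borel_measurable_add)
    qed simp
    from this[of L] show "(\<lambda>z. y (fst z) (snd z)) \<in> borel_measurable (borel \<Otimes>\<^sub>M ?P)"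
      "(\<lambda>z. dy (fst z) (snd z)) \<in> borel_measurable (borel \<Otimes>\<^sub>M ?P)"
      by (simp_all add: y_def dy_def)
  qed
  define \<Phi>1 where "\<Phi>1 z = fst z * u (fst z) (snd z)" for z
  define \<Phi>2 where "\<Phi>2 z = u' (fst z) (snd z)" for z
  have [measurable]: "\<Phi>1 \<in> borel_measurable (borel \<Otimes>\<^sub>M ?P)" "\<Phi>2 \<in> borel_measurable (borel \<Otimes>\<^sub>M ?P)"
    unfolding \<Phi>1_def \<Phi>2_def u_def u'_def by measurable
  have V[measurable]: "V \<in> measurable M ?P" unfolding V_def by measurable
  have Vk: "AE w in M. \<forall>k\<in>K. W k w = t k * W h w + V w k"
  proof (rule AE_finite_allI[OF K])
    fix k assume "k \<in> K"
    then show "AE w in M. W k w = t k * W h w + V w k"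
      using W_linear[of "r k" "t k" h] by (auto simp: r_def V_def add.commute)
  qed
  \<comment> \<open>The slope \<open>t k\<close> is
    \<open>(k \<bullet> h) / (h \<bullet> h)\<close>, so the derivative in \<open>x\<close> times
    the variance \<open>h \<bullet> h\<close> is the gradient in the direction
    \<open>h\<close>.\<close>
  have yV: "AE w in M. y (W h w) (V w) = cyl L w \<and> (h \<bullet> h) * dy (W h w) (V w) = h \<bullet> dcyl L w"
    using Vk
  proof eventually_elim
    case (elim w)
    have "set L' \<subseteq> set L \<Longrightarrow> (\<Sum>(m, c, k)\<leftarrow>L'. c * shermite m (k \<bullet> k) (t k * W h w + V w k)) = cyl L' w \<and>
       (h \<bullet> h) * (\<Sum>(m, c, k)\<leftarrow>L'. c * real m * shermite (m - 1) (k \<bullet> k) (t k * W h w + V w k) * t k) = h \<bullet> dcyl L' w"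
      for L'
    proof (induction L')
      case (Cons p L')
      obtain m c k where p: "p = (m, c, k)" by (cases p)
      have "k \<in> K" using Cons.prems p by (force simp: K_def)
      then have k: "t k * W h w + V w k = W k w" using elim by simp
      have tk: "(h \<bullet> h) * t k = h \<bullet> k" using False by (simp add: t_def inner_commute)
      have "(h \<bullet> h) * (x * t k + S) = x * (h \<bullet> k) + (h \<bullet> h) * S" for x S
        unfolding tk[symmetric] by (simp add: algebra_simps)
      then show ?case using Cons by (simp add: p k inner_add)
    qed simp
    from this[of L] show ?case by (simp add: y_def dy_def)
  qed
  note mom = moments_lipschitz[of \<phi> \<phi>', OF D B moments_cyl[of L]]
  have mom': "(\<lambda>w. \<phi>' (cyl L w)) \<in> moments M"
    by (rule moments_bounded_compose[OF _ _ B]) measurable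
  have m1: "(\<lambda>w. W h w * (\<phi> (cyl L w) * ?H n (W h w))) \<in> moments M"
    by (intro moments_mult mom moments_W moments_shermite)
  have m2: "(\<lambda>w. \<phi>' (cyl L w) * (h \<bullet> dcyl L w) * ?H n (W h w)) \<in> moments M"
    by (intro moments_mult mom' moments_dcyl moments_shermite)
  have m3: "(\<lambda>w. \<phi> (cyl L w) * (real n * (h \<bullet> h) * ?H (n - 1) (W h w))) \<in> moments M"
    by (intro moments_mult mom moments_const moments_shermite)
  have a1: "AE w in M. W h w * (\<phi> (cyl L w) * ?H n (W h w)) = \<Phi>1 (W h w, V w)"
    using yV by eventually_elim (simp add: \<Phi>1_def u_def)
  have a2: "AE w in M. \<phi>' (cyl L w) * (h \<bullet> dcyl L w) * ?H n (W h w) +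
      \<phi> (cyl L w) * (real n * (h \<bullet> h) * ?H (n - 1) (W h w)) = (h \<bullet> h) * \<Phi>2 (W h w, V w)"
    using yV
  proof eventually_elim
    case (elim w)
    have "(h \<bullet> h) * \<Phi>2 (W h w, V w) = \<phi>' (y (W h w) (V w)) * ((h \<bullet> h) * dy (W h w) (V w)) * ?H n (W h w) +
      \<phi> (y (W h w) (V w)) * (real n * (h \<bullet> h) * ?H (n - 1) (W h w))"
      by (simp only: \<Phi>2_def u'_def fst_conv snd_conv algebra_simps)
    then show ?case using elim by simp
  qed
  have hh: "h \<bullet> h > 0" using False by simp
  have i1: "integrable M (\<lambda>w. \<Phi>1 (W h w, V w))"
    by (rule integrable_cong_AE_imp[OF momentsD(4)[OF m1] _ a1]) measurable
  have "integrable M (\<lambda>w. (h \<bullet> h) * \<Phi>2 (W h w, V w))"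
    by (rule integrable_cong_AE_imp[OF Bochner_Integration.integrable_add[OF momentsD(4)[OF m2] momentsD(4)[OF m3]] _ a2])
       measurable
  then have i2: "integrable M (\<lambda>w. \<Phi>2 (W h w, V w))" using hh by simp
  let ?D = "distr M ?P V"
  let ?n = "normal_density 0 (norm h)"
  have Veq: "V = (\<lambda>w. \<lambda>k\<in>K. W (r k) w)" by (simp add: V_def fun_eq_iff)
  have fub: "AE v in ?D. integrable lborel (\<lambda>x. ?n x * \<Phi> (x, v))"
     "(LINT w|M. \<Phi> (W h w, V w)) = (LINT v|?D. (LINT x|lborel. ?n x * \<Phi> (x, v)))"
    if m: "\<Phi> \<in> borel_measurable (borel \<Otimes>\<^sub>M ?P)" and i: "integrable M (\<lambda>w. \<Phi> (W h w, V w))" for \<Phi>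
  proof -
    show "AE v in ?D. integrable lborel (\<lambda>x. ?n x * \<Phi> (x, v))"
      unfolding Veq by (rule expectation_orthogonal(1)[OF K r False m i[unfolded Veq]])
    show "(LINT w|M. \<Phi> (W h w, V w)) = (LINT v|?D. (LINT x|lborel. ?n x * \<Phi> (x, v)))"
      unfolding Veq by (rule expectation_orthogonal(2)[OF K r False m i[unfolded Veq]])
  qed
  have "(LINT w|M. \<Phi>1 (W h w, V w)) = (LINT v|?D. (LINT x|lborel. ?n x * \<Phi>1 (x, v)))"
    by (rule fub(2)) (use i1 in simp_all)
  also have "\<dots> = (LINT v|?D. (norm h)\<^sup>2 * (LINT x|lborel. ?n x * \<Phi>2 (x, v)))"
  proof (rule integral_cong_AE)
    have a: "AE v in ?D. integrable lborel (\<lambda>x. ?n x * \<Phi>1 (x, v))"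
      by (rule fub(1)) (use i1 in simp_all)
    have b: "AE v in ?D. integrable lborel (\<lambda>x. ?n x * \<Phi>2 (x, v))"
      by (rule fub(1)) (use i2 in simp_all)
    show "AE v in ?D. (LINT x|lborel. ?n x * \<Phi>1 (x, v)) = (norm h)\<^sup>2 * (LINT x|lborel. ?n x * \<Phi>2 (x, v))"
      using a b
    proof eventually_elim
      case (elim v)
      then show ?case
        using normal_density_integration_by_parts[of "norm h" "\<lambda>x. u x v" "\<lambda>x. u' x v", OF _ Du cu'] False
        by (simp add: \<Phi>1_def \<Phi>2_def)
    qed
  qed measurable
  also have "\<dots> = (norm h)\<^sup>2 * (LINT w|M. \<Phi>2 (W h w, V w))"
    by (subst fub(2)) (use i2 in simp_all)
  finally have "(LINT w|M. W h w * (\<phi> (cyl L w) * ?H n (W h w))) = (LINT w|M. (h \<bullet> h) * \<Phi>2 (W h w, V w))"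
    using integral_cong_AE[OF _ _ a1] by (simp add: power2_norm_eq_inner)
  also have "\<dots> = (LINT w|M. \<phi>' (cyl L w) * (h \<bullet> dcyl L w) * ?H n (W h w) +
      \<phi> (cyl L w) * (real n * (h \<bullet> h) * ?H (n - 1) (W h w)))"
    by (rule integral_cong_AE[symmetric, OF _ _ a2]) measurable
  also have "\<dots> = (LINT w|M. \<phi>' (cyl L w) * (h \<bullet> dcyl L w) * ?H n (W h w)) +
      (LINT w|M. \<phi> (cyl L w) * (real n * (h \<bullet> h) * ?H (n - 1) (W h w)))"
    using momentsD(4)[OF m2] momentsD(4)[OF m3] by simp
  finally have "(LINT w|M. W h w * (\<phi> (cyl L w) * ?H n (W h w))) -
      (LINT w|M. \<phi> (cyl L w) * (real n * (h \<bullet> h) * ?H (n - 1) (W h w))) =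
      (LINT w|M. \<phi>' (cyl L w) * (h \<bullet> dcyl L w) * ?H n (W h w))" by simp
  \<comment> \<open>By the recurrence, the subtracted term is the one that the derivative of
    \<open>?H n\<close> has contributed.\<close>
  moreover have "(LINT w|M. \<phi> (cyl L w) * ?H (Suc n) (W h w)) =
     (LINT w|M. W h w * (\<phi> (cyl L w) * ?H n (W h w)) - \<phi> (cyl L w) * (real n * (h \<bullet> h) * ?H (n - 1) (W h w)))"
    unfolding shermite_Suc by (intro Bochner_Integration.integral_cong refl) (simp add: algebra_simps)
  ultimately show ?thesis
    using momentsD(4)[OF m1] momentsD(4)[OF m3] by simp
qed

end

section \<open>Tensors and multiple integrals\<close>

lemma sum_list_prod_index:
  "(\<Sum>(c, h)\<leftarrow>T. F c h) = (\<Sum>i<length T. F (fst (T ! i)) (snd (T ! i)))"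
  for F :: "'a \<Rightarrow> 'b \<Rightarrow> 'c::comm_monoid_add"
  by (simp add: sum_list_sum_nth split_def atLeast0LessThan)

lemma orthonormal_inner:
  assumes "orthonormal B" "b \<in> B" "b' \<in> B"
  shows "b \<bullet> b' = (if b = b' then 1 else 0)"
  using assms
  by (auto simp: orthonormal_def pairwise_def orthogonal_def dot_square_norm)

text \<open>One Gram-Schmidt step: the projection \<open>p\<close> onto the span is subtracted and
  the remainder is normalised; if \<open>x = p\<close>, nothing has to be added.\<close>

lemma orthonormal_extend:
  fixes x :: "'h::real_inner"
  assumes "finite B" "orthonormal B"
  shows "\<exists>B'. finite B' \<and> orthonormal B' \<and> B \<subseteq> B' \<and> x \<in> span B'"
proof -
  define p where "p = (\<Sum>b\<in>B. (x \<bullet> b) *\<^sub>R b)"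
  have p: "p \<in> span B" unfolding p_def by (intro span_sum span_scale span_base)
  have pb: "p \<bullet> b = x \<bullet> b" if "b \<in> B" for b
  proof -
    have "p \<bullet> b = (\<Sum>b'\<in>B. if b' = b then x \<bullet> b' else 0)"
      unfolding p_def inner_sum_left
      by (intro sum.cong) (auto simp: orthonormal_inner[OF assms(2)] that)
    then show ?thesis using assms(1) that by simp
  qed
  show ?thesis
  proof (cases "x = p")
    case True
    then show ?thesis using assms p by blast
  next
    case False
    define e where "e = (x - p) /\<^sub>R norm (x - p)"
    have e: "norm e = 1" using False by (simp add: e_def)
    have eb: "e \<bullet> b = 0" if "b \<in> B" for b
      using pb[OF that] by (simp add: e_def inner_diff)
    have "orthonormal (insert e B)"
      using assms(2) e eb by (auto simp: orthonormal_def pairwise_insert orthogonal_def inner_commute)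
    moreover have "x \<in> span (insert e B)"
    proof -
      have "x = norm (x - p) *\<^sub>R e + p" using False by (simp add: e_def)
      also have "\<dots> \<in> span (insert e B)"
      proof (intro span_add span_scale)
        show "e \<in> span (insert e B)" by (simp add: span_base)
        show "p \<in> span (insert e B)" using p span_mono[of B "insert e B"] by auto
      qed
      finally show ?thesis .
    qed
    ultimately show ?thesis using assms(1) by (intro exI[of _ "insert e B"]) auto
  qed
qed

lemma orthonormal_basis_finite:
  fixes S :: "'h::real_inner set"
  assumes "finite S"
  shows "\<exists>B. finite B \<and> orthonormal B \<and> S \<subseteq> span B"
  using assms
proof (induction S rule: finite_induct)
  case empty
  have "orthonormal ({} :: 'h set)" by (simp add: orthonormal_def)
  then show ?case by blast
next
  case (insert x S)
  then obtain B where B: "finite B" "orthonormal B" "S \<subseteq> span B" by blast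
  obtain B' where B': "finite B'" "orthonormal B'" "B \<subseteq> B'" "x \<in> span B'"
    using orthonormal_extend[OF B(1,2)] by blast
  have "insert x S \<subseteq> span B'" using B(3) B'(4) span_mono[OF B'(3)] by auto
  with B' show ?case by blast
qed

lemma orthonormal_expansion:
  assumes B: "finite B" "orthonormal B" and h: "h \<in> span B"
  shows "h = (\<Sum>b\<in>B. (h \<bullet> b) *\<^sub>R b)"
  using h
proof (induction rule: span_induct_alt)
  case base
  then show ?case by simp
next
  case (step c x y)
  have "(\<Sum>b\<in>B. (x \<bullet> b) *\<^sub>R b) = (\<Sum>b\<in>B. if b = x then x else 0)"
    using step by (intro sum.cong) (auto simp: orthonormal_inner[OF B(2)])
  then have x: "(\<Sum>b\<in>B. (x \<bullet> b) *\<^sub>R b) = x" using step B by simp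
  have "(\<Sum>b\<in>B. ((c *\<^sub>R x + y) \<bullet> b) *\<^sub>R b) = c *\<^sub>R (\<Sum>b\<in>B. (x \<bullet> b) *\<^sub>R b) + (\<Sum>b\<in>B. (y \<bullet> b) *\<^sub>R b)"
    by (simp add: inner_add scaleR_add_left sum.distrib scaleR_sum_right)
  then show ?case using x step by simp
qed

lemma orthonormal_parseval:
  assumes "finite B" "orthonormal B" "h \<in> span B"
  shows "h \<bullet> k = (\<Sum>b\<in>B. (h \<bullet> b) * (k \<bullet> b))"
proof -
  have "h \<bullet> k = (\<Sum>b\<in>B. (h \<bullet> b) *\<^sub>R b) \<bullet> k"
    using orthonormal_expansion[OF assms] by simp
  also have "\<dots> = (\<Sum>b\<in>B. (h \<bullet> b) * (k \<bullet> b))"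
    by (simp add: inner_sum_left inner_commute[of k])
  finally show ?thesis .
qed

lemma sum_lists_length_Suc:
  assumes "finite B"
  shows "(\<Sum>hs\<in>{hs. set hs \<subseteq> B \<and> length hs = Suc n}. F hs) =
    (\<Sum>hs\<in>{hs. set hs \<subseteq> B \<and> length hs = n}. \<Sum>b\<in>B. F (b # hs))"
proof -
  have "inj_on (\<lambda>(xs, n). n # xs) ({xs. set xs \<subseteq> B \<and> length xs = n} \<times> B)"
    by (auto simp: inj_on_def)
  then show ?thesis
    unfolding lists_length_Suc_eq
    by (subst sum.reindex) (auto simp: sum.cartesian_product o_def split_def)
qed

text \<open>The power is expanded over all words of length \<open>n\<close>. For
  \<open>g b = (h \<bullet> b) * (k \<bullet> b)\<close> this computes the inner product of two
  tensor powers in coordinates.\<close>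

lemma sum_lists_prod_list:
  fixes g :: "'b \<Rightarrow> real"
  assumes "finite B"
  shows "(\<Sum>hs\<in>{hs. set hs \<subseteq> B \<and> length hs = n}. \<Prod>x\<leftarrow>hs. g x) = (\<Sum>b\<in>B. g b) ^ n"
proof (induction n)
  case 0
  have "{hs. set hs \<subseteq> B \<and> length hs = 0} = {[]}" by auto
  then show ?case by simp
next
  case (Suc n)
  then show ?case
    unfolding sum_lists_length_Suc[OF assms]
    by (simp add: sum_distrib_left[symmetric] sum_distrib_right[symmetric])
qed

abbreviation tensor_sum :: "(real \<times> 'h::real_inner) list \<Rightarrow> 'h list \<Rightarrow> real" where
  "tensor_sum T hs \<equiv> (\<Sum>(c, h)\<leftarrow>T. c * pow_tensor h hs)"

text \<open>The Gram form of the squared Hilbert norm, since the inner product of the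
  \<open>n\<close>-th tensor powers of \<open>h\<close> and \<open>k\<close> is
  \<open>(h \<bullet> k) ^ n\<close>. It is the shape in which second moments of multiple integrals
  appear.\<close>

definition tensor_form :: "nat \<Rightarrow> (real \<times> 'h::real_inner) list \<Rightarrow> real" where
  "tensor_form n T = (\<Sum>(c, h)\<leftarrow>T. \<Sum>(d, k)\<leftarrow>T. c * d * (h \<bullet> k) ^ n)"

text \<open>A finite orthonormal system whose span contains all vectors of \<open>T\<close> yields
  the Gram form exactly, and it is one of the systems in the supremum.\<close>

lemma tensor_form_le_norm:
  "ennreal (tensor_form n T) \<le> tensor_norm_sq n (tensor_sum T)"
proof -
  obtain B where B: "finite B" "orthonormal B" "snd ` set T \<subseteq> span B"
    using orthonormal_basis_finite[of "snd ` set T"] by auto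
  let ?c = "\<lambda>i. fst (T ! i)" and ?h = "\<lambda>i. snd (T ! i)"
  let ?I = "{..<length T}" and ?L = "{hs. set hs \<subseteq> B \<and> length hs = n}"
  have pt: "pow_tensor h hs * pow_tensor k hs = (\<Prod>x\<leftarrow>hs. (h \<bullet> x) * (k \<bullet> x))" for h k :: 'a and hs
    unfolding pow_tensor_def by (induction hs) auto
  have "(\<Sum>hs\<in>?L. (tensor_sum T hs)\<^sup>2) =
      (\<Sum>hs\<in>?L. \<Sum>i\<in>?I. \<Sum>j\<in>?I. ?c i * ?c j * (pow_tensor (?h i) hs * pow_tensor (?h j) hs))"
    unfolding sum_list_prod_index power2_eq_square sum_product by (intro sum.cong refl) (simp add: mult_ac)
  also have "\<dots> = (\<Sum>i\<in>?I. \<Sum>hs\<in>?L. \<Sum>j\<in>?I. ?c i * ?c j * (pow_tensor (?h i) hs * pow_tensor (?h j) hs))"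
    by (rule sum.swap)
  also have "\<dots> = (\<Sum>i\<in>?I. \<Sum>j\<in>?I. \<Sum>hs\<in>?L. ?c i * ?c j * (pow_tensor (?h i) hs * pow_tensor (?h j) hs))"
    by (intro sum.cong refl sum.swap)
  also have "\<dots> = (\<Sum>i\<in>?I. \<Sum>j\<in>?I. ?c i * ?c j * (\<Sum>b\<in>B. (?h i \<bullet> b) * (?h j \<bullet> b)) ^ n)"
    by (simp only: sum_distrib_left[symmetric] pt sum_lists_prod_list[OF B(1)])
  also have "\<dots> = (\<Sum>i\<in>?I. \<Sum>j\<in>?I. ?c i * ?c j * (?h i \<bullet> ?h j) ^ n)"
  proof (intro sum.cong refl)
    fix i j assume "i \<in> ?I"
    then have "?h i \<in> span B" using B(3) by (auto simp: subset_iff)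
    then show "?c i * ?c j * (\<Sum>b\<in>B. (?h i \<bullet> b) * (?h j \<bullet> b)) ^ n = ?c i * ?c j * (?h i \<bullet> ?h j) ^ n"
      using orthonormal_parseval[OF B(1,2)] by simp
  qed
  finally have "tensor_form n T = (\<Sum>hs\<in>?L. (tensor_sum T hs)\<^sup>2)"
    unfolding tensor_form_def sum_list_prod_index by simp
  then have "ennreal (tensor_form n T) = (\<Sum>hs\<in>?L. ennreal ((tensor_sum T hs)\<^sup>2))"
    by simp
  also have "\<dots> \<le> tensor_norm_sq n (tensor_sum T)"
    unfolding tensor_norm_sq_def by (rule SUP_upper) (use B in auto)
  finally show ?thesis .
qed

lemma tensor_norm_sq_diff_le:
  "tensor_norm_sq n (\<lambda>hs. f hs - g hs) \<le> 2 * tensor_norm_sq n f + 2 * tensor_norm_sq n g"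
  unfolding tensor_norm_sq_def[of n "\<lambda>hs. f hs - g hs"]
proof (rule SUP_least)
  fix B :: "'a set" assume B: "B \<in> {B. finite B \<and> orthonormal B}"
  let ?L = "{hs. set hs \<subseteq> B \<and> length hs = n}"
  have "(\<Sum>hs\<in>?L. ennreal ((f hs - g hs)\<^sup>2)) \<le> (\<Sum>hs\<in>?L. 2 * ennreal ((f hs)\<^sup>2) + 2 * ennreal ((g hs)\<^sup>2))"
  proof (rule sum_mono)
    fix hs
    have "(f hs - g hs)\<^sup>2 \<le> 2 * (f hs)\<^sup>2 + 2 * (g hs)\<^sup>2"
      using norm_add_sq_le[of "f hs" "- g hs"] by simp
    then have "ennreal ((f hs - g hs)\<^sup>2) \<le> ennreal (2 * (f hs)\<^sup>2 + 2 * (g hs)\<^sup>2)"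
      by (rule ennreal_leI)
    then show "ennreal ((f hs - g hs)\<^sup>2) \<le> 2 * ennreal ((f hs)\<^sup>2) + 2 * ennreal ((g hs)\<^sup>2)"
      by (simp add: ennreal_mult)
  qed
  also have "\<dots> = 2 * (\<Sum>hs\<in>?L. ennreal ((f hs)\<^sup>2)) + 2 * (\<Sum>hs\<in>?L. ennreal ((g hs)\<^sup>2))"
    by (simp only: sum.distrib sum_distrib_left)
  also have "\<dots> \<le> 2 * tensor_norm_sq n f + 2 * tensor_norm_sq n g"
    unfolding tensor_norm_sq_def by (intro add_mono mult_left_mono SUP_upper B) auto
  finally show "(\<Sum>hs\<in>?L. ennreal ((f hs - g hs)\<^sup>2)) \<le> 2 * tensor_norm_sq n f + 2 * tensor_norm_sq n g" .
qed

text \<open>The system is enlarged until its span contains \<open>h\<close>, and \<open>h\<close> is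
  expanded in it. Cauchy-Schwarz bounds each squared coefficient by \<open>(norm h)\<^sup>2\<close>
  times a sum over the first entry, and a word with a new first entry is a word of length
  \<open>Suc n\<close>.\<close>

lemma tensor_norm_sq_contract_le:
  fixes g :: "'h::real_inner list \<Rightarrow> real"
  assumes lin: "\<And>hs. length hs = n \<Longrightarrow> linear (\<lambda>x. g (x # hs))"
  shows "tensor_norm_sq n (\<lambda>hs. g (h # hs)) \<le> ennreal ((norm h)\<^sup>2) * tensor_norm_sq (Suc n) g"
  unfolding tensor_norm_sq_def[of n]
proof (rule SUP_least)
  fix B :: "'h set" assume "B \<in> {B. finite B \<and> orthonormal B}"
  then have B: "finite B" "orthonormal B" by auto
  obtain B' where B': "finite B'" "orthonormal B'" "B \<subseteq> B'" "h \<in> span B'"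
    using orthonormal_extend[OF B] by blast
  let ?L = "\<lambda>B n. {hs. set hs \<subseteq> B \<and> length hs = n}"
  have fin: "finite (?L B' n)" using B'(1) by (rule finite_lists_length_eq)
  have hh: "(\<Sum>b\<in>B'. (h \<bullet> b)\<^sup>2) = (norm h)\<^sup>2"
    unfolding power2_norm_eq_inner
    using orthonormal_parseval[OF B'(1,2,4), of h] by (simp only: power2_eq_square)
  have pt: "(g (h # hs))\<^sup>2 \<le> (norm h)\<^sup>2 * (\<Sum>b\<in>B'. (g (b # hs))\<^sup>2)" if "length hs = n" for hs
  proof -
    interpret linear "\<lambda>x. g (x # hs)" by (rule lin[OF that])
    have "g (h # hs) = g ((\<Sum>b\<in>B'. (h \<bullet> b) *\<^sub>R b) # hs)"
      using orthonormal_expansion[OF B'(1,2,4)] by simp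
    also have "\<dots> = (\<Sum>b\<in>B'. (h \<bullet> b) * g (b # hs))" by (simp add: sum scale)
    finally show ?thesis using Cauchy_Schwarz_ineq_sum[of "\<lambda>b. h \<bullet> b" "\<lambda>b. g (b # hs)" B'] hh by simp
  qed
  have "(\<Sum>hs\<in>?L B n. ennreal ((g (h # hs))\<^sup>2)) \<le> (\<Sum>hs\<in>?L B' n. ennreal ((g (h # hs))\<^sup>2))"
    using B'(3) fin by (intro sum_mono2) auto
  also have "\<dots> \<le> (\<Sum>hs\<in>?L B' n. ennreal ((norm h)\<^sup>2 * (\<Sum>b\<in>B'. (g (b # hs))\<^sup>2)))"
    by (intro sum_mono ennreal_leI pt) auto
  also have "\<dots> = ennreal ((norm h)\<^sup>2) * (\<Sum>hs\<in>?L B' n. \<Sum>b\<in>B'. ennreal ((g (b # hs))\<^sup>2))"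
  proof -
    have "ennreal ((norm h)\<^sup>2 * (\<Sum>b\<in>B'. (g (b # hs))\<^sup>2)) =
        ennreal ((norm h)\<^sup>2) * (\<Sum>b\<in>B'. ennreal ((g (b # hs))\<^sup>2))" for hs
      by (subst ennreal_mult) (auto simp: sum_nonneg)
    then show ?thesis by (simp only: sum_distrib_left)
  qed
  also have "(\<Sum>hs\<in>?L B' n. \<Sum>b\<in>B'. ennreal ((g (b # hs))\<^sup>2)) = (\<Sum>hs\<in>?L B' (Suc n). ennreal ((g hs)\<^sup>2))"
    by (rule sum_lists_length_Suc[OF B'(1), symmetric])
  also have "ennreal ((norm h)\<^sup>2) * \<dots> \<le> ennreal ((norm h)\<^sup>2) * tensor_norm_sq (Suc n) g"
    unfolding tensor_norm_sq_def by (intro mult_left_mono SUP_upper) (use B' in auto)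
  finally show "(\<Sum>hs\<in>?L B n. ennreal ((g (h # hs))\<^sup>2)) \<le>
      ennreal ((norm h)\<^sup>2) * tensor_norm_sq (Suc n) g" .
qed

lemma ennreal_tendsto_0_squeeze:
  assumes "\<And>k. 0 \<le> a k" "\<And>k. ennreal (a k) \<le> b k" "b \<longlonglongrightarrow> 0"
  shows "a \<longlonglongrightarrow> 0"
proof -
  have "(\<lambda>k. ennreal (a k)) \<longlonglongrightarrow> 0"
    by (rule tendsto_sandwich[OF _ _ tendsto_const assms(3)]) (use assms in auto)
  then have "(\<lambda>k. ennreal (a k)) \<longlonglongrightarrow> ennreal 0" by simp
  then show ?thesis using assms(1) by (subst (asm) tendsto_ennreal_iff) auto
qed

text \<open>Contraction in the first slot turns a tensor power of \<open>k\<close> into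
  \<open>h \<bullet> k\<close> times the power one degree lower. Lists do not store the degree, so
  only the coefficient changes.\<close>

definition contract :: "'h::real_inner \<Rightarrow> (real \<times> 'h) list \<Rightarrow> (real \<times> 'h) list" where
  "contract h T = map (\<lambda>(c, k). (c * (h \<bullet> k), k)) T"

lemma tensor_sum_contract: "tensor_sum (contract h T) hs = tensor_sum T (h # hs)"
  by (induction T) (auto simp: contract_def pow_tensor_def inner_commute)

definition neg_tensor :: "(real \<times> 'h) list \<Rightarrow> (real \<times> 'h) list" where
  "neg_tensor T = map (\<lambda>(c, k). (- c, k)) T"

lemma tensor_sum_append_neg: "tensor_sum (S @ neg_tensor T) hs = tensor_sum S hs - tensor_sum T hs"
proof -
  have "tensor_sum (neg_tensor T) hs = - tensor_sum T hs"
    by (induction T) (auto simp: neg_tensor_def)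
  then show ?thesis by simp
qed

lemma linear_tensor_sum: "linear (\<lambda>x. tensor_sum T (x # hs))"
proof (induction T)
  case (Cons p T)
  obtain c h where p: "p = (c, h)" by (cases p)
  have "linear (\<lambda>x. c * pow_tensor h (x # hs))"
    by (intro linearI) (auto simp: pow_tensor_def inner_add algebra_simps)
  from linear_compose_add[OF this Cons] show ?case by (simp add: p)
qed (simp add: linear_zero)

section \<open>The isometry of multiple integrals and of their gradients\<close>

context isonormal begin

text \<open>Integration by parts with the identity for \<open>\<phi>\<close> lowers both degrees by
  one and releases a factor \<open>k \<bullet> h\<close>. Against the constant polynomial the
  derivative is zero, which ends the recursion for different degrees.\<close>

lemma expectation_shermite_mult:
  "(LINT w|M. shermite m (k \<bullet> k) (W k w) * shermite n (h \<bullet> h) (W h w)) =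
    (if m = n then fact n * (k \<bullet> h) ^ n else 0)"
proof (induction n arbitrary: m)
  case 0
  show ?case
  proof (cases m)
    case 0
    then show ?thesis by (simp add: prob_space)
  next
    case (Suc m')
    have "(LINT w|M. (\<lambda>x. x) (cyl [(0, 1, h)] w) * shermite (Suc m') (k \<bullet> k) (W k w)) =
      (LINT w|M. (\<lambda>x. 1) (cyl [(0, 1, h)] w) * (k \<bullet> dcyl [(0, 1, h)] w) * shermite m' (k \<bullet> k) (W k w))"
      by (rule cyl_integration_by_parts[where C=1]) (auto intro: DERIV_ident)
    then show ?thesis using Suc by simp
  qed
next
  case (Suc n)
  have "(LINT w|M. (\<lambda>x. x) (cyl [(m, 1, k)] w) * shermite (Suc n) (h \<bullet> h) (W h w)) =
    (LINT w|M. (\<lambda>x. 1) (cyl [(m, 1, k)] w) * (h \<bullet> dcyl [(m, 1, k)] w) * shermite n (h \<bullet> h) (W h w))"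
    by (rule cyl_integration_by_parts[where C=1]) (auto intro: DERIV_ident)
  then have "(LINT w|M. shermite m (k \<bullet> k) (W k w) * shermite (Suc n) (h \<bullet> h) (W h w)) =
    (LINT w|M. (real m * (k \<bullet> h)) * (shermite (m - 1) (k \<bullet> k) (W k w) * shermite n (h \<bullet> h) (W h w)))"
    by (simp add: inner_commute mult_ac)
  also have "\<dots> = (real m * (k \<bullet> h)) * (if m - 1 = n then fact n * (k \<bullet> h) ^ n else 0)"
    by (simp only: integral_mult_right_zero Suc)
  also have "\<dots> = (if m = Suc n then fact (Suc n) * (k \<bullet> h) ^ Suc n else 0)"
    by (cases m) (auto simp: algebra_simps)
  finally show ?case .
qed

text \<open>\<open>cyl (level n T)\<close> is the multiple integral of degree \<open>n\<close> of
  the tensor \<open>tensor_sum T\<close>.\<close>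

definition level :: "nat \<Rightarrow> (real \<times> 'h) list \<Rightarrow> (nat \<times> real \<times> 'h) list" where
  "level n T = map (\<lambda>(c, h). (n, c, h)) T"

lemma cyl_level: "cyl (level n T) w = (\<Sum>(c, h)\<leftarrow>T. c * shermite n (h \<bullet> h) (W h w))"
  by (induction T) (auto simp: level_def)

lemma expectation_cyl_level_mult:
  "(LINT w|M. cyl (level m S) w * cyl (level n T) w) =
    (if m = n then fact n * (\<Sum>(c, h)\<leftarrow>S. \<Sum>(d, k)\<leftarrow>T. c * d * (h \<bullet> k) ^ n) else 0)"
proof -
  let ?c = "\<lambda>S i. fst (S ! i)" and ?h = "\<lambda>S i. snd (S ! i)"
  let ?e = "\<lambda>w i j. (?c S i * ?c T j) * (shermite m (?h S i \<bullet> ?h S i) (W (?h S i) w) * shermite n (?h T j \<bullet> ?h T j) (W (?h T j) w))"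
  have "(LINT w|M. cyl (level m S) w * cyl (level n T) w) =
     (LINT w|M. (\<Sum>i<length S. \<Sum>j<length T. ?e w i j))"
    unfolding cyl_level sum_list_prod_index sum_product
    by (intro Bochner_Integration.integral_cong sum.cong refl) (simp add: mult_ac)
  also have "\<dots> = (\<Sum>i<length S. LINT w|M. (\<Sum>j<length T. ?e w i j))"
    by (rule Bochner_Integration.integral_sum)
       (rule Bochner_Integration.integrable_sum, rule momentsD(4),
        intro moments_mult moments_const moments_shermite)
  also have "\<dots> = (\<Sum>i<length S. \<Sum>j<length T. LINT w|M. ?e w i j)"
    by (rule sum.cong[OF refl], rule Bochner_Integration.integral_sum, rule momentsD(4))
       (intro moments_mult moments_const moments_shermite)
  also have "\<dots> = (\<Sum>i<length S. \<Sum>j<length T. (?c S i * ?c T j) *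
      (if m = n then fact n * (?h S i \<bullet> ?h T j) ^ n else 0))"
    by (simp only: integral_mult_right_zero expectation_shermite_mult)
  also have "\<dots> = (if m = n then fact n * (\<Sum>(c, h)\<leftarrow>S. \<Sum>(d, k)\<leftarrow>T. c * d * (h \<bullet> k) ^ n) else 0)"
    by (auto simp: sum_list_prod_index sum_distrib_left intro!: sum.cong)
  finally show ?thesis .
qed

lemma expectation_cyl_level_square:
  "(LINT w|M. (cyl (level n T) w)\<^sup>2) = fact n * tensor_form n T"
  using expectation_cyl_level_mult[of n T n T] by (simp add: tensor_form_def power2_eq_square)

text \<open>The link between the gradient of a polynomial and the first-slot contraction through
  which \<open>malliavin_derivative\<close> is defined.\<close>

lemma inner_dcyl_level:
  "h \<bullet> dcyl (level (Suc n) T) w = real (Suc n) * cyl (level n (contract h T)) w"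
proof (induction T)
  case (Cons p T)
  obtain c k where p: "p = (c, k)" by (cases p)
  show ?case using Cons by (simp add: p level_def contract_def inner_add algebra_simps)
qed (simp add: level_def contract_def)

lemma dcyl_level_inner:
  "dcyl (level (Suc n) S) w \<bullet> dcyl (level (Suc n) T) w =
    (\<Sum>(c, h)\<leftarrow>S. (c * real (Suc n) * shermite n (h \<bullet> h) (W h w)) * (real (Suc n) * cyl (level n (contract h T)) w))"
proof (induction S)
  case (Cons p S)
  obtain c k where p: "p = (c, k)" by (cases p)
  have "dcyl (level (Suc n) (p # S)) w =
      (c * real (Suc n) * shermite n (k \<bullet> k) (W k w)) *\<^sub>R k + dcyl (level (Suc n) S) w"
    by (simp add: p level_def)
  then show ?case
    by (simp only: p inner_add_left inner_scaleR_left inner_dcyl_level[of k] Cons sum_list.Cons list.map prod.case)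
qed (simp add: level_def)

text \<open>Contracting with \<open>h\<close> supplies one more factor \<open>h \<bullet> k\<close>,
  which lifts the Gram form from degree \<open>n\<close> to \<open>Suc n\<close>. On a fixed chaos,
  approximations that are bounded in L2 therefore have bounded gradients.\<close>

lemma expectation_dcyl_level_square:
  "(LINT w|M. (norm (dcyl (level (Suc n) T) w))\<^sup>2) =
    real (Suc n) * (LINT w|M. (cyl (level (Suc n) T) w)\<^sup>2)"
proof -
  let ?c = "\<lambda>i. fst (T ! i)" and ?h = "\<lambda>i. snd (T ! i)"
  have 1: "(LINT w|M. shermite n (h \<bullet> h) (W h w) * cyl (level n S) w) = fact n * (\<Sum>(d, k)\<leftarrow>S. d * (h \<bullet> k) ^ n)"
    for h S using expectation_cyl_level_mult[of n "[(1, h)]" n S] by (simp add: level_def)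
  have "(LINT w|M. (norm (dcyl (level (Suc n) T) w))\<^sup>2) =
     (LINT w|M. (\<Sum>i<length T. (?c i * real (Suc n) * real (Suc n)) * (shermite n (?h i \<bullet> ?h i) (W (?h i) w) * cyl (level n (contract (?h i) T)) w)))"
    unfolding power2_norm_eq_inner dcyl_level_inner sum_list_prod_index
    by (intro Bochner_Integration.integral_cong sum.cong refl) (simp only: mult_ac)
  also have "\<dots> = (\<Sum>i<length T. LINT w|M. (?c i * real (Suc n) * real (Suc n)) * (shermite n (?h i \<bullet> ?h i) (W (?h i) w) * cyl (level n (contract (?h i) T)) w))"
    by (intro Bochner_Integration.integral_sum momentsD(4) moments_mult moments_const moments_shermite moments_cyl)
  also have "\<dots> = (\<Sum>i<length T. (?c i * real (Suc n) * real (Suc n)) * (fact n * (\<Sum>(d, k)\<leftarrow>contract (?h i) T. d * (?h i \<bullet> k) ^ n)))"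
    by (simp only: integral_mult_right_zero 1)
  also have "\<dots> = real (Suc n) * (fact (Suc n) * tensor_form (Suc n) T)"
  proof -
    have "(\<Sum>(d, k)\<leftarrow>contract h T. d * (h \<bullet> k) ^ n) = (\<Sum>(d, k)\<leftarrow>T. d * (h \<bullet> k) ^ Suc n)" for h
      by (induction T) (auto simp: contract_def)
    then show ?thesis
      by (simp only: tensor_form_def sum_list_prod_index sum_distrib_left)
         (intro sum.cong refl, simp add: mult_ac)
  qed
  finally show ?thesis by (simp only: expectation_cyl_level_square)
qed

text \<open>The scaled Hermite polynomials in the definition agree almost surely with
  \<open>shermite\<close>. For \<open>h = 0\<close> this rests on \<open>W 0 = 0\<close> almost
  surely and on both expressions being 1 in degree 0 and 0 in higher degrees.\<close>

lemma multiple_integral_cyl: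
  assumes "multiple_integral M W n f Y"
  obtains T where "(\<lambda>k. tensor_norm_sq n (\<lambda>hs. tensor_sum (T k) hs - f hs)) \<longlonglongrightarrow> 0"
    "L2_tendsto M (\<lambda>k. cyl (level n (T k))) Y"
proof -
  obtain T where T: "(\<lambda>k. tensor_norm_sq n (\<lambda>hs. tensor_sum (T k) hs - f hs)) \<longlonglongrightarrow> 0"
    and Y: "L2_tendsto M (\<lambda>k w. \<Sum>(c, h)\<leftarrow>T k. c * (norm h ^ n * hermite n (W h w / norm h))) Y"
    using assms by (auto simp: multiple_integral_def)
  have 1: "AE w in M. norm h ^ n * hermite n (W h w / norm h) = shermite n (h \<bullet> h) (W h w)" for h
  proof (cases "h = 0")
    case True
    have "shermite n 0 0 = 0 ^ n * hermite n 0" by (induction n rule: induct_nat_012) auto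
    then show ?thesis using W_zero unfolding True by auto
  qed (simp add: shermite_hermite)
  have 2: "AE w in M. (\<Sum>(c, h)\<leftarrow>S. c * (norm h ^ n * hermite n (W h w / norm h))) = cyl (level n S) w" for S
  proof (induction S)
    case (Cons p S)
    obtain c h where p: "p = (c, h)" by (cases p)
    from Cons 1[of h] show ?case by eventually_elim (simp add: p level_def)
  qed (simp add: level_def)
  have "L2_tendsto M (\<lambda>k. cyl (level n (T k))) Y"
    by (rule L2_tendsto_cong_AE[OF Y 2]) measurable
  with T that show thesis by blast
qed

text \<open>The sequences that approximate the integral of \<open>f\<close> and those of its
  contractions are a priori unrelated. Contracting the approximations of \<open>f\<close> gives a
  second approximation of the contracted tensor, and two approximations of one tensor have L2-close
  integrals by the isometry. Hence a single \<open>T\<close> serves all \<open>h\<close>.\<close>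

lemma multiple_integral_derivative:
  assumes J: "multiple_integral M W (Suc n) f J"
    and D: "\<And>h. multiple_integral M W n (\<lambda>hs. f (h # hs)) (\<lambda>w. h \<bullet> D w)"
  obtains T where "L2_tendsto M (\<lambda>k. cyl (level (Suc n) (T k))) J"
    "\<And>h. L2_tendsto M (\<lambda>k w. h \<bullet> dcyl (level (Suc n) (T k)) w) (\<lambda>w. h \<bullet> (real (Suc n) *\<^sub>R D w))"
proof -
  obtain T where T: "(\<lambda>k. tensor_norm_sq (Suc n) (\<lambda>hs. tensor_sum (T k) hs - f hs)) \<longlonglongrightarrow> 0"
    and Y: "L2_tendsto M (\<lambda>k. cyl (level (Suc n) (T k))) J"
    using multiple_integral_cyl[OF J] by blast
  have linf: "linear (\<lambda>x. f (x # hs))" if "length hs = n" for hs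
  proof -
    \<comment> \<open>Linearity is available for updates of a slot; updating slot 0 of a list with
      an arbitrary head is the same as prepending \<open>x\<close>.\<close>
    have "linear (\<lambda>x. f ((undefined # hs)[0 := x]))"
      using J that unfolding multiple_integral_def sym_tensor_def
      by (metis length_Cons zero_less_Suc)
    then show ?thesis by simp
  qed
  have "L2_tendsto M (\<lambda>k w. h \<bullet> dcyl (level (Suc n) (T k)) w) (\<lambda>w. h \<bullet> (real (Suc n) *\<^sub>R D w))" for h
  proof -
    obtain S where S: "(\<lambda>k. tensor_norm_sq n (\<lambda>hs. tensor_sum (S k) hs - f (h # hs))) \<longlonglongrightarrow> 0"
      and Z: "L2_tendsto M (\<lambda>k. cyl (level n (S k))) (\<lambda>w. h \<bullet> D w)"
      using multiple_integral_cyl[OF D[of h]] by blast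
    have le: "ennreal (LINT w|M. (norm (cyl (level n (contract h (T k))) w - cyl (level n (S k)) w))\<^sup>2) \<le>
        ennreal (fact n) * (2 * (ennreal ((norm h)\<^sup>2) * tensor_norm_sq (Suc n) (\<lambda>hs. tensor_sum (T k) hs - f hs)) +
          2 * tensor_norm_sq n (\<lambda>hs. tensor_sum (S k) hs - f (h # hs)))" (is "_ \<le> ?b k") for k
    proof -
      let ?U = "contract h (T k) @ neg_tensor (S k)"
      have "cyl (level n (contract h (T k))) w - cyl (level n (S k)) w = cyl (level n ?U) w" for w
      proof -
        have "cyl (level n (neg_tensor S)) w = - cyl (level n S) w" for S
          by (induction S) (auto simp: level_def neg_tensor_def)
        then show ?thesis by (simp add: level_def cyl_append)
      qed
      then have "ennreal (LINT w|M. (norm (cyl (level n (contract h (T k))) w - cyl (level n (S k)) w))\<^sup>2) =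
         ennreal (fact n) * ennreal (tensor_form n ?U)"
        by (simp add: expectation_cyl_level_square ennreal_mult')
      also have "\<dots> \<le> ennreal (fact n) * tensor_norm_sq n (tensor_sum ?U)"
        by (intro mult_left_mono tensor_form_le_norm) auto
      also have "tensor_sum ?U = (\<lambda>hs. (tensor_sum (T k) (h # hs) - f (h # hs)) - (tensor_sum (S k) hs - f (h # hs)))"
        by (simp only: tensor_sum_append_neg tensor_sum_contract fun_eq_iff) simp
      also have "ennreal (fact n) * tensor_norm_sq n \<dots> \<le> ennreal (fact n) *
          (2 * tensor_norm_sq n (\<lambda>hs. tensor_sum (T k) (h # hs) - f (h # hs)) +
           2 * tensor_norm_sq n (\<lambda>hs. tensor_sum (S k) hs - f (h # hs)))"
        by (intro mult_left_mono tensor_norm_sq_diff_le) auto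
      also have "\<dots> \<le> ?b k"
        by (intro mult_left_mono add_mono tensor_norm_sq_contract_le[where g="\<lambda>hs. tensor_sum (T k) hs - f hs"]
            linear_compose_sub linear_tensor_sum linf order_refl) auto
      finally show ?thesis .
    qed
    have b0: "(\<lambda>k. ennreal (fact n) * (2 * (ennreal ((norm h)\<^sup>2) * tensor_norm_sq (Suc n) (\<lambda>hs. tensor_sum (T k) hs - f hs)) +
          2 * tensor_norm_sq n (\<lambda>hs. tensor_sum (S k) hs - f (h # hs)))) \<longlonglongrightarrow> 0"
    proof -
      have "(\<lambda>k. ennreal (fact n) * (2 * (ennreal ((norm h)\<^sup>2) * tensor_norm_sq (Suc n) (\<lambda>hs. tensor_sum (T k) hs - f hs)) +
          2 * tensor_norm_sq n (\<lambda>hs. tensor_sum (S k) hs - f (h # hs)))) \<longlonglongrightarrow>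
          ennreal (fact n) * (2 * (ennreal ((norm h)\<^sup>2) * 0) + 2 * 0)"
        by (intro ennreal_tendsto_cmult tendsto_add T S) auto
      then show ?thesis by simp
    qed
    have "L2_tendsto M (\<lambda>k. cyl (level n (contract h (T k)))) (\<lambda>w. h \<bullet> D w)"
      by (rule L2_tendsto_zeroI[OF Z momentsD(3)[OF moments_cyl] ennreal_tendsto_0_squeeze[OF _ le b0]]) simp
    from L2_tendsto_scaleR[OF this, of "real (Suc n)"] show ?thesis
      by (simp only: inner_dcyl_level inner_scaleR_right real_scaleR_def)
  qed
  with Y that show thesis by blast
qed

end

section \<open>The integration by parts formula for chaos expansions\<close>

lemma L2_tendsto_lipschitz:
  fixes \<phi> \<phi>' :: "real \<Rightarrow> real"
  assumes M: "finite_measure M" and D: "\<And>x. (\<phi> has_real_derivative \<phi>' x) (at x)" and B: "\<And>x. \<bar>\<phi>' x\<bar> \<le> C"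
    and Y: "L2_tendsto M Y y"
  shows "L2_tendsto M (\<lambda>k w. \<phi> (Y k w)) (\<lambda>w. \<phi> (y w))"
proof -
  interpret finite_measure M by fact
  have c\<phi>: "continuous_on UNIV \<phi>"
    by (rule DERIV_continuous_on[OF has_field_derivative_at_within[OF D]])
  have [measurable]: "\<phi> \<in> borel_measurable borel"
    by (rule borel_measurable_continuous_onI[OF c\<phi>])
  have lip: "\<bar>\<phi> a - \<phi> b\<bar> \<le> C * \<bar>a - b\<bar>" for a b
  proof -
    have "norm (\<phi> a - \<phi> b) \<le> C * norm (a - b)"
      by (rule field_differentiable_bound[of UNIV, where f'=\<phi>'])
         (auto intro: has_field_derivative_at_within[OF D] B)
    then show ?thesis by simp
  qed
  have C: "C \<ge> 0" using B[of 0] by linarith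
  have L: "\<And>k. Y k \<in> L2 M" "y \<in> L2 M" using Y by (auto simp: L2_tendsto_def)
  have \<phi>L: "(\<lambda>w. \<phi> (f w)) \<in> L2 M" if f: "f \<in> L2 M" for f
  proof -
    note [measurable] = L2D(1)[OF f]
    have "(\<lambda>w. \<bar>\<phi> 0\<bar> + C * \<bar>f w\<bar>) \<in> L2 M"
      using L2_norm[OF f] by (intro L2_add L2_const L2_mult) simp
    then show ?thesis
    proof (rule L2_dominated[where C=1])
      have "\<bar>\<phi> y\<bar> \<le> \<bar>\<phi> 0\<bar> + C * \<bar>y\<bar>" for y using lip[of y 0] by simp
      then show "AE w in M. norm (\<phi> (f w)) \<le> 1 * norm (\<bar>\<phi> 0\<bar> + C * \<bar>f w\<bar>)"
        using C by (auto simp: abs_of_nonneg)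
    qed measurable
  qed
  have "(\<lambda>k. LINT w|M. (norm (\<phi> (Y k w) - \<phi> (y w)))\<^sup>2) \<longlonglongrightarrow> 0"
  proof (rule Lim_null_comparison)
    show "\<forall>\<^sub>F k in sequentially. norm (LINT w|M. (norm (\<phi> (Y k w) - \<phi> (y w)))\<^sup>2) \<le>
        C\<^sup>2 * (LINT w|M. (norm (Y k w - y w))\<^sup>2)"
    proof (rule always_eventually, rule allI)
      fix k
      have "(LINT w|M. (norm (\<phi> (Y k w) - \<phi> (y w)))\<^sup>2) \<le> (LINT w|M. C\<^sup>2 * (norm (Y k w - y w))\<^sup>2)"
      proof (rule integral_mono)
        show "integrable M (\<lambda>w. (norm (\<phi> (Y k w) - \<phi> (y w)))\<^sup>2)"
          by (intro L2D(2) L2_diff \<phi>L L)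
        show "integrable M (\<lambda>w. C\<^sup>2 * (norm (Y k w - y w))\<^sup>2)"
          by (intro integrable_mult_right L2D(2) L2_diff L)
        fix w
        have "(norm (\<phi> (Y k w) - \<phi> (y w)))\<^sup>2 \<le> (C * norm (Y k w - y w))\<^sup>2"
          using lip by (intro power_mono) auto
        then show "(norm (\<phi> (Y k w) - \<phi> (y w)))\<^sup>2 \<le> C\<^sup>2 * (norm (Y k w - y w))\<^sup>2"
          by (simp only: power_mult_distrib)
      qed
      then show "norm (LINT w|M. (norm (\<phi> (Y k w) - \<phi> (y w)))\<^sup>2) \<le> C\<^sup>2 * (LINT w|M. (norm (Y k w - y w))\<^sup>2)"
        by simp
    qed
    show "(\<lambda>k. C\<^sup>2 * (LINT w|M. (norm (Y k w - y w))\<^sup>2)) \<longlonglongrightarrow> 0"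
      using Y by (intro tendsto_mult_right_zero) (simp add: L2_tendsto_def)
  qed
  then show ?thesis using \<phi>L L by (simp add: L2_tendsto_def)
qed

text \<open>The left-hand side converges because \<open>\<phi>\<close> is Lipschitz. On the right,
  \<open>F\<close> converges weakly with bounded norms, while \<open>\<phi>' (Y k) U\<close>
  converges strongly, so their pairing converges.\<close>

lemma integration_by_parts_closed:
  fixes \<phi> \<phi>' :: "real \<Rightarrow> real" and F :: "nat \<Rightarrow> 'a \<Rightarrow> 'h::{real_inner,second_countable_topology}"
  assumes M: "finite_measure M" and D: "\<And>x. (\<phi> has_real_derivative \<phi>' x) (at x)"
    and c: "continuous_on UNIV \<phi>'" and B: "\<And>x. \<bar>\<phi>' x\<bar> \<le> C"
    and Y: "L2_tendsto M Y y" and F: "\<And>k. F k \<in> L2 M" and f: "f \<in> L2 M"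
    and bd: "\<And>k. (LINT w|M. (norm (F k w))\<^sup>2) \<le> K"
    and weak: "\<And>V. V \<in> L2 M \<Longrightarrow> (\<lambda>k. LINT w|M. F k w \<bullet> V w) \<longlonglongrightarrow> (LINT w|M. f w \<bullet> V w)"
    and X: "X \<in> L2 M" and U: "U \<in> L2 M"
    and eq: "\<And>k. (LINT w|M. \<phi> (Y k w) * X w) = (LINT w|M. \<phi>' (Y k w) * (F k w \<bullet> U w))"
  shows "(LINT w|M. \<phi> (y w) * X w) = (LINT w|M. \<phi>' (y w) * (f w \<bullet> U w))"
proof -
  interpret finite_measure M by fact
  \<comment> \<open>\<open>\<phi>'\<close> is merely continuous and bounded, so strong convergence
    is obtained from dominated convergence along an almost surely convergent subsequence.\<close>
  obtain r where r: "strict_mono r" "AE w in M. (\<lambda>k. Y (r k) w) \<longlonglongrightarrow> y w"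
    using L2_tendsto_AE_subseq[OF Y] by blast
  have L: "\<And>k. Y k \<in> L2 M" "y \<in> L2 M" using Y by (auto simp: L2_tendsto_def)
  note [measurable] = L2D(1)[OF L(1)] L2D(1)[OF L(2)] L2D(1)[OF U]
  have [measurable]: "\<phi>' \<in> borel_measurable borel" by (rule borel_measurable_continuous_onI[OF c])
  have C: "C \<ge> 0" using B[of 0] by linarith
  define G where "G k w = \<phi>' (Y (r k) w) *\<^sub>R U w" for k w
  define g where "g w = \<phi>' (y w) *\<^sub>R U w" for w
  have GL: "G k \<in> L2 M" for k
    by (rule L2_dominated[OF U, where C=C]) (auto simp: G_def[abs_def] intro!: AE_I2 mult_right_mono B)
  have gL: "g \<in> L2 M"
    by (rule L2_dominated[OF U, where C=C]) (auto simp: g_def[abs_def] intro!: AE_I2 mult_right_mono B)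
  have [measurable]: "G k \<in> borel_measurable M" "g \<in> borel_measurable M" for k
    using L2D(1)[OF GL] L2D(1)[OF gL] by auto
  have G0: "(\<lambda>k. LINT w|M. (norm (G k w - g w))\<^sup>2) \<longlonglongrightarrow> (LINT w|M. 0)"
  proof (rule integral_dominated_convergence[where w="\<lambda>w. (2 * C)\<^sup>2 * (norm (U w))\<^sup>2"])
    show "integrable M (\<lambda>w. (2 * C)\<^sup>2 * (norm (U w))\<^sup>2)" using L2D(2)[OF U] by simp
    show "AE w in M. (\<lambda>k. (norm (G k w - g w))\<^sup>2) \<longlonglongrightarrow> 0"
      using r(2)
    proof eventually_elim
      case (elim w)
      have "(\<lambda>k. \<phi>' (Y (r k) w)) \<longlonglongrightarrow> \<phi>' (y w)"
        by (rule continuous_on_tendsto_compose[OF c elim]) auto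
      then have "(\<lambda>k. G k w) \<longlonglongrightarrow> g w" unfolding G_def g_def by (intro tendsto_scaleR tendsto_const)
      then have "(\<lambda>k. norm (G k w - g w)) \<longlonglongrightarrow> 0" using LIM_zero tendsto_norm_zero by blast
      from tendsto_power[OF this, of 2] show ?case by simp
    qed
    show "AE w in M. norm ((norm (G k w - g w))\<^sup>2) \<le> (2 * C)\<^sup>2 * (norm (U w))\<^sup>2" for k
    proof (rule AE_I2)
      fix w
      have "norm (G k w - g w) = \<bar>\<phi>' (Y (r k) w) - \<phi>' (y w)\<bar> * norm (U w)"
        by (simp add: G_def g_def scaleR_diff_left[symmetric])
      also have "\<dots> \<le> (2 * C) * norm (U w)"
        using B[of "Y (r k) w"] B[of "y w"] by (intro mult_right_mono) auto
      finally have "(norm (G k w - g w))\<^sup>2 \<le> ((2 * C) * norm (U w))\<^sup>2" by (rule power_mono) simp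
      then show "norm ((norm (G k w - g w))\<^sup>2) \<le> (2 * C)\<^sup>2 * (norm (U w))\<^sup>2"
        by (simp add: power_mult_distrib)
    qed
  qed simp_all
  have "(\<lambda>k. (LINT w|M. F (r k) w \<bullet> G k w) - (LINT w|M. F (r k) w \<bullet> g w)) \<longlonglongrightarrow> 0"
  proof (rule Lim_null_comparison)
    show "\<forall>\<^sub>F k in sequentially. norm ((LINT w|M. F (r k) w \<bullet> G k w) - (LINT w|M. F (r k) w \<bullet> g w))
       \<le> sqrt K * sqrt (LINT w|M. (norm (G k w - g w))\<^sup>2)"
    proof (rule always_eventually, rule allI)
      fix k
      have "(LINT w|M. F (r k) w \<bullet> G k w) - (LINT w|M. F (r k) w \<bullet> g w) = (LINT w|M. F (r k) w \<bullet> (G k w - g w))"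
        using L2_inner_integrable[OF F[of "r k"] GL[of k]] L2_inner_integrable[OF F[of "r k"] gL]
        by (simp add: inner_diff_right)
      moreover have "sqrt (LINT w|M. (norm (F (r k) w))\<^sup>2) * sqrt (LINT w|M. (norm (G k w - g w))\<^sup>2) \<le>
         sqrt K * sqrt (LINT w|M. (norm (G k w - g w))\<^sup>2)"
        using bd by (intro mult_right_mono) auto
      ultimately show "norm ((LINT w|M. F (r k) w \<bullet> G k w) - (LINT w|M. F (r k) w \<bullet> g w))
         \<le> sqrt K * sqrt (LINT w|M. (norm (G k w - g w))\<^sup>2)"
        using L2_Cauchy_Schwarz[OF F[of "r k"] L2_diff[OF GL[of k] gL]] by simp
    qed
    show "(\<lambda>k. sqrt K * sqrt (LINT w|M. (norm (G k w - g w))\<^sup>2)) \<longlonglongrightarrow> 0"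
      using tendsto_real_sqrt[OF G0] by (intro tendsto_mult_right_zero) simp
  qed
  from tendsto_add[OF this LIMSEQ_subseq_LIMSEQ[OF weak[OF gL] r(1), unfolded o_def]]
  have "(\<lambda>k. LINT w|M. F (r k) w \<bullet> G k w) \<longlonglongrightarrow> (LINT w|M. f w \<bullet> g w)" by simp
  moreover have "(LINT w|M. F (r k) w \<bullet> G k w) = (LINT w|M. \<phi> (Y (r k) w) * X w)" for k
    unfolding eq G_def by simp
  ultimately have "(\<lambda>k. LINT w|M. \<phi> (Y (r k) w) * X w) \<longlonglongrightarrow> (LINT w|M. f w \<bullet> g w)" by simp
  moreover have "(\<lambda>k. LINT w|M. \<phi> (Y (r k) w) * X w) \<longlonglongrightarrow> (LINT w|M. \<phi> (y w) * X w)"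
    using L2_tendsto_inner[OF L2_tendsto_lipschitz[OF M D B L2_tendsto_subseq[OF Y r(1)]] L2_tendsto_const[OF X]] by simp
  ultimately have "(LINT w|M. f w \<bullet> g w) = (LINT w|M. \<phi> (y w) * X w)" by (rule LIMSEQ_unique)
  then show ?thesis by (simp add: g_def)
qed

context isonormal begin

text \<open>\<open>Suc n\<close> is the eigenvalue of \<open>- L\<close> on this chaos; here it
  comes from the factor carried by the gradient of \<open>shermite (Suc n)\<close>. The formula for
  one vector extends by linearity in \<open>T\<close>.\<close>

lemma cyl_level_duality:
  fixes \<phi> \<phi>' :: "real \<Rightarrow> real"
  assumes D: "\<And>x. (\<phi> has_real_derivative \<phi>' x) (at x)" and c: "continuous_on UNIV \<phi>'"
    and B: "\<And>x. \<bar>\<phi>' x\<bar> \<le> C"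
  shows "real (Suc n) * (LINT w|M. \<phi> (cyl L w) * cyl (level (Suc n) T) w) =
    (LINT w|M. \<phi>' (cyl L w) * (dcyl L w \<bullet> dcyl (level (Suc n) T) w))"
proof (induction T)
  case Nil
  then show ?case by (simp add: level_def)
next
  case (Cons p T)
  obtain d h where p: "p = (d, h)" by (cases p)
  have m\<phi>: "(\<lambda>w. \<phi> (cyl L w)) \<in> moments M" by (rule moments_lipschitz[OF D B moments_cyl])
  have [measurable]: "\<phi>' \<in> borel_measurable borel" by (rule borel_measurable_continuous_onI[OF c])
  have m\<phi>': "(\<lambda>w. \<phi>' (cyl L w)) \<in> moments M"
    by (rule moments_bounded_compose[OF _ _ B]) measurable
  have i: "integrable M (\<lambda>w. \<phi> (cyl L w) * shermite (Suc n) (h \<bullet> h) (W h w))"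
    "integrable M (\<lambda>w. \<phi> (cyl L w) * cyl (level (Suc n) T) w)"
    by (intro momentsD(4) moments_mult m\<phi> moments_shermite moments_cyl)+
  have md: "(\<lambda>w. dcyl L w \<bullet> dcyl (level (Suc n) T) w) \<in> moments M"
  proof -
    have "(\<lambda>w. dcyl L w \<bullet> dcyl S w) \<in> moments M" for S
    proof (induction S)
      case (Cons p S)
      obtain m d h where p: "p = (m, d, h)" by (cases p)
      have "(\<lambda>w. (d * real m) * shermite (m - 1) (h \<bullet> h) (W h w) * (h \<bullet> dcyl L w) + dcyl L w \<bullet> dcyl S w) \<in> moments M"
        by (intro moments_add moments_mult moments_const moments_shermite moments_dcyl Cons)
      moreover have "dcyl L w \<bullet> dcyl (p # S) w =
          (d * real m) * shermite (m - 1) (h \<bullet> h) (W h w) * (h \<bullet> dcyl L w) + dcyl L w \<bullet> dcyl S w" for w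
        by (simp add: p inner_add_right inner_commute)
      ultimately show ?case by (simp only:)
    qed (simp add: moments_const)
    then show ?thesis .
  qed
  have i': "integrable M (\<lambda>w. \<phi>' (cyl L w) * (h \<bullet> dcyl L w) * shermite n (h \<bullet> h) (W h w))"
    "integrable M (\<lambda>w. \<phi>' (cyl L w) * (dcyl L w \<bullet> dcyl (level (Suc n) T) w))"
    by (intro momentsD(4) moments_mult m\<phi>' moments_shermite moments_dcyl md)+
  have "(LINT w|M. \<phi> (cyl L w) * cyl (level (Suc n) (p # T)) w) =
     (LINT w|M. d * (\<phi> (cyl L w) * shermite (Suc n) (h \<bullet> h) (W h w)) + \<phi> (cyl L w) * cyl (level (Suc n) T) w)"
    by (intro Bochner_Integration.integral_cong refl) (simp add: p level_def distrib_left)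
  also have "\<dots> = d * (LINT w|M. \<phi> (cyl L w) * shermite (Suc n) (h \<bullet> h) (W h w)) +
     (LINT w|M. \<phi> (cyl L w) * cyl (level (Suc n) T) w)"
    using i by (simp del: shermite.simps)
  finally have 1: "real (Suc n) * (LINT w|M. \<phi> (cyl L w) * cyl (level (Suc n) (p # T)) w) =
     d * real (Suc n) * (LINT w|M. \<phi>' (cyl L w) * (h \<bullet> dcyl L w) * shermite n (h \<bullet> h) (W h w)) +
     (LINT w|M. \<phi>' (cyl L w) * (dcyl L w \<bullet> dcyl (level (Suc n) T) w))"
    unfolding cyl_integration_by_parts[OF D c B] Cons[symmetric] by (simp add: algebra_simps)
  have "(LINT w|M. \<phi>' (cyl L w) * (dcyl L w \<bullet> dcyl (level (Suc n) (p # T)) w)) =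
    (LINT w|M. (d * real (Suc n)) * (\<phi>' (cyl L w) * (h \<bullet> dcyl L w) * shermite n (h \<bullet> h) (W h w)) +
       \<phi>' (cyl L w) * (dcyl L w \<bullet> dcyl (level (Suc n) T) w))"
    by (intro Bochner_Integration.integral_cong refl)
       (simp add: p level_def inner_add_right inner_commute algebra_simps)
  also have "\<dots> = d * real (Suc n) * (LINT w|M. \<phi>' (cyl L w) * (h \<bullet> dcyl L w) * shermite n (h \<bullet> h) (W h w)) +
     (LINT w|M. \<phi>' (cyl L w) * (dcyl L w \<bullet> dcyl (level (Suc n) T) w))"
    using i' by simp
  finally show ?case using 1 by simp
qed

text \<open>\<open>dcyl L\<close> has values in the span of finitely many fixed vectors, with
  polynomial coefficients, so convergence of the scalar products with fixed vectors is
  enough.\<close>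

lemma integral_inner_dcyl_tendsto:
  assumes Z: "\<And>h. L2_tendsto M (\<lambda>k w. h \<bullet> Z k w) (\<lambda>w. h \<bullet> z w)" and \<psi>: "\<psi> \<in> moments M"
  shows "(\<lambda>k. LINT w|M. \<psi> w * (dcyl L w \<bullet> Z k w)) \<longlonglongrightarrow> (LINT w|M. \<psi> w * (dcyl L w \<bullet> z w))"
proof -
  \<comment> \<open>Integrability is carried through the induction because each step splits the
    integral of a sum.\<close>
  have "(\<forall>k. integrable M (\<lambda>w. \<psi> w * (dcyl L w \<bullet> Z k w))) \<and> integrable M (\<lambda>w. \<psi> w * (dcyl L w \<bullet> z w)) \<and>
    (\<lambda>k. LINT w|M. \<psi> w * (dcyl L w \<bullet> Z k w)) \<longlonglongrightarrow> (LINT w|M. \<psi> w * (dcyl L w \<bullet> z w))"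
  proof (induction L)
    case (Cons p L)
    obtain m d h where p: "p = (m, d, h)" by (cases p)
    let ?a = "\<lambda>w. \<psi> w * ((d * real m) * shermite (m - 1) (h \<bullet> h) (W h w))"
    have a: "?a \<in> L2 M"
      by (intro momentsD(3) moments_mult moments_const moments_shermite \<psi>)
    have hZ: "\<And>k. (\<lambda>w. h \<bullet> Z k w) \<in> L2 M" "(\<lambda>w. h \<bullet> z w) \<in> L2 M"
      using Z[of h] by (auto simp: L2_tendsto_def)
    have i: "integrable M (\<lambda>w. ?a w * (h \<bullet> Z k w))" "integrable M (\<lambda>w. ?a w * (h \<bullet> z w))" for k
      using L2_inner_integrable[OF a hZ(1)[of k]] L2_inner_integrable[OF a hZ(2)] by simp_all
    have l: "(\<lambda>k. LINT w|M. ?a w * (h \<bullet> Z k w)) \<longlonglongrightarrow> (LINT w|M. ?a w * (h \<bullet> z w))"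
      using L2_tendsto_inner[OF L2_tendsto_const[OF a] Z[of h]] by simp
    have e: "\<psi> w * (dcyl (p # L) w \<bullet> v) = ?a w * (h \<bullet> v) + \<psi> w * (dcyl L w \<bullet> v)" for w v
      by (simp add: p inner_add_left algebra_simps)
    show ?case
      unfolding e using Cons i tendsto_add[OF l conjunct2[OF conjunct2[OF Cons]]] by simp
  qed simp
  then show ?thesis by blast
qed

text \<open>The nonlinear factor stays fixed while the linear one is approximated. The gradients are
  paired with \<open>dcyl L\<close>, for which their weak convergence suffices.\<close>

lemma level_duality:
  fixes \<phi> \<phi>' :: "real \<Rightarrow> real"
  assumes D: "\<And>x. (\<phi> has_real_derivative \<phi>' x) (at x)" and c: "continuous_on UNIV \<phi>'"
    and B: "\<And>x. \<bar>\<phi>' x\<bar> \<le> C"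
    and J: "multiple_integral M W (Suc n) f J"
    and E: "\<And>h. multiple_integral M W n (\<lambda>hs. f (h # hs)) (\<lambda>w. h \<bullet> E w)"
  shows "real (Suc n) * (LINT w|M. \<phi> (cyl L w) * J w) =
    (LINT w|M. \<phi>' (cyl L w) * (dcyl L w \<bullet> (real (Suc n) *\<^sub>R E w)))"
proof -
  obtain T where T: "L2_tendsto M (\<lambda>k. cyl (level (Suc n) (T k))) J"
    "\<And>h. L2_tendsto M (\<lambda>k w. h \<bullet> dcyl (level (Suc n) (T k)) w) (\<lambda>w. h \<bullet> (real (Suc n) *\<^sub>R E w))"
    using multiple_integral_derivative[OF J E] by blast
  have m\<phi>: "(\<lambda>w. \<phi> (cyl L w)) \<in> moments M" by (rule moments_lipschitz[OF D B moments_cyl])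
  have [measurable]: "\<phi>' \<in> borel_measurable borel" by (rule borel_measurable_continuous_onI[OF c])
  have m\<phi>': "(\<lambda>w. \<phi>' (cyl L w)) \<in> moments M"
    by (rule moments_bounded_compose[OF _ _ B]) measurable
  have "(\<lambda>k. real (Suc n) * (LINT w|M. \<phi> (cyl L w) * cyl (level (Suc n) (T k)) w)) \<longlonglongrightarrow>
     real (Suc n) * (LINT w|M. \<phi> (cyl L w) * J w)"
    using L2_tendsto_inner[OF L2_tendsto_const[OF momentsD(3)[OF m\<phi>]] T(1)]
    by (intro tendsto_mult_left) simp
  moreover have "(\<lambda>k. real (Suc n) * (LINT w|M. \<phi> (cyl L w) * cyl (level (Suc n) (T k)) w)) \<longlonglongrightarrow>
     (LINT w|M. \<phi>' (cyl L w) * (dcyl L w \<bullet> (real (Suc n) *\<^sub>R E w)))"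
    unfolding cyl_level_duality[OF D c B] by (rule integral_inner_dcyl_tendsto[OF T(2) m\<phi>'])
  ultimately show ?thesis by (rule LIMSEQ_unique)
qed

section \<open>Orthogonality and uniqueness of chaos components\<close>

lemma multiple_integral_L2: "multiple_integral M W n f J \<Longrightarrow> J \<in> L2 M"
  by (auto simp: multiple_integral_def L2_tendsto_def)

lemma multiple_integral_orthogonal:
  assumes "multiple_integral M W m f I" "multiple_integral M W n g J" "m \<noteq> n"
  shows "(LINT w|M. I w * J w) = 0"
proof -
  obtain S where S: "L2_tendsto M (\<lambda>k. cyl (level m (S k))) I"
    using multiple_integral_cyl[OF assms(1)] by blast
  obtain T where T: "L2_tendsto M (\<lambda>k. cyl (level n (T k))) J"
    using multiple_integral_cyl[OF assms(2)] by blast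
  have "(\<lambda>k. 0) \<longlonglongrightarrow> (LINT w|M. I w * J w)"
    using L2_tendsto_inner[OF S T] assms(3) by (simp add: expectation_cyl_level_mult)
  then show ?thesis by (simp add: LIMSEQ_const_iff)
qed

text \<open>Approximations of degree 0 are constants \<open>c k\<close>, so \<open>E[J^2]\<close> is
  the limit of \<open>c k * E[J] = 0\<close>.\<close>

lemma multiple_integral_0_AE:
  assumes J: "multiple_integral M W 0 f J" and 0: "(LINT w|M. J w) = 0"
  shows "AE w in M. J w = 0"
proof -
  obtain T where T: "L2_tendsto M (\<lambda>k. cyl (level 0 (T k))) J"
    using multiple_integral_cyl[OF J] by blast
  define c where "c k = (\<Sum>(c, h)\<leftarrow>T k. c)" for k
  have c: "cyl (level 0 (T k)) = (\<lambda>w. c k)" for k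
    by (auto simp: cyl_level c_def)
  have JL: "J \<in> L2 M" by (rule multiple_integral_L2[OF J])
  have "(\<lambda>k. LINT w|M. c k * J w) \<longlonglongrightarrow> (LINT w|M. J w * J w)"
    using L2_tendsto_inner[OF T L2_tendsto_const[OF JL]] by (simp add: c)
  then have "(LINT w|M. J w * J w) = 0" using 0 by (simp add: LIMSEQ_const_iff)
  then have "AE w in M. J w * J w = 0"
    using integral_nonneg_eq_0_iff_AE[of M "\<lambda>w. J w * J w"] L2_inner_integrable[OF JL JL] by simp
  then show ?thesis by eventually_elim simp
qed

text \<open>The derivative of \<open>L^-1 X\<close> refers to an expansion of its own, while
  \<open>L^-1 X\<close> is defined through an expansion of \<open>X\<close>. Both are tested with
  \<open>V = I m + J m / m\<close>, which is orthogonal to all other degrees: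
  \<open>E[Y V] = E[I m V]\<close> and \<open>E[- Y V] = E[J m V] / m\<close>. The sum of the two
  says \<open>E[V^2] = 0\<close>.\<close>

lemma chaos_decomposition_unique:
  assumes F: "chaos_decomposition M W X f J"
    and G: "chaos_decomposition M W Y g I" and Y: "L2_tendsto M (\<lambda>N w. \<Sum>n=1..N. J n w / real n) (\<lambda>w. - Y w)"
    and m: "m \<noteq> 0"
  shows "AE w in M. real m * I m w = - J m w"
proof -
  have J: "\<And>n. multiple_integral M W n (f n) (J n)" and I: "\<And>n. multiple_integral M W n (g n) (I n)"
    and YI: "L2_tendsto M (\<lambda>N w. \<Sum>n\<le>N. I n w) Y"
    using F G by (auto simp: chaos_decomposition_def)
  note JL = multiple_integral_L2[OF J] and IL = multiple_integral_L2[OF I]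
  define V where "V w = I m w + (1 / real m) * J m w" for w
  have VL: "V \<in> L2 M" unfolding V_def[abs_def] by (intro L2_add L2_mult JL IL)
  have II: "(LINT w|M. I n w * V w) = 0" and JJ: "(LINT w|M. J n w * V w) = 0" if "n \<noteq> m" for n
  proof -
    have i: "integrable M (\<lambda>w. A w * B w)" if "A \<in> L2 M" "B \<in> L2 M" for A B :: "'a \<Rightarrow> real"
      using L2_inner_integrable[OF that] by simp
    have e: "(LINT w|M. A w * V w) = (LINT w|M. A w * I m w) + (1 / real m) * (LINT w|M. A w * J m w)"
      if "A \<in> L2 M" for A
      using i[OF that IL[of m]] i[OF that JL[of m]] unfolding V_def by (simp add: distrib_left)
    show "(LINT w|M. I n w * V w) = 0" "(LINT w|M. J n w * V w) = 0"
      using multiple_integral_orthogonal[OF I I that] multiple_integral_orthogonal[OF I J that]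
        multiple_integral_orthogonal[OF J I that] multiple_integral_orthogonal[OF J J that]
      by (simp_all add: e IL JL)
  qed
  have iV: "integrable M (\<lambda>w. A w * V w)" if "A \<in> L2 M" for A
    using L2_inner_integrable[OF that VL] by simp
  have "(\<lambda>N. LINT w|M. (\<Sum>n\<le>N. I n w) * V w) \<longlonglongrightarrow> (LINT w|M. Y w * V w)"
    using L2_tendsto_inner[OF YI L2_tendsto_const[OF VL]] by simp
  note lim1 = this
  have "\<forall>\<^sub>F N in sequentially. (LINT w|M. (\<Sum>n\<le>N. I n w) * V w) = (LINT w|M. I m w * V w)"
    using eventually_ge_at_top[of m]
  proof eventually_elim
    case (elim N)
    have "(LINT w|M. (\<Sum>n\<le>N. I n w) * V w) = (\<Sum>n\<le>N. LINT w|M. I n w * V w)"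
      unfolding sum_distrib_right by (intro Bochner_Integration.integral_sum iV IL)
    also have "\<dots> = (\<Sum>n\<in>{m}. LINT w|M. I n w * V w)"
      by (rule sum.mono_neutral_right) (use elim II in auto)
    finally show ?case by simp
  qed
  then have 1: "(LINT w|M. Y w * V w) = (LINT w|M. I m w * V w)"
    by (rule LIMSEQ_unique[OF lim1 tendsto_eventually])
  have "(\<lambda>N. LINT w|M. (\<Sum>n=1..N. J n w / real n) * V w) \<longlonglongrightarrow> (LINT w|M. - Y w * V w)"
    using L2_tendsto_inner[OF Y L2_tendsto_const[OF VL]] by simp
  note lim2 = this
  have "\<forall>\<^sub>F N in sequentially. (LINT w|M. (\<Sum>n=1..N. J n w / real n) * V w) = (1 / real m) * (LINT w|M. J m w * V w)"
    using eventually_ge_at_top[of m]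
  proof eventually_elim
    case (elim N)
    have "(LINT w|M. (\<Sum>n=1..N. J n w / real n) * V w) = (LINT w|M. (\<Sum>n=1..N. (1 / real n) * (J n w * V w)))"
      unfolding sum_distrib_right by simp
    also have "\<dots> = (\<Sum>n=1..N. LINT w|M. (1 / real n) * (J n w * V w))"
      by (intro Bochner_Integration.integral_sum integrable_mult_right iV JL)
    also have "\<dots> = (\<Sum>n=1..N. (1 / real n) * (LINT w|M. J n w * V w))"
      by simp
    also have "\<dots> = (\<Sum>n\<in>{m}. (1 / real n) * (LINT w|M. J n w * V w))"
      by (rule sum.mono_neutral_right) (use elim JJ m in auto)
    finally show ?case by simp
  qed
  then have 2: "(LINT w|M. - Y w * V w) = (1 / real m) * (LINT w|M. J m w * V w)"
    by (rule LIMSEQ_unique[OF lim2 tendsto_eventually])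
  have "(LINT w|M. V w * V w) = (LINT w|M. I m w * V w + (1 / real m) * (J m w * V w))"
    by (intro Bochner_Integration.integral_cong refl) (simp add: V_def algebra_simps)
  also have "\<dots> = (LINT w|M. I m w * V w) + (1 / real m) * (LINT w|M. J m w * V w)"
    using iV[OF IL[of m]] iV[OF JL[of m]] by simp
  also have "\<dots> = 0" using 1 2 by simp
  finally have "AE w in M. V w * V w = 0"
    using integral_nonneg_eq_0_iff_AE[OF iV[OF VL]] by simp
  then show ?thesis
  proof eventually_elim
    case (elim w)
    then have "real m * V w = 0" by simp
    then show ?case using m by (simp add: V_def distrib_left)
  qed
qed

text \<open>By uniqueness \<open>J (Suc n) = - Suc n * I (Suc n)\<close>, and the factor
  \<open>Suc n\<close> is the one that \<open>level_duality\<close> converts into a gradient.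
  Summation over the degrees and an L2 limit give the formula, since both sides are linear in the
  expansion.\<close>

lemma cyl_duality:
  fixes \<phi> \<phi>' :: "real \<Rightarrow> real"
  assumes D: "\<And>x. (\<phi> has_real_derivative \<phi>' x) (at x)" and c: "continuous_on UNIV \<phi>'"
    and B: "\<And>x. \<bar>\<phi>' x\<bar> \<le> C"
    and X0: "(LINT w|M. X w) = 0"
    and LX: "OU_pseudo_inverse M W X LX" and DLX: "malliavin_derivative M W LX DLX"
  shows "(LINT w|M. \<phi> (cyl L w) * X w) = (LINT w|M. \<phi>' (cyl L w) * (dcyl L w \<bullet> (- DLX w)))"
proof -
  obtain f J where XJ: "chaos_decomposition M W X f J"
    and LJ: "L2_tendsto M (\<lambda>N w. \<Sum>n=1..N. J n w / real n) (\<lambda>w. - LX w)"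
    using LX by (auto simp: OU_pseudo_inverse_def)
  obtain g I E where LI: "chaos_decomposition M W LX g I"
    and E: "\<And>n h. multiple_integral M W n (\<lambda>hs. g (Suc n) (h # hs)) (\<lambda>w. h \<bullet> E n w)"
    and DE: "L2_tendsto M (\<lambda>N w. \<Sum>n<N. real (Suc n) *\<^sub>R E n w) DLX"
    using DLX by (auto simp: malliavin_derivative_def)
  have J: "\<And>n. multiple_integral M W n (f n) (J n)" and I: "\<And>n. multiple_integral M W n (g n) (I n)"
    and XS: "L2_tendsto M (\<lambda>N w. \<Sum>n\<le>N. J n w) X"
    using XJ LI by (auto simp: chaos_decomposition_def)
  note JL = multiple_integral_L2[OF J] and IL = multiple_integral_L2[OF I]
  have J_mean: "(LINT w|M. J n w) = 0" if "n \<noteq> 0" for n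
  proof -
    obtain T where T: "L2_tendsto M (\<lambda>k. cyl (level n (T k))) (J n)"
      using multiple_integral_cyl[OF J] by blast
    \<comment> \<open>The constant 1 is written as a polynomial of degree 0, to which all positive
      degrees are orthogonal.\<close>
    have "(\<lambda>k. LINT w|M. cyl (level n (T k)) w * cyl (level 0 [(1, 0)]) w) \<longlonglongrightarrow>
        (LINT w|M. J n w * cyl (level 0 [(1, 0)]) w)"
      using L2_tendsto_inner[OF T L2_tendsto_const[OF momentsD(3)[OF moments_cyl]]] by simp
    moreover have "(LINT w|M. cyl (level n (T k)) w * cyl (level 0 [(1, 0)]) w) = 0" for k
      using that by (simp only: expectation_cyl_level_mult if_False)
    ultimately show ?thesis by (simp add: LIMSEQ_const_iff level_def)
  qed
  have "(\<lambda>N. LINT w|M. (\<Sum>n\<le>N. J n w)) \<longlonglongrightarrow> (LINT w|M. X w)"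
    using L2_tendsto_inner[OF XS L2_tendsto_const[OF L2_const[of "1::real"]]] by simp
  moreover have "(LINT w|M. (\<Sum>n\<le>N. J n w)) = (LINT w|M. J 0 w)" for N
  proof -
    have "(LINT w|M. (\<Sum>n\<le>N. J n w)) = (\<Sum>n\<le>N. LINT w|M. J n w)"
      by (intro Bochner_Integration.integral_sum L2_integrable JL)
    also have "\<dots> = (\<Sum>n\<in>{0}. LINT w|M. J n w)"
      by (rule sum.mono_neutral_right) (use J_mean in auto)
    finally show ?thesis by simp
  qed
  ultimately have "(LINT w|M. J 0 w) = 0" using X0 by (simp add: LIMSEQ_const_iff)
  then have J0: "AE w in M. J 0 w = 0" by (rule multiple_integral_0_AE[OF J])
  have m\<phi>: "(\<lambda>w. \<phi> (cyl L w)) \<in> moments M" by (rule moments_lipschitz[OF D B moments_cyl])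
  note \<phi>L = momentsD(3)[OF m\<phi>]
  have [measurable]: "\<phi>' \<in> borel_measurable borel" by (rule borel_measurable_continuous_onI[OF c])
  have m\<phi>': "(\<lambda>w. \<phi>' (cyl L w)) \<in> moments M"
    by (rule moments_bounded_compose[OF _ _ B]) measurable
  have i\<phi>: "integrable M (\<lambda>w. \<phi> (cyl L w) * A w)" if "A \<in> L2 M" for A
    using L2_inner_integrable[OF \<phi>L that] by simp
  have [measurable]: "\<And>n. J n \<in> borel_measurable M" "\<And>n. I n \<in> borel_measurable M"
    using L2D(1)[OF JL] L2D(1)[OF IL] by auto
  have EL: "E n \<in> L2 M" for n
  proof -
    \<comment> \<open>Square integrability is known for the partial sums only; consecutive
      differences recover \<open>E n\<close>.\<close>
    have "(\<lambda>w. (1 / real (Suc n)) *\<^sub>R ((\<Sum>n<Suc n. real (Suc n) *\<^sub>R E n w) - (\<Sum>n<n. real (Suc n) *\<^sub>R E n w))) \<in> L2 M"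
      using DE unfolding L2_tendsto_def by (intro L2_scaleR L2_diff) blast+
    then show ?thesis by simp
  qed
  have J_eq: "(LINT w|M. \<phi> (cyl L w) * J (Suc n) w) =
      - (LINT w|M. \<phi>' (cyl L w) * (dcyl L w \<bullet> (real (Suc n) *\<^sub>R E n w)))" for n
  proof -
    have "AE w in M. \<phi> (cyl L w) * J (Suc n) w = - real (Suc n) * (\<phi> (cyl L w) * I (Suc n) w)"
      using chaos_decomposition_unique[OF XJ LI LJ, of "Suc n", OF nat.distinct(2)]
    proof eventually_elim
      case (elim w)
      then have "J (Suc n) w = - (real (Suc n) * I (Suc n) w)" by simp
      then show ?case by (simp del: of_nat_Suc)
    qed
    then have "(LINT w|M. \<phi> (cyl L w) * J (Suc n) w) = (LINT w|M. - real (Suc n) * (\<phi> (cyl L w) * I (Suc n) w))"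
      using momentsD(1)[OF m\<phi>] by (intro integral_cong_AE) auto
    also have "\<dots> = - (real (Suc n) * (LINT w|M. \<phi> (cyl L w) * I (Suc n) w))"
      by (simp del: of_nat_Suc)
    also have "\<dots> = - (LINT w|M. \<phi>' (cyl L w) * (dcyl L w \<bullet> (real (Suc n) *\<^sub>R E n w)))"
      by (simp only: level_duality[OF D c B I E])
    finally show ?thesis .
  qed
  \<comment> \<open>\<open>E n\<close> belongs to degree \<open>Suc n\<close>, so
    \<open>n < N\<close> matches the degrees from 1 to \<open>N\<close>; degree 0 contributes
    nothing because \<open>X\<close> is centered.\<close>
  have sum_eq: "(LINT w|M. \<phi> (cyl L w) * (\<Sum>n\<le>N. J n w)) =
      - (LINT w|M. \<phi>' (cyl L w) * (dcyl L w \<bullet> (\<Sum>n<N. real (Suc n) *\<^sub>R E n w)))" for N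
  proof (induction N)
    case 0
    have "AE w in M. \<phi> (cyl L w) * J 0 w = 0" using J0 by eventually_elim simp
    then have "(LINT w|M. \<phi> (cyl L w) * J 0 w) = 0" by (rule integral_eq_zero_AE)
    then show ?case by simp
  next
    case (Suc N)
    have iE: "integrable M (\<lambda>w. \<phi>' (cyl L w) * (dcyl L w \<bullet> A w))" if A: "A \<in> L2 M" for A
    proof -
      have "(\<lambda>w. \<phi>' (cyl L w) *\<^sub>R A w) \<in> L2 M"
        by (rule L2_dominated[OF A, where C=C])
           (use L2D(1)[OF A] in \<open>auto intro!: AE_I2 mult_right_mono B\<close>)
      from L2_inner_integrable[OF L2_dcyl this] show ?thesis by simp
    qed
    have "(LINT w|M. \<phi> (cyl L w) * (\<Sum>n\<le>Suc N. J n w)) =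
       (LINT w|M. \<phi> (cyl L w) * (\<Sum>n\<le>N. J n w)) + (LINT w|M. \<phi> (cyl L w) * J (Suc N) w)"
      using i\<phi>[OF L2_sum[of "{..N}" J, OF JL]] i\<phi>[OF JL] by (simp add: distrib_left)
    also have "\<dots> = - ((LINT w|M. \<phi>' (cyl L w) * (dcyl L w \<bullet> (\<Sum>n<N. real (Suc n) *\<^sub>R E n w))) +
       (LINT w|M. \<phi>' (cyl L w) * (dcyl L w \<bullet> (real (Suc N) *\<^sub>R E N w))))"
      unfolding Suc J_eq by simp
    also have "(LINT w|M. \<phi>' (cyl L w) * (dcyl L w \<bullet> (\<Sum>n<N. real (Suc n) *\<^sub>R E n w))) +
       (LINT w|M. \<phi>' (cyl L w) * (dcyl L w \<bullet> (real (Suc N) *\<^sub>R E N w))) =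
       (LINT w|M. \<phi>' (cyl L w) * (dcyl L w \<bullet> (\<Sum>n<N. real (Suc n) *\<^sub>R E n w)) +
         \<phi>' (cyl L w) * (dcyl L w \<bullet> (real (Suc N) *\<^sub>R E N w)))"
      by (rule Bochner_Integration.integral_add[symmetric]; intro iE L2_sum L2_scaleR EL)
    also have "\<dots> = (LINT w|M. \<phi>' (cyl L w) * (dcyl L w \<bullet> (\<Sum>n<Suc N. real (Suc n) *\<^sub>R E n w)))"
      by (simp only: sum.lessThan_Suc inner_add_right distrib_left)
    finally show ?case .
  qed
  have "(\<lambda>N. LINT w|M. \<phi> (cyl L w) * (\<Sum>n\<le>N. J n w)) \<longlonglongrightarrow> (LINT w|M. \<phi> (cyl L w) * X w)"
    using L2_tendsto_inner[OF L2_tendsto_const[OF \<phi>L] XS] by simp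
  moreover have "(\<lambda>N. LINT w|M. \<phi> (cyl L w) * (\<Sum>n\<le>N. J n w)) \<longlonglongrightarrow>
      - (LINT w|M. \<phi>' (cyl L w) * (dcyl L w \<bullet> DLX w))"
  proof -
    have "(\<lambda>w. \<phi>' (cyl L w) *\<^sub>R dcyl L w) \<in> L2 M"
      by (rule L2_dominated[OF L2_dcyl, where C=C]) (auto intro!: AE_I2 mult_right_mono B)
    from L2_tendsto_inner[OF L2_tendsto_const[OF this] DE] show ?thesis
      unfolding sum_eq by (intro tendsto_minus) simp
  qed
  ultimately have "(LINT w|M. \<phi> (cyl L w) * X w) = - (LINT w|M. \<phi>' (cyl L w) * (dcyl L w \<bullet> DLX w))"
    by (rule LIMSEQ_unique)
  then show ?thesis by simp
qed

text \<open>The three conclusions are what the weak closure argument needs. Lists for successive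
  degrees are concatenated, and each new degree enters the gradient bound with a factor 2, which is
  harmless while \<open>N\<close> is fixed.\<close>

lemma chaos_partial_sum_approx:
  assumes J: "\<And>n. multiple_integral M W n (f n) (J n)"
    and E: "\<And>n h. multiple_integral M W n (\<lambda>hs. f (Suc n) (h # hs)) (\<lambda>w. h \<bullet> E n w)"
  shows "\<exists>L C. L2_tendsto M (\<lambda>k. cyl (L k)) (\<lambda>w. \<Sum>n\<le>N. J n w) \<and>
    (\<forall>h. L2_tendsto M (\<lambda>k w. h \<bullet> dcyl (L k) w) (\<lambda>w. h \<bullet> (\<Sum>n<N. real (Suc n) *\<^sub>R E n w))) \<and>
    (\<forall>k. (LINT w|M. (norm (dcyl (L k) w))\<^sup>2) \<le> C)"
proof (induction N)
  case 0
  obtain T where T: "L2_tendsto M (\<lambda>k. cyl (level 0 (T k))) (J 0)"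
    using multiple_integral_cyl[OF J] by blast
  have "dcyl (level 0 S) = (\<lambda>w. 0)" for S
  proof
    show "dcyl (level 0 S) w = 0" for w by (induction S) (auto simp: level_def)
  qed
  then show ?case using T by (intro exI[of _ "\<lambda>k. level 0 (T k)"] exI[of _ 0]) (auto simp: L2_tendsto_const L2_zero)
next
  case (Suc N)
  then obtain L C where L: "L2_tendsto M (\<lambda>k. cyl (L k)) (\<lambda>w. \<Sum>n\<le>N. J n w)"
    "\<And>h. L2_tendsto M (\<lambda>k w. h \<bullet> dcyl (L k) w) (\<lambda>w. h \<bullet> (\<Sum>n<N. real (Suc n) *\<^sub>R E n w))"
    "\<And>k. (LINT w|M. (norm (dcyl (L k) w))\<^sup>2) \<le> C"
    by blast
  obtain T where T: "L2_tendsto M (\<lambda>k. cyl (level (Suc N) (T k))) (J (Suc N))"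
    "\<And>h. L2_tendsto M (\<lambda>k w. h \<bullet> dcyl (level (Suc N) (T k)) w) (\<lambda>w. h \<bullet> (real (Suc N) *\<^sub>R E N w))"
    using multiple_integral_derivative[OF J E] by blast
  obtain K where K: "\<And>k. (LINT w|M. (norm (cyl (level (Suc N) (T k)) w))\<^sup>2) \<le> K"
    using L2_tendsto_bounded[OF T(1)] by blast
  let ?L = "\<lambda>k. L k @ level (Suc N) (T k)"
  have a: "L2_tendsto M (\<lambda>k. cyl (?L k)) (\<lambda>w. \<Sum>n\<le>Suc N. J n w)"
    using L2_tendsto_add[OF L(1) T(1)] by (simp add: cyl_append[abs_def])
  have b: "L2_tendsto M (\<lambda>k w. h \<bullet> dcyl (?L k) w) (\<lambda>w. h \<bullet> (\<Sum>n<Suc N. real (Suc n) *\<^sub>R E n w))" for h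
    using L2_tendsto_add[OF L(2)[of h] T(2)[of h]] by (simp only: cyl_append inner_add_right sum.lessThan_Suc)
  have d: "(LINT w|M. (norm (dcyl (?L k) w))\<^sup>2) \<le> 2 * C + 2 * (real (Suc N) * K)" for k
  proof -
    have i: "integrable M (\<lambda>w. (norm (dcyl S w))\<^sup>2)" for S by (rule L2D(2)[OF L2_dcyl])
    have "(LINT w|M. (norm (dcyl (?L k) w))\<^sup>2) \<le>
       (LINT w|M. 2 * (norm (dcyl (L k) w))\<^sup>2 + 2 * (norm (dcyl (level (Suc N) (T k)) w))\<^sup>2)"
      by (intro integral_mono i Bochner_Integration.integrable_add integrable_mult_right)
         (simp only: cyl_append norm_add_sq_le)
    also have "\<dots> = 2 * (LINT w|M. (norm (dcyl (L k) w))\<^sup>2) +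
        2 * (LINT w|M. (norm (dcyl (level (Suc N) (T k)) w))\<^sup>2)"
      using i by simp
    also have "(LINT w|M. (norm (dcyl (level (Suc N) (T k)) w))\<^sup>2) \<le> real (Suc N) * K"
      unfolding expectation_dcyl_level_square using K[of k] by (intro mult_left_mono) auto
    finally show ?thesis using L(3)[of k] by linarith
  qed
  show ?case by (intro exI[of _ ?L] exI[of _ "2 * C + 2 * (real (Suc N) * K)"] conjI allI a b d)
qed

text \<open>The closure argument is used twice: for fixed \<open>N\<close>, polynomials approximate
  the partial sum with weakly convergent gradients; then \<open>N\<close> tends to infinity, where
  the gradients converge in L2 by the definition of the derivative. The bounds of the first stage
  may therefore depend on \<open>N\<close>.\<close>

theorem malliavin_integration_by_parts:
  fixes \<phi> \<phi>' :: "real \<Rightarrow> real"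
  assumes D: "\<And>x. (\<phi> has_real_derivative \<phi>' x) (at x)" and c: "continuous_on UNIV \<phi>'"
    and B: "\<And>x. \<bar>\<phi>' x\<bar> \<le> C"
    and X0: "(LINT w|M. X w) = 0" and DX: "malliavin_derivative M W X DX"
    and LX: "OU_pseudo_inverse M W X LX" and DLX: "malliavin_derivative M W LX DLX"
  shows "(LINT w|M. \<phi> (X w) * X w) = (LINT w|M. \<phi>' (X w) * (DX w \<bullet> (- DLX w)))"
    and "X \<in> L2 M" "DX \<in> L2 M" "DLX \<in> L2 M"
proof -
  obtain f J E where XJ: "chaos_decomposition M W X f J"
    and E: "\<And>n h. multiple_integral M W n (\<lambda>hs. f (Suc n) (h # hs)) (\<lambda>w. h \<bullet> E n w)"
    and DE: "L2_tendsto M (\<lambda>N w. \<Sum>n<N. real (Suc n) *\<^sub>R E n w) DX"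
    using DX by (auto simp: malliavin_derivative_def)
  have J: "\<And>n. multiple_integral M W n (f n) (J n)"
    and XS: "L2_tendsto M (\<lambda>N w. \<Sum>n\<le>N. J n w) X"
    using XJ by (auto simp: chaos_decomposition_def)
  show XL: "X \<in> L2 M" using XS by (auto simp: L2_tendsto_def)
  show DXL: "DX \<in> L2 M" using DE by (auto simp: L2_tendsto_def)
  show DLXL: "DLX \<in> L2 M" using DLX by (auto simp: malliavin_derivative_def L2_tendsto_def)
  then have UL: "(\<lambda>w. - DLX w) \<in> L2 M" by (rule L2_uminus)
  have fm: "finite_measure M" by unfold_locales
  have SL: "(\<lambda>w. \<Sum>n<N. real (Suc n) *\<^sub>R E n w) \<in> L2 M" for N
    using DE by (auto simp: L2_tendsto_def)
  have partial: "(LINT w|M. \<phi> (\<Sum>n\<le>N. J n w) * X w) =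
     (LINT w|M. \<phi>' (\<Sum>n\<le>N. J n w) * ((\<Sum>n<N. real (Suc n) *\<^sub>R E n w) \<bullet> (- DLX w)))" for N
  proof -
    obtain L K where L: "L2_tendsto M (\<lambda>k. cyl (L k)) (\<lambda>w. \<Sum>n\<le>N. J n w)"
      "\<And>h. L2_tendsto M (\<lambda>k w. h \<bullet> dcyl (L k) w) (\<lambda>w. h \<bullet> (\<Sum>n<N. real (Suc n) *\<^sub>R E n w))"
      "\<And>k. (LINT w|M. (norm (dcyl (L k) w))\<^sup>2) \<le> K"
      using chaos_partial_sum_approx[where f=f and J=J and E=E and N=N] J E by blast
    show ?thesis
      by (rule integration_by_parts_closed[OF fm D c B L(1) L2_dcyl SL L(3) L2_weak_tendsto[OF fm L2_dcyl SL _ L(2) L(3)] XL UL])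
         (assumption | rule cyl_duality[OF D c B X0 LX DLX])+
  qed
  obtain K where K: "\<And>N. (LINT w|M. (norm (\<Sum>n<N. real (Suc n) *\<^sub>R E n w))\<^sup>2) \<le> K"
    using L2_tendsto_bounded[OF DE] by blast
  show "(LINT w|M. \<phi> (X w) * X w) = (LINT w|M. \<phi>' (X w) * (DX w \<bullet> (- DLX w)))"
  proof (rule integration_by_parts_closed[OF fm D c B XS SL DXL _ _ XL UL partial])
    show "(LINT w|M. (norm (\<Sum>n<N. real (Suc n) *\<^sub>R E n w))\<^sup>2) \<le> K" for N
      by (rule K)
    show "(\<lambda>N. LINT w|M. (\<Sum>n<N. real (Suc n) *\<^sub>R E n w) \<bullet> V w) \<longlonglongrightarrow> (LINT w|M. DX w \<bullet> V w)"
      if "V \<in> L2 M" for V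
      by (rule L2_tendsto_inner[OF DE L2_tendsto_const[OF that]])
  qed
qed

end

section \<open>Pearson densities\<close>

text \<open>For integrable \<open>f\<close>, the antiderivative that vanishes at minus infinity. It
  serves for the distribution function and the partial mean of \<open>\<rho>\<close>, and also to
  build test functions from prescribed derivatives.\<close>

definition lower_integral :: "(real \<Rightarrow> real) \<Rightarrow> real \<Rightarrow> real" where
  "lower_integral f z = (LINT y|lborel. indicator {..z} y * f y)"

lemma integrable_lower: "integrable lborel f \<Longrightarrow> integrable lborel (\<lambda>y. indicator {..z} y * f y)"
  for f :: "real \<Rightarrow> real"
  by (rule Bochner_Integration.integrable_bound) (auto simp: indicator_def)

lemma lower_integral_eq:
  fixes f :: "real \<Rightarrow> real"
  assumes f: "integrable lborel f" and c: "continuous_on UNIV f" and "u \<le> z"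
  shows "lower_integral f z = lower_integral f u + integral {u..z} f"
proof -
  have i: "integrable lborel (\<lambda>y. indicator {u..z} y *\<^sub>R f y)"
    by (rule borel_integrable_compact) (auto intro: continuous_on_subset[OF c])
  have "lower_integral f z = (LINT y|lborel. indicator {..u} y * f y + indicator {u..z} y *\<^sub>R f y)"
    unfolding lower_integral_def
  proof (rule integral_cong_AE)
    show "AE y in lborel. indicator {..z} y * f y = indicator {..u} y * f y + indicator {u..z} y *\<^sub>R f y"
      using AE_lborel_singleton[of u] by eventually_elim (use \<open>u \<le> z\<close> in \<open>auto simp: indicator_def\<close>)
  qed (use integrable_lower[OF f] i in auto)
  also have "\<dots> = lower_integral f u + (LINT y|lborel. indicator {u..z} y *\<^sub>R f y)"
    unfolding lower_integral_def using integrable_lower[OF f, of u] i by simp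
  also have "(LINT y|lborel. indicator {u..z} y *\<^sub>R f y) = integral {u..z} f"
    using set_borel_integral_eq_integral(2)[of "{u..z}" f] i
    by (simp add: set_lebesgue_integral_def set_integrable_def)
  finally show ?thesis .
qed

lemma DERIV_lower_integral:
  fixes f :: "real \<Rightarrow> real"
  assumes f: "integrable lborel f" and c: "continuous_on UNIV f"
  shows "(lower_integral f has_real_derivative f z) (at z)"
proof -
  have "((\<lambda>x. integral {z - 1..x} f) has_real_derivative f z) (at z within {z - 1..z + 1})"
    by (rule integral_has_real_derivative) (auto intro: continuous_on_subset[OF c])
  then have "((\<lambda>x. integral {z - 1..x} f) has_real_derivative f z) (at z)"
    by (simp add: at_within_Icc_at)
  then have "((\<lambda>x. lower_integral f (z - 1) + integral {z - 1..x} f) has_real_derivative f z) (at z)"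
    by (auto intro!: derivative_eq_intros)
  moreover have "\<forall>\<^sub>F x in nhds z. lower_integral f x = lower_integral f (z - 1) + integral {z - 1..x} f"
  proof -
    have "\<forall>\<^sub>F x in nhds z. x > z - 1"
      by (rule order_tendstoD(1)[OF filterlim_ident]) simp
    then show ?thesis by eventually_elim (rule lower_integral_eq[OF f c], simp)
  qed
  ultimately show ?thesis
    using DERIV_cong_ev[OF refl, of "lower_integral f" "\<lambda>x. lower_integral f (z - 1) + integral {z - 1..x} f" z] by simp
qed

lemma lower_integral_tendsto:
  fixes f :: "real \<Rightarrow> real"
  assumes f: "integrable lborel f"
  shows "(lower_integral f \<longlongrightarrow> (LINT y|lborel. f y)) at_top"
  unfolding lower_integral_def[abs_def]
proof (rule integral_dominated_convergence_at_top[where w="\<lambda>x. \<bar>f x\<bar>"])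
  show "AE x in lborel. ((\<lambda>z. indicator {..z} x * f x) \<longlongrightarrow> f x) at_top"
  proof (rule AE_I2)
    fix x :: real
    have "\<forall>\<^sub>F z in at_top. indicator {..z} x * f x = f x"
      using eventually_ge_at_top[of x] by eventually_elim (auto simp: indicator_def)
    then show "((\<lambda>z. indicator {..z} x * f x) \<longlongrightarrow> f x) at_top"
      by (rule tendsto_eventually)
  qed
  show "\<forall>\<^sub>F z in at_top. AE x in lborel. norm (indicator {..z} x * f x) \<le> \<bar>f x\<bar>"
    by (auto simp: indicator_def)
qed (use f integrable_lower[OF f] in auto)

section \<open>Densities whose Stein kernel is a quadratic polynomial\<close>

locale pearson_density =
  fixes \<rho> :: "real \<Rightarrow> real" and a :: ereal and \<alpha> \<beta> \<gamma> :: real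
  assumes cont: "continuous_on UNIV \<rho>"
    and pos: "\<And>z. a < ereal z \<Longrightarrow> 0 < \<rho> z" and zero: "\<And>z. \<not> a < ereal z \<Longrightarrow> \<rho> z = 0"
    and int: "integrable lborel \<rho>" and mass: "(LINT y|lborel. \<rho> y) = 1"
    and int1: "integrable lborel (\<lambda>y. y * \<rho> y)" and mean: "(LINT y|lborel. y * \<rho> y) = 0"
    and pearson: "\<And>z. a < ereal z \<Longrightarrow> stein_g \<rho> a \<infinity> z = \<alpha> * z\<^sup>2 + \<beta> * z + \<gamma>"
begin

definition "F = lower_integral \<rho>"
text \<open>The function \<open>q\<close> of the overview: since the mean is zero, this is the
  partial mean over the upper tail. Written as a lower integral, it is differentiated in the same
  way as \<open>F\<close>.\<close>

definition "upper_mean z = - lower_integral (\<lambda>y. y * \<rho> y) z"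

lemma nonneg: "0 \<le> \<rho> z"
  using pos[of z] zero[of z] by (cases "a < ereal z") auto

lemma cont1: "continuous_on UNIV (\<lambda>y. y * \<rho> y)"
  by (intro continuous_intros cont)

lemma DERIV_F: "(F has_real_derivative \<rho> z) (at z)"
  unfolding F_def by (rule DERIV_lower_integral[OF int cont])

lemma DERIV_upper_mean: "(upper_mean has_real_derivative - (z * \<rho> z)) (at z)"
  unfolding upper_mean_def[abs_def] by (intro DERIV_minus DERIV_lower_integral[OF int1 cont1])

lemma F_tendsto: "(F \<longlongrightarrow> 1) at_top"
  unfolding F_def using lower_integral_tendsto[OF int] by (simp add: mass)

lemma upper_mean_tendsto: "(upper_mean \<longlongrightarrow> 0) at_top"
  unfolding upper_mean_def[abs_def] using tendsto_minus[OF lower_integral_tendsto[OF int1]] by (simp add: mean)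

lemma F_nonneg: "0 \<le> F z"
  unfolding F_def lower_integral_def by (rule Bochner_Integration.integral_nonneg) (simp add: nonneg)

lemma upper_mean_upper: "upper_mean z = (LINT y|lborel. indicator {z..} y * (y * \<rho> y))"
proof -
  have i: "integrable lborel (\<lambda>y. indicator {z..} y * (y * \<rho> y))"
    using integrable_real_mult_indicator[of "{z..}" lborel "\<lambda>y. y * \<rho> y"] int1
    by (simp add: mult.commute)
  have "(LINT y|lborel. y * \<rho> y) = (LINT y|lborel. indicator {..z} y * (y * \<rho> y) + indicator {z..} y * (y * \<rho> y))"
  proof (rule integral_cong_AE)
    show "AE y in lborel. y * \<rho> y = indicator {..z} y * (y * \<rho> y) + indicator {z..} y * (y * \<rho> y)"
      using AE_lborel_singleton[of z] by eventually_elim (auto simp: indicator_def)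
  qed (use int1 integrable_lower[OF int1] i in auto)
  then show ?thesis
    using i integrable_lower[OF int1, of z] mean by (simp add: upper_mean_def lower_integral_def)
qed

lemma upper_mean_eq: "a < ereal z \<Longrightarrow> upper_mean z = (\<alpha> * z\<^sup>2 + \<beta> * z + \<gamma>) * \<rho> z"
proof -
  assume z: "a < ereal z"
  have "stein_g \<rho> a \<infinity> z = upper_mean z / \<rho> z"
    using z by (simp add: stein_g_def upper_mean_upper set_lebesgue_integral_def)
  then have "upper_mean z / \<rho> z = \<alpha> * z\<^sup>2 + \<beta> * z + \<gamma>" using pearson[OF z] by simp
  moreover have "\<rho> z \<noteq> 0" using pos[OF z] by simp
  ultimately show "upper_mean z = (\<alpha> * z\<^sup>2 + \<beta> * z + \<gamma>) * \<rho> z"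
    by (metis nonzero_divide_eq_eq)
qed

text \<open>If \<open>a\<close> were nonnegative, \<open>y * \<rho> y\<close> would be nonnegative
  with integral 0, so \<open>\<rho>\<close> would vanish almost everywhere. Consequently all
  positive points lie in the support, and the support contains negative points.\<close>

lemma a_neg: "a < 0"
proof (rule ccontr)
  assume "\<not> a < 0"
  then have "\<rho> y = 0" if "y < 0" for y
    using that by (intro zero) (auto simp: not_less intro: order_trans[of _ 0])
  then have "0 \<le> y * \<rho> y" for y
    using nonneg[of y] by (cases "y < 0") auto
  then have "AE y in lborel. y * \<rho> y = 0"
    using integral_nonneg_eq_0_iff_AE[OF int1] mean by simp
  then have "AE y in lborel. \<rho> y = 0"
    using AE_lborel_singleton[of 0] by eventually_elim simp
  then have "(LINT y|lborel. \<rho> y) = 0" by (rule integral_eq_zero_AE)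
  then show False using mass by simp
qed

text \<open>For \<open>z \<ge> 0\<close> the sign is visible in the integral over the upper tail,
  for \<open>z < 0\<close> in the lower integral.\<close>

lemma upper_mean_nonneg: "0 \<le> upper_mean z"
proof (cases "z \<ge> 0")
  case True
  then show ?thesis unfolding upper_mean_upper
    by (intro Bochner_Integration.integral_nonneg) (auto simp: nonneg indicator_def)
next
  case False
  have "0 \<le> (LINT y|lborel. - (indicator {..z} y * (y * \<rho> y)))"
    using False by (intro Bochner_Integration.integral_nonneg)
      (auto simp: nonneg indicator_def mult_nonpos_nonneg)
  then show ?thesis by (simp add: upper_mean_def lower_integral_def)
qed

text \<open>The derivative \<open>- (z * \<rho> z)\<close> makes \<open>upper_mean\<close> strictly
  decreasing on the positive half-line and strictly increasing on the negative part of the support.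
  A neighbouring point, \<open>z + 1\<close> or some \<open>b\<close> between \<open>a\<close> and
  \<open>z\<close>, has a nonnegative value, which makes the inequality at \<open>z\<close>
  strict.\<close>

lemma upper_mean_pos: assumes z: "a < ereal z" shows "0 < upper_mean z"
proof (cases "z \<ge> 0")
  case True
  have "upper_mean (z + 1) < upper_mean z"
  proof (rule DERIV_neg_imp_decreasing_open[of z "z + 1" upper_mean])
    show "\<exists>y. (upper_mean has_real_derivative y) (at x) \<and> y < 0" if "z < x" "x < z + 1" for x
    proof -
      have "a < ereal x" using less_trans[OF z, of "ereal x"] that by simp
      then have "- (x * \<rho> x) < 0" using pos[of x] that True by simp
      then show ?thesis using DERIV_upper_mean by blast
    qed
    show "continuous_on {z..z + 1} upper_mean"
      by (rule DERIV_continuous_on[OF has_field_derivative_at_within[OF DERIV_upper_mean]])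
  qed simp
  then show ?thesis using upper_mean_nonneg[of "z + 1"] by linarith
next
  case False
  obtain b where b: "a < ereal b" "b < z" using z ereal_dense2[of a "ereal z"] by auto
  have "upper_mean b < upper_mean z"
  proof (rule DERIV_pos_imp_increasing_open[OF b(2), of upper_mean])
    show "\<exists>y. (upper_mean has_real_derivative y) (at x) \<and> 0 < y" if "b < x" "x < z" for x
    proof -
      have "a < ereal x" using less_trans[OF b(1), of "ereal x"] that by simp
      then have "0 < - (x * \<rho> x)" using pos[of x] that False by (simp add: mult_neg_pos)
      then show ?thesis using DERIV_upper_mean by blast
    qed
    show "continuous_on {b..z} upper_mean"
      by (rule DERIV_continuous_on[OF has_field_derivative_at_within[OF DERIV_upper_mean]])
  qed
  then show ?thesis using upper_mean_nonneg[of b] by linarith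
qed

definition "stein_poly z = \<alpha> * z\<^sup>2 + \<beta> * z + \<gamma>"

lemma upper_mean_stein_poly: "a < ereal z \<Longrightarrow> upper_mean z = stein_poly z * \<rho> z"
  unfolding stein_poly_def by (rule upper_mean_eq)

lemma stein_poly_pos: "a < ereal z \<Longrightarrow> 0 < stein_poly z"
proof -
  assume z: "a < ereal z"
  have "0 < stein_poly z * \<rho> z" using upper_mean_pos[OF z] unfolding upper_mean_stein_poly[OF z] .
  then show "0 < stein_poly z" using pos[OF z] by (rule zero_less_mult_pos2)
qed

text \<open>On the left of a point \<open>c\<close>, the bounded solution of the Stein equation of \<open>\<rho>\<close> for the indicator
  of \<open>{..c}\<close> is a constant multiple of \<open>stein_sol\<close>.\<close>

definition "stein_sol z = F z / upper_mean z"
definition "stein_deriv z = (1 + z * stein_sol z) / stein_poly z"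

text \<open>The expression is the integral of \<open>(z - y) * \<rho> y\<close> over
  \<open>y \<le> z\<close>. Its sign makes \<open>stein_sol\<close> nondecreasing also at negative
  points.\<close>

lemma upper_mean_add_F_nonneg: "0 \<le> upper_mean z + z * F z"
proof -
  have "upper_mean z + z * F z = (LINT y|lborel. z * (indicator {..z} y * \<rho> y) - indicator {..z} y * (y * \<rho> y))"
    using integrable_lower[OF int, of z] integrable_lower[OF int1, of z]
    by (simp add: upper_mean_def F_def lower_integral_def)
  also have "\<dots> \<ge> 0"
  proof (rule Bochner_Integration.integral_nonneg)
    fix y
    have "z * (indicator {..z} y * \<rho> y) - indicator {..z} y * (y * \<rho> y) = indicator {..z} y * ((z - y) * \<rho> y)"
      by (simp add: algebra_simps)
    also have "\<dots> \<ge> 0" by (auto simp: indicator_def nonneg)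
    finally show "0 \<le> z * (indicator {..z} y * \<rho> y) - indicator {..z} y * (y * \<rho> y)" .
  qed
  finally show ?thesis .
qed

lemma one_add_stein_sol_nonneg: "a < ereal z \<Longrightarrow> 0 \<le> 1 + z * stein_sol z"
proof -
  assume z: "a < ereal z"
  have "1 + z * stein_sol z = (upper_mean z + z * F z) / upper_mean z"
    using upper_mean_pos[OF z] by (simp add: stein_sol_def add_divide_distrib)
  then show "0 \<le> 1 + z * stein_sol z"
    using divide_nonneg_pos[OF upper_mean_add_F_nonneg upper_mean_pos[OF z]] by simp
qed

lemma stein_deriv_nonneg: "a < ereal z \<Longrightarrow> 0 \<le> stein_deriv z"
  unfolding stein_deriv_def by (intro divide_nonneg_pos one_add_stein_sol_nonneg stein_poly_pos)

lemma DERIV_stein_sol: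
  assumes z: "a < ereal z"
  shows "(stein_sol has_real_derivative stein_deriv z) (at z)"
proof -
  have upper_mean: "upper_mean z \<noteq> 0" using upper_mean_pos[OF z] by simp
  have "(stein_sol has_real_derivative (\<rho> z * upper_mean z - F z * (- (z * \<rho> z))) / (upper_mean z * upper_mean z)) (at z)"
    unfolding stein_sol_def[abs_def] by (rule DERIV_divide[OF DERIV_F DERIV_upper_mean upper_mean])
  moreover have "(\<rho> z * upper_mean z - F z * (- (z * \<rho> z))) / (upper_mean z * upper_mean z) = stein_deriv z"
  proof -
    \<comment> \<open>Eliminating the density in favour of \<open>upper_mean\<close> and
      \<open>stein_poly\<close> leaves the Stein equation.\<close>
    have r: "\<rho> z = upper_mean z / stein_poly z" using upper_mean_stein_poly[OF z] stein_poly_pos[OF z] by simp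
    show ?thesis unfolding r stein_deriv_def stein_sol_def using upper_mean stein_poly_pos[OF z] by (simp add: field_simps)
  qed
  ultimately show ?thesis by simp
qed

lemma isCont_stein_deriv: "a < ereal z \<Longrightarrow> isCont stein_deriv z"
proof -
  assume z: "a < ereal z"
  have "isCont (\<lambda>x. \<alpha> * x\<^sup>2 + \<beta> * x + \<gamma>) z" by simp
  then have stein_poly: "isCont stein_poly z" by (simp only: stein_poly_def[abs_def])
  have "isCont (\<lambda>x. 1 + x * stein_sol x) z"
    by (rule isCont_add[OF continuous_const isCont_mult[OF continuous_ident DERIV_isCont[OF DERIV_stein_sol[OF z]]]])
  from isCont_divide[OF this stein_poly] show "isCont stein_deriv z"
    using stein_poly_pos[OF z] by (simp add: stein_deriv_def[abs_def])
qed

lemma stein_sol_nonneg: "a < ereal z \<Longrightarrow> 0 \<le> stein_sol z"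
  unfolding stein_sol_def by (intro divide_nonneg_pos F_nonneg upper_mean_pos)

text \<open>For \<open>y \<le> z \<le> c < 0\<close> one has \<open>- c \<le> - y\<close>, and
  integration against \<open>\<rho>\<close> gives \<open>(- c) * F z \<le> upper_mean z\<close>. The
  bound does not depend on \<open>z\<close>, so it survives up to the left end of the
  support.\<close>

lemma stein_sol_le:
  assumes z: "a < ereal z" "z \<le> c" "c < 0"
  shows "stein_sol z \<le> 1 / (- c)"
proof -
  have "(- c) * F z = (LINT y|lborel. (- c) * (indicator {..z} y * \<rho> y))"
    by (simp add: F_def lower_integral_def)
  also have "\<dots> \<le> (LINT y|lborel. - (indicator {..z} y * (y * \<rho> y)))"
  proof (rule integral_mono)
    show "(- c) * (indicator {..z} y * \<rho> y) \<le> - (indicator {..z} y * (y * \<rho> y))" for y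
      using z nonneg[of y] mult_right_mono[of y c "\<rho> y"] by (auto simp: indicator_def)
  qed (use integrable_lower[OF int, of z] integrable_lower[OF int1, of z] in auto)
  also have "\<dots> = upper_mean z" by (simp add: upper_mean_def lower_integral_def)
  finally have "(- c) * F z \<le> upper_mean z" .
  then show ?thesis using upper_mean_pos[OF z(1)] z by (simp add: stein_sol_def field_simps)
qed

text \<open>The difference \<open>H\<close> of the tail and
  \<open>upper_mean z / (\<kappa> * z)\<close> tends to 0 and is nonincreasing once
  \<open>1 + stein_poly z / z\<^sup>2 < \<kappa>\<close>, hence it is nonnegative there. In the
  threshold, 1 comes from differentiating \<open>upper_mean\<close> and \<open>\<alpha>\<close> from
  differentiating \<open>1 / z\<close>.\<close>

lemma upper_mean_le_tail:
  assumes \<kappa>: "1 + \<alpha> < \<kappa>"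
  shows "\<forall>\<^sub>F z in at_top. upper_mean z \<le> \<kappa> * z * (1 - F z)"
proof -
  have "((\<lambda>z. 1 + (\<alpha> + \<beta> * inverse z + \<gamma> * (inverse z * inverse z))) \<longlongrightarrow> 1 + (\<alpha> + \<beta> * 0 + \<gamma> * (0 * 0))) at_top"
    by (intro tendsto_intros tendsto_inverse_0_at_top filterlim_ident)
  then have "\<forall>\<^sub>F z in at_top. 1 + (\<alpha> + \<beta> * inverse z + \<gamma> * (inverse z * inverse z)) < \<kappa>"
    using \<kappa> by (intro order_tendstoD(2)) auto
  then have "\<forall>\<^sub>F z in at_top. z > 0 \<and> 1 + stein_poly z / z\<^sup>2 < \<kappa>"
    using eventually_gt_at_top[of 0]
  proof eventually_elim
    case (elim z)
    have "stein_poly z / z\<^sup>2 = \<alpha> + \<beta> * inverse z + \<gamma> * (inverse z * inverse z)"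
      using elim(2) by (simp add: stein_poly_def field_simps power2_eq_square)
    then show ?case using elim by simp
  qed
  then obtain z1 where z1: "\<And>z. z \<ge> z1 \<Longrightarrow> z > 0 \<and> 1 + stein_poly z / z\<^sup>2 < \<kappa>"
    by (auto simp: eventually_at_top_linorder)
  have az: "a < ereal z" if "z > 0" for z
    using a_neg that by (meson ereal_less(2) less_trans)
  \<comment> \<open>At \<open>z1\<close> the bound
    \<open>1 + stein_poly z1 / z1\<^sup>2 < \<kappa>\<close> holds with a positive quotient.\<close>
  have \<kappa>0: "\<kappa> > 0"
    using z1[of z1] divide_pos_pos[OF stein_poly_pos[OF az, of z1], of "z1\<^sup>2"] by simp
  define H where "H z = (1 - F z) - upper_mean z / (\<kappa> * z)" for z
  have DH: "(H has_real_derivative - \<rho> z + (\<rho> z / \<kappa>) * (1 + stein_poly z / z\<^sup>2)) (at z)" if "z \<ge> z1" for z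
  proof -
    have z: "z > 0" using z1[OF that] by simp
    have "(H has_real_derivative (0 - \<rho> z) - (- (z * \<rho> z) * (\<kappa> * z) - upper_mean z * \<kappa>) / ((\<kappa> * z) * (\<kappa> * z))) (at z)"
      unfolding H_def[abs_def] using z \<kappa>0
      by (intro DERIV_diff DERIV_const DERIV_F DERIV_divide DERIV_upper_mean DERIV_cmult_Id) auto
    moreover have "(0 - \<rho> z) - (- (z * \<rho> z) * (\<kappa> * z) - upper_mean z * \<kappa>) / ((\<kappa> * z) * (\<kappa> * z)) =
        - \<rho> z + (\<rho> z / \<kappa>) * (1 + stein_poly z / z\<^sup>2)"
      using z \<kappa>0 unfolding upper_mean_stein_poly[OF az[OF z]] by (simp add: field_simps power2_eq_square)
    ultimately show ?thesis by (simp only:)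
  qed
  have dec: "H w \<le> H z" if "z1 \<le> z" "z \<le> w" for z w
  proof (rule DERIV_nonpos_imp_nonincreasing[OF that(2)])
    fix x assume x: "z \<le> x" "x \<le> w"
    then have x1: "z1 \<le> x" using that by simp
    have "(\<rho> x / \<kappa>) * (1 + stein_poly x / x\<^sup>2) \<le> (\<rho> x / \<kappa>) * \<kappa>"
      using z1[OF x1] nonneg[of x] \<kappa>0 by (intro mult_left_mono) auto
    then have "- \<rho> x + (\<rho> x / \<kappa>) * (1 + stein_poly x / x\<^sup>2) \<le> 0" using \<kappa>0 by simp
    then show "\<exists>y. (H has_real_derivative y) (at x) \<and> y \<le> 0" using DH[OF x1] by blast
  qed
  have "((\<lambda>z. (1 - F z) - upper_mean z * (inverse \<kappa> * inverse z)) \<longlongrightarrow> (1 - 1) - 0 * (inverse \<kappa> * 0)) at_top"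
    by (intro tendsto_intros F_tendsto upper_mean_tendsto tendsto_inverse_0_at_top filterlim_ident)
  then have lim: "(H \<longlongrightarrow> 0) at_top" by (simp add: H_def[abs_def] divide_inverse mult.commute)
  have "0 \<le> H z" if "z \<ge> z1" for z
  proof (rule tendsto_upperbound[OF lim])
    show "\<forall>\<^sub>F w in at_top. H w \<le> H z"
      using eventually_ge_at_top[of z] by eventually_elim (rule dec[OF that])
  qed simp
  then have "upper_mean z \<le> \<kappa> * z * (1 - F z)" if "z \<ge> z1" for z
  proof -
    have "\<kappa> * z > 0" using z1[OF that] \<kappa>0 by simp
    moreover have "upper_mean z / (\<kappa> * z) \<le> 1 - F z" using \<open>\<And>z. z \<ge> z1 \<Longrightarrow> 0 \<le> H z\<close>[OF that] by (simp add: H_def)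
    ultimately show ?thesis by (simp only: pos_divide_le_eq mult.commute)
  qed
  then show ?thesis by (auto simp: eventually_at_top_linorder)
qed

text \<open>Integration by parts is applied to smoothed versions of \<open>stein_sol\<close> clamped
  to the interval from \<open>c\<close> to \<open>z\<close>. In the limit the expectation of
  \<open>X * stein_sol X\<close> over \<open>c < X < z\<close> stands on both sides and cancels.
  What remains are the contributions of the two tails, bounded by the probability of the middle
  interval and so by 1.\<close>

lemma stein_comparison:
  fixes M :: "'a measure" and X G :: "'a \<Rightarrow> real"
  assumes M: "prob_space M" and X: "integrable M X" and X0: "(LINT w|M. X w) = 0"
    and aX: "AE w in M. a < ereal (X w)" and G: "integrable M G"
    and ibp: "\<And>\<phi> \<phi>' C. (\<And>x. (\<phi> has_real_derivative \<phi>' x) (at x)) \<Longrightarrow> continuous_on UNIV \<phi>' \<Longrightarrow>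
      (\<And>x. \<bar>\<phi>' x\<bar> \<le> C) \<Longrightarrow> (LINT w|M. \<phi> (X w) * X w) = (LINT w|M. \<phi>' (X w) * G w)"
    and Gg: "AE w in M. G w \<le> stein_poly (X w)"
    and c: "a < ereal c" and cz: "c < z"
  shows "stein_sol z * (LINT w|M. indicator {z..} (X w) * X w) + stein_sol c * (LINT w|M. indicator {..c} (X w) * X w) \<le> 1"
proof -
  interpret prob_space M by fact
  have [measurable]: "X \<in> borel_measurable M" "G \<in> borel_measurable M" using X G by auto
  have ax: "a < ereal x" if "c \<le> x" for x using less_le_trans[OF c, of "ereal x"] that by simp
  define cl where "cl x = max c (min z x)" for x
  have cl: "c \<le> cl x" "cl x \<le> z" for x using cz by (auto simp: cl_def)
  have ccl: "continuous_on UNIV cl" unfolding cl_def[abs_def] by (intro continuous_intros)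
  have cd: "continuous_on {c..z} stein_deriv"
    by (rule continuous_at_imp_continuous_on) (auto intro: isCont_stein_deriv[OF ax])
  have cdcl: "continuous_on UNIV (\<lambda>x. stein_deriv (cl x))"
    by (rule continuous_on_compose2[OF cd ccl]) (use cl in auto)
  have bounded: "\<exists>D. \<forall>x\<in>{c..z}. \<bar>h x\<bar> \<le> D" if "continuous_on {c..z} h" for h :: "real \<Rightarrow> real"
    using compact_imp_bounded[OF compact_continuous_image[OF that compact_Icc]]
    by (auto simp: bounded_iff)
  obtain D where D: "\<And>x. c \<le> x \<Longrightarrow> x \<le> z \<Longrightarrow> \<bar>stein_deriv x\<bar> \<le> D"
    using bounded[OF cd] by (meson atLeastAtMost_iff)
  have D0: "0 \<le> D" using D[of c] cz by linarith
  \<comment> \<open>A continuous cut-off that vanishes outside the open interval, rises from its end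
    points with slope \<open>m\<close> and is capped at 1.\<close>
  define \<eta> where "\<eta> m x = max 0 (min 1 (real m * min (x - c) (z - x)))" for m :: nat and x
  have \<eta>: "0 \<le> \<eta> m x" "\<eta> m x \<le> 1" for m x by (auto simp: \<eta>_def)
  have \<eta>0: "\<eta> m x = 0" if "\<not> (c < x \<and> x < z)" for m x
  proof -
    have "real m * min (x - c) (z - x) \<le> 0" using that by (intro mult_nonneg_nonpos) (auto simp: min_def)
    then show ?thesis by (simp add: \<eta>_def)
  qed
  have \<eta>1: "(\<lambda>m. \<eta> m x) \<longlonglongrightarrow> indicator {c<..<z} x" for x
  proof (cases "c < x \<and> x < z")
    case True
    then have p: "0 < min (x - c) (z - x)" by auto
    obtain m0 where m0: "1 < real m0 * min (x - c) (z - x)"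
      using reals_Archimedean3[OF p] by blast
    have "\<forall>\<^sub>F m in sequentially. \<eta> m x = 1"
      using eventually_ge_at_top[of m0]
    proof eventually_elim
      case (elim m)
      have "real m0 * min (x - c) (z - x) \<le> real m * min (x - c) (z - x)"
        using elim p by (intro mult_right_mono) auto
      then have "1 \<le> real m * min (x - c) (z - x)" using m0 by linarith
      then show ?case unfolding \<eta>_def by linarith
    qed
    then show ?thesis using True by (simp add: tendsto_eventually)
  next
    case False
    then show ?thesis using \<eta>0[OF False] by simp
  qed
  have c\<eta>: "continuous_on UNIV (\<eta> m)" for m
    unfolding \<eta>_def[abs_def] by (intro continuous_intros)
  define \<psi> where "\<psi> m x = stein_deriv (cl x) * \<eta> m x" for m x
  have c\<psi>: "continuous_on UNIV (\<psi> m)" for m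
    unfolding \<psi>_def[abs_def] by (intro continuous_intros cdcl c\<eta>)
  have [measurable]: "\<psi> m \<in> borel_measurable borel" for m
    by (rule borel_measurable_continuous_onI[OF c\<psi>])
  have [measurable]: "(\<lambda>x. stein_deriv (cl x)) \<in> borel_measurable borel"
    by (rule borel_measurable_continuous_onI[OF cdcl])
  have \<psi>_bound: "\<bar>\<psi> m x\<bar> \<le> D * indicator {c..z} x" for m x
  proof (cases "c < x \<and> x < z")
    case True
    have "\<bar>stein_deriv (cl x)\<bar> * \<eta> m x \<le> D * 1" using D[of "cl x"] cl \<eta>[of m x] D0 by (intro mult_mono) auto
    then show ?thesis using True \<eta>[of m x] by (simp add: \<psi>_def abs_mult)
  qed (use \<eta>0 D0 in \<open>auto simp: \<psi>_def\<close>)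
  have \<psi>_le: "\<bar>\<psi> m x\<bar> \<le> D" for m x
    using \<psi>_bound[of m x] D0 by (cases "x \<in> {c..z}") auto
  have iD: "integrable lborel (\<lambda>x. D * indicator {c..z} x)"
    using cz by (intro integrable_mult_right integrable_real_indicator) auto
  have i\<psi>: "integrable lborel (\<psi> m)" for m
  proof (rule Bochner_Integration.integrable_bound[OF iD])
    show "AE x in lborel. norm (\<psi> m x) \<le> norm (D * indicator {c..z} x)"
      using order_trans[OF \<psi>_bound abs_ge_self] by auto
  qed measurable
  define \<phi> where "\<phi> m = lower_integral (\<psi> m)" for m
  have D\<phi>: "(\<phi> m has_real_derivative \<psi> m x) (at x)" for m x
    unfolding \<phi>_def by (rule DERIV_lower_integral[OF i\<psi> c\<psi>])
  have [measurable]: "\<phi> m \<in> borel_measurable borel" for m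
    by (rule borel_measurable_continuous_onI[OF DERIV_continuous_on[OF has_field_derivative_at_within[OF D\<phi>]]])
  have \<phi>_bound: "\<bar>\<phi> m x\<bar> \<le> D * (z - c)" for m x
  proof -
    have "\<bar>\<phi> m x\<bar> \<le> (LINT y|lborel. \<bar>indicator {..x} y * \<psi> m y\<bar>)"
      unfolding \<phi>_def lower_integral_def by (rule integral_abs_bound)
    also have "\<dots> \<le> (LINT y|lborel. D * indicator {c..z} y)"
    proof (rule integral_mono)
      show "\<bar>indicator {..x} y * \<psi> m y\<bar> \<le> D * indicator {c..z} y" for y
        using \<psi>_bound[of m y] by (cases "y \<le> x") (auto simp: abs_mult intro: order_trans[OF abs_ge_zero])
    qed (use iD integrable_lower[OF i\<psi>] in auto)
    also have "\<dots> = D * (z - c)" using cz by simp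
    finally show ?thesis .
  qed
  \<comment> \<open>\<open>\<phi> m\<close> vanishes to the left of \<open>c\<close>, whence the
    constant \<open>stein_sol c\<close>; it later drops out because \<open>X\<close> is
    centered.\<close>
  have \<phi>_lim: "(\<lambda>m. \<phi> m x) \<longlonglongrightarrow> stein_sol (cl x) - stein_sol c" for x
  proof -
    have "(\<lambda>m. \<phi> m x) \<longlonglongrightarrow> (LINT y|lborel. indicator {..x} y * (stein_deriv (cl y) * indicator {c<..<z} y))"
      unfolding \<phi>_def lower_integral_def
    proof (rule integral_dominated_convergence[OF _ _ iD])
      show "AE y in lborel. (\<lambda>m. indicator {..x} y * \<psi> m y) \<longlonglongrightarrow> indicator {..x} y * (stein_deriv (cl y) * indicator {c<..<z} y)"
        unfolding \<psi>_def by (intro AE_I2 tendsto_mult tendsto_const \<eta>1)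
      show "AE y in lborel. norm (indicator {..x} y * \<psi> m y) \<le> D * indicator {c..z} y" for m
      proof (rule AE_I2)
        fix y
        show "norm (indicator {..x} y * \<psi> m y) \<le> D * indicator {c..z} y"
          using \<psi>_bound[of m y] by (cases "y \<le> x") (auto simp: abs_mult intro: order_trans[OF abs_ge_zero])
      qed
    qed measurable
    also have "(LINT y|lborel. indicator {..x} y * (stein_deriv (cl y) * indicator {c<..<z} y)) =
       (LINT y|lborel. stein_deriv y * indicator {c..cl x} y)"
    proof (rule integral_cong_AE)
      have "continuous_on {c..cl x} stein_deriv" by (rule continuous_on_subset[OF cd]) (use cl in auto)
      then have "integrable lborel (\<lambda>y. indicator {c..cl x} y *\<^sub>R stein_deriv y)"
        by (intro borel_integrable_compact) auto
      then show "(\<lambda>y. stein_deriv y * indicator {c..cl x} y) \<in> borel_measurable lborel"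
        by (auto simp: mult.commute)
      show "AE y in lborel. indicator {..x} y * (stein_deriv (cl y) * indicator {c<..<z} y) = stein_deriv y * indicator {c..cl x} y"
        using AE_lborel_singleton[of c] AE_lborel_singleton[of z]
        by eventually_elim (use cz in \<open>auto simp: indicator_def cl_def\<close>)
    qed measurable
    also have "\<dots> = stein_sol (cl x) - stein_sol c"
      using cl[of x] by (intro integral_FTC_Icc_real DERIV_stein_sol[OF ax] isCont_stein_deriv[OF ax]) auto
    finally show ?thesis .
  qed
  have bounded_int: "integrable M (\<lambda>w. h (X w) * A w)"
    if "h \<in> borel_measurable borel" "\<And>x. \<bar>h x\<bar> \<le> K" "integrable M A"
    for h :: "real \<Rightarrow> real" and A :: "'a \<Rightarrow> real" and K
  proof (rule Bochner_Integration.integrable_bound)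
    show "integrable M (\<lambda>w. K * A w)" using that by simp
    show "(\<lambda>w. h (X w) * A w) \<in> borel_measurable M" using that by measurable
    have "\<bar>h x\<bar> \<le> \<bar>K\<bar>" for x using that(2)[of x] by linarith
    then show "AE w in M. norm (h (X w) * A w) \<le> norm (K * A w)"
      by (auto simp: abs_mult intro!: mult_right_mono)
  qed
  \<comment> \<open>By the Stein equation this is \<open>stein_deriv x * stein_poly x\<close> on the
    open interval.\<close>
  let ?R = "\<lambda>x. (1 + x * stein_sol x) * indicator {c<..<z} x"
  have cf: "continuous_on {c..z} stein_sol"
    by (rule continuous_at_imp_continuous_on) (auto intro: DERIV_isCont[OF DERIV_stein_sol[OF ax]])
  have cfcl: "continuous_on UNIV (\<lambda>x. stein_sol (cl x))"
    by (rule continuous_on_compose2[OF cf ccl]) (use cl in auto)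
  have [measurable]: "(\<lambda>x. stein_sol (cl x)) \<in> borel_measurable borel"
    by (rule borel_measurable_continuous_onI[OF cfcl])
  obtain K where K: "\<And>x. c \<le> x \<Longrightarrow> x \<le> z \<Longrightarrow> \<bar>stein_sol x\<bar> \<le> K"
    using bounded[OF cf] by (meson atLeastAtMost_iff)
  have fK: "\<bar>stein_sol (cl x)\<bar> \<le> K" for x using K cl by blast
  have R_eq: "?R x = indicator {c<..<z} x + (stein_sol (cl x) * indicator {c<..<z} x) * x" for x
    by (auto simp: indicator_def cl_def)
  have iI: "integrable M (\<lambda>w. indicator {c<..<z} (X w) :: real)"
    by (rule integrable_const_bound[where B=1]) (auto simp: indicator_def)
  have iRf: "integrable M (\<lambda>w. (stein_sol (cl (X w)) * indicator {c<..<z} (X w)) * X w)"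
    by (rule bounded_int[of "\<lambda>x. stein_sol (cl x) * indicator {c<..<z} x" K X, OF _ _ X])
       (use fK order_trans[OF abs_ge_zero fK] in \<open>auto simp: indicator_def\<close>)
  have iR: "integrable M (\<lambda>w. ?R (X w))" unfolding R_eq using iI iRf by simp
  have step: "(LINT w|M. \<phi> m (X w) * X w) \<le> (LINT w|M. ?R (X w))" for m
  proof -
    have "(LINT w|M. \<phi> m (X w) * X w) = (LINT w|M. \<psi> m (X w) * G w)"
    proof (rule ibp[OF D\<phi> c\<psi>])
      show "\<bar>\<psi> m x\<bar> \<le> D" for x by (rule \<psi>_le)
    qed
    also have "\<dots> \<le> (LINT w|M. ?R (X w))"
    proof (rule integral_mono_AE[OF bounded_int[of "\<psi> m" D G, OF _ _ G] iR])
      show "\<bar>\<psi> m x\<bar> \<le> D" for x by (rule \<psi>_le)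
      show "AE w in M. \<psi> m (X w) * G w \<le> ?R (X w)"
        using Gg
      proof eventually_elim
        case (elim w)
        show ?case
        proof (cases "c < X w \<and> X w < z")
          case True
          then have clx: "cl (X w) = X w" by (simp add: cl_def)
          have aw: "a < ereal (X w)" using ax True by simp
          \<comment> \<open>The bound on \<open>G\<close> is one-sided; it can be multiplied by
            \<open>\<psi> m (X w)\<close> because \<open>stein_deriv\<close> and the cut-off are
            nonnegative.\<close>
          have "\<psi> m (X w) * G w \<le> \<psi> m (X w) * stein_poly (X w)"
            using elim stein_deriv_nonneg[OF aw] \<eta>[of m "X w"] by (intro mult_left_mono) (auto simp: \<psi>_def clx)
          also have "\<dots> = (1 + X w * stein_sol (X w)) * \<eta> m (X w)"
            using stein_poly_pos[OF aw] by (simp add: \<psi>_def clx stein_deriv_def)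
          also have "\<dots> \<le> (1 + X w * stein_sol (X w)) * 1"
            using one_add_stein_sol_nonneg[OF aw] \<eta>[of m "X w"] by (intro mult_left_mono) auto
          finally show ?thesis using True by simp
        next
          case False
          then show ?thesis using \<eta>0[OF False, of m] by (auto simp: \<psi>_def)
        qed
      qed
    qed measurable
    finally show ?thesis .
  qed
  have "(\<lambda>m. LINT w|M. \<phi> m (X w) * X w) \<longlonglongrightarrow> (LINT w|M. (stein_sol (cl (X w)) - stein_sol c) * X w)"
  proof (rule integral_dominated_convergence[where w="\<lambda>w. D * (z - c) * \<bar>X w\<bar>"])
    show "integrable M (\<lambda>w. D * (z - c) * \<bar>X w\<bar>)" using X by simp
    show "AE w in M. (\<lambda>m. \<phi> m (X w) * X w) \<longlonglongrightarrow> (stein_sol (cl (X w)) - stein_sol c) * X w"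
      by (intro AE_I2 tendsto_mult tendsto_const \<phi>_lim)
    show "AE w in M. norm (\<phi> m (X w) * X w) \<le> D * (z - c) * \<bar>X w\<bar>" for m
      using \<phi>_bound by (auto simp: abs_mult intro!: mult_right_mono)
  qed measurable
  then have main: "(LINT w|M. (stein_sol (cl (X w)) - stein_sol c) * X w) \<le> (LINT w|M. ?R (X w))"
    by (rule LIMSEQ_le_const2) (use step in auto)
  have iu: "integrable M (\<lambda>w. indicator {z..} (X w) * X w)" "integrable M (\<lambda>w. indicator {..c} (X w) * X w)"
    using bounded_int[of "indicator {z..}" 1 X] bounded_int[of "indicator {..c}" 1 X] X
    by (simp_all add: indicator_le_1)
  \<comment> \<open>The clamped function is constant on each tail, with value
    \<open>stein_sol z\<close> above and \<open>stein_sol c\<close> below.\<close>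
  have "(stein_sol (cl x) - stein_sol c) * x = (stein_sol (cl x) * indicator {c<..<z} x) * x + stein_sol z * (indicator {z..} x * x) + stein_sol c * (indicator {..c} x * x) - stein_sol c * x" for x
    using cz by (auto simp: indicator_def cl_def max_def min_def algebra_simps)
  then have "(LINT w|M. (stein_sol (cl (X w)) - stein_sol c) * X w) =
     (LINT w|M. (stein_sol (cl (X w)) * indicator {c<..<z} (X w)) * X w) + stein_sol z * (LINT w|M. indicator {z..} (X w) * X w)
      + stein_sol c * (LINT w|M. indicator {..c} (X w) * X w)"
    using iRf iu X X0 by simp
  moreover have "(LINT w|M. ?R (X w)) = (LINT w|M. indicator {c<..<z} (X w)) + (LINT w|M. (stein_sol (cl (X w)) * indicator {c<..<z} (X w)) * X w)"
    unfolding R_eq using iI iRf by simp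
  moreover have "(LINT w|M. indicator {c<..<z} (X w)) \<le> (1::real)"
    using integral_mono[OF iI integrable_const[of "1::real"]] by (simp add: prob_space indicator_def)
  ultimately show ?thesis using main by linarith
qed

text \<open>The point \<open>c\<close> runs through a sequence \<open>u\<close> decreasing to
  \<open>a\<close>. There \<open>stein_sol\<close> stays below \<open>1 / (- u 0)\<close>, and the
  lower partial mean of \<open>X\<close> tends to 0 because \<open>X > a\<close> almost surely, so
  the left boundary term disappears. Markov's inequality bounds \<open>z\<close> times the tail
  probability by the upper partial mean.\<close>

lemma tail_le:
  fixes M :: "'a measure" and X G :: "'a \<Rightarrow> real"
  assumes M: "prob_space M" and X: "integrable M X" and X0: "(LINT w|M. X w) = 0"
    and aX: "AE w in M. a < ereal (X w)" and G: "integrable M G"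
    and ibp: "\<And>\<phi> \<phi>' C. (\<And>x. (\<phi> has_real_derivative \<phi>' x) (at x)) \<Longrightarrow> continuous_on UNIV \<phi>' \<Longrightarrow>
      (\<And>x. \<bar>\<phi>' x\<bar> \<le> C) \<Longrightarrow> (LINT w|M. \<phi> (X w) * X w) = (LINT w|M. \<phi>' (X w) * G w)"
    and Gg: "AE w in M. G w \<le> stein_poly (X w)"
    and z: "0 < z"
  shows "measure M {w \<in> space M. X w > z} * z * F z \<le> upper_mean z"
proof -
  interpret prob_space M by fact
  have [measurable]: "X \<in> borel_measurable M" using X by auto
  obtain u :: "nat \<Rightarrow> real" where u: "decseq u" "\<And>i. a < u i" "\<And>i. u i < 0" "u \<longlonglongrightarrow> a"
    using ereal_decseq_approx[OF a_neg] by auto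
  have u0: "u i < 0" for i using u(3)[of i] by simp
  let ?E = "\<integral>w. indicator {z..} (X w) * X w \<partial>M"
  let ?e = "\<lambda>i. LINT w|M. indicator {..u i} (X w) * X w"
  have lim: "?e \<longlonglongrightarrow> (LINT w|M. 0)"
  proof (rule integral_dominated_convergence[where w="\<lambda>w. \<bar>X w\<bar>"])
    show "AE w in M. (\<lambda>i. indicator {..u i} (X w) * X w) \<longlonglongrightarrow> 0"
      using aX
    proof eventually_elim
      case (elim w)
      have "\<forall>\<^sub>F i in sequentially. ereal (u i) < ereal (X w)"
        by (rule order_tendstoD(2)[OF u(4) elim])
      then have "\<forall>\<^sub>F i in sequentially. indicator {..u i} (X w) * X w = 0"
        by eventually_elim (simp add: indicator_def)
      then show ?case by (rule tendsto_eventually)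
    qed
  qed (use X in \<open>auto simp: indicator_def\<close>)
  have "stein_sol z * ?E \<le> 1 + (1 / (- u 0)) * \<bar>?e i\<bar>" for i
  proof -
    have "stein_sol z * ?E + stein_sol (u i) * ?e i \<le> 1"
      using u0[of i] z by (intro stein_comparison[OF M X X0 aX G ibp Gg u(2)]) auto
    moreover have "\<bar>stein_sol (u i) * ?e i\<bar> \<le> (1 / (- u 0)) * \<bar>?e i\<bar>"
    proof -
      have "stein_sol (u i) \<le> 1 / (- u 0)"
        using decseqD[OF u(1), of 0 i] u0 by (intro stein_sol_le u) auto
      then have "stein_sol (u i) * \<bar>?e i\<bar> \<le> (1 / (- u 0)) * \<bar>?e i\<bar>"
        by (rule mult_right_mono) simp
      then show ?thesis using stein_sol_nonneg[OF u(2)[of i]] by (simp only: abs_mult abs_of_nonneg)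
    qed
    ultimately show ?thesis by linarith
  qed
  moreover have "(\<lambda>i. 1 + (1 / (- u 0)) * \<bar>?e i\<bar>) \<longlonglongrightarrow> 1 + (1 / (- u 0)) * \<bar>0\<bar>"
    using lim by (intro tendsto_intros) simp
  ultimately have fE: "stein_sol z * ?E \<le> 1"
    using LIMSEQ_le_const[of "\<lambda>i. 1 + (1 / (- u 0)) * \<bar>?e i\<bar>" 1 "stein_sol z * ?E"] by auto
  have az: "a < ereal z" using a_neg z by (meson ereal_less(2) less_trans)
  have "measure M {w \<in> space M. X w > z} * z = (LINT w|M. z * indicator {w \<in> space M. X w > z} w)"
    by simp
  also have "\<dots> \<le> ?E"
  proof (rule integral_mono)
    show "integrable M (\<lambda>w. z * indicator {w \<in> space M. X w > z} w)"
      by (intro integrable_mult_right integrable_real_indicator) (auto simp: emeasure_eq_measure)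
    show "integrable M (\<lambda>w. indicator {z..} (X w) * X w)"
      by (rule Bochner_Integration.integrable_bound[OF X]) (auto simp: indicator_def)
    show "z * indicator {w \<in> space M. X w > z} w \<le> indicator {z..} (X w) * X w" for w
      using z by (auto simp: indicator_def)
  qed
  finally have "measure M {w \<in> space M. X w > z} * z * F z \<le> ?E * F z"
    by (rule mult_right_mono[OF _ F_nonneg])
  also have "\<dots> \<le> upper_mean z" using fE upper_mean_pos[OF az] by (simp add: stein_sol_def field_simps)
  finally show ?thesis .
qed

text \<open>A constant \<open>\<kappa>\<close> strictly between \<open>1 + \<alpha>\<close> and
  \<open>K\<close> is used in the bound on \<open>upper_mean\<close>; the room up to
  \<open>K\<close> pays for dividing by \<open>F z\<close>, which tends to 1.\<close>

lemma eventually_tail_le: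
  fixes P :: "real \<Rightarrow> real"
  assumes P: "\<And>z. 0 < z \<Longrightarrow> P z * z * F z \<le> upper_mean z" and K: "1 + \<alpha> < K"
  shows "\<forall>\<^sub>F z in at_top. P z \<le> K * (1 - F z)"
proof -
  \<comment> \<open>The midpoint to \<open>K\<close>; \<open>max 0\<close> makes it positive
    whatever the sign of \<open>1 + \<alpha>\<close>.\<close>
  define \<kappa> where "\<kappa> = (max 0 (1 + \<alpha>) + K) / 2"
  have ev1: "\<forall>\<^sub>F z in at_top. upper_mean z \<le> K * z * (1 - F z)" by (rule upper_mean_le_tail[OF K])
  have F_le: "F z \<le> 1" for z
  proof -
    have "F z \<le> (LINT y|lborel. \<rho> y)" unfolding F_def lower_integral_def
      by (rule integral_mono) (use int integrable_lower[OF int] nonneg in \<open>auto simp: indicator_def\<close>)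
    then show ?thesis by (simp add: mass)
  qed
  have K0: "K > 0"
  proof -
    obtain z where z: "z > 0" "upper_mean z \<le> K * z * (1 - F z)"
      using eventually_conj[OF ev1 eventually_gt_at_top[of 0]] by (auto simp: eventually_at_top_linorder)
    have "0 < upper_mean z" using z(1) a_neg by (intro upper_mean_pos) (meson ereal_less(2) less_trans)
    then have "0 < K * (z * (1 - F z))" using z by (simp add: mult.assoc)
    moreover have "0 \<le> z * (1 - F z)" using z F_le by simp
    ultimately show ?thesis by (simp add: zero_less_mult_iff)
  qed
  have \<kappa>: "1 + \<alpha> < \<kappa>" "\<kappa> < K" "0 < \<kappa>" using K K0 by (auto simp: \<kappa>_def max_def)
  have "\<forall>\<^sub>F z in at_top. \<kappa> / K < F z"
    using \<kappa> K0 by (intro order_tendstoD(1)[OF F_tendsto]) simp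
  then show ?thesis
    using upper_mean_le_tail[OF \<kappa>(1)] eventually_gt_at_top[of 0]
  proof eventually_elim
    case (elim z)
    have p: "0 < F z" using elim(1) \<kappa> K0 by (metis divide_pos_pos less_trans)
    have "P z * F z * z \<le> (\<kappa> * (1 - F z)) * z"
      using P[OF elim(3)] elim(2) by (simp add: mult_ac)
    then have "P z * F z \<le> \<kappa> * (1 - F z)" using elim(3) by simp
    also have "\<dots> \<le> (K * F z) * (1 - F z)"
      using elim(1) K0 F_le by (intro mult_right_mono) (auto simp: field_simps)
    finally have "P z * F z \<le> (K * (1 - F z)) * F z" by (simp add: mult_ac)
    then show ?case using p by simp
  qed
qed

end

section \<open>Transfer to random variables and the tail comparison\<close>

lemma centered_pearson_density:
  assumes N: "prob_space N" and Z: "centered_pearson N Z \<rho> a \<infinity> \<alpha> \<beta> \<gamma>"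
  shows "pearson_density \<rho> a \<alpha> \<beta> \<gamma>"
    and "measure N {w \<in> space N. Z w > z} = 1 - lower_integral \<rho> z"
proof -
  interpret prob_space N by fact
  have i: "integrable N Z" and m: "(LINT w|N. Z w) = 0"
    and d: "distributed N lborel Z (\<lambda>z. ennreal (\<rho> z))" and c: "continuous_on UNIV \<rho>"
    and pos: "\<And>z. a < ereal z \<Longrightarrow> 0 < \<rho> z" and zero: "\<And>z. \<not> a < ereal z \<Longrightarrow> \<rho> z = 0"
    and g: "\<And>z. a < ereal z \<Longrightarrow> stein_g \<rho> a \<infinity> z = \<alpha> * z\<^sup>2 + \<beta> * z + \<gamma>"
    using Z unfolding centered_pearson_def centered_with_density_def by auto
  have nn: "0 \<le> \<rho> z" for z using pos[of z] zero[of z] by (cases "a < ereal z") auto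
  note di = distributed_integral[OF d _ nn] and db = distributed_integrable[OF d _ nn]
  have int: "integrable lborel \<rho>" using db[of "\<lambda>_. 1"] by simp
  have mass: "(LINT y|lborel. \<rho> y) = 1" using di[of "\<lambda>_. 1"] by (simp add: prob_space)
  show "pearson_density \<rho> a \<alpha> \<beta> \<gamma>"
  proof
    show "integrable lborel (\<lambda>y. y * \<rho> y)" using db[of "\<lambda>y. y"] i by (simp add: mult.commute)
    show "(LINT y|lborel. y * \<rho> y) = 0" using di[of "\<lambda>y. y"] m by (simp add: mult.commute)
  qed (use c pos zero int mass g in auto)
  have [measurable]: "Z \<in> borel_measurable N" using i by auto
  have "lower_integral \<rho> z = (LINT w|N. indicator {..z} (Z w))"
    unfolding lower_integral_def using di[of "indicator {..z}"] by (simp add: mult.commute)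
  also have "\<dots> = prob {w\<in>space N. Z w \<in> {..z}}" by (rule expectation_indicator[where N=borel]) measurable
  also have "{w\<in>space N. Z w \<in> {..z}} = space N - {w\<in>space N. Z w > z}" by auto
  also have "prob \<dots> = 1 - prob {w\<in>space N. Z w > z}" by (rule prob_compl) measurable
  finally show "measure N {w \<in> space N. Z w > z} = 1 - lower_integral \<rho> z" by simp
qed

theorem corollary20:
  fixes M :: "'a measure"
    and W :: "'h::{real_inner, banach, second_countable_topology} \<Rightarrow> 'a \<Rightarrow> real"
    and X LX :: "'a \<Rightarrow> real" and DX DLX :: "'a \<Rightarrow> 'h"
    and N :: "'b measure" and Z :: "'b \<Rightarrow> real"
    and \<rho> :: "real \<Rightarrow> real" and a :: ereal and \<alpha> \<beta> \<gamma> :: real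
  assumes "prob_space N"
    and "centered_pearson N Z \<rho> a \<infinity> \<alpha> \<beta> \<gamma>"
    and "\<alpha> < 1 / 2"
    and "prob_space M"
    and "isonormal_process M W"
    and "generated_by M W"
    and "X \<in> D12 M W"
    and "(\<integral>w. X w \<partial>M) = 0"
    and "\<exists>p. distributed M lborel X p"
    and "AE w in M. a < ereal (X w)"
    and "malliavin_derivative M W X DX"
    and "OU_pseudo_inverse M W X LX"
    and "malliavin_derivative M W LX DLX"
    and "AE w in M. DX w \<bullet> (- DLX w) \<le> stein_g \<rho> a \<infinity> (X w)"
  shows "\<forall>K > (1 - \<alpha>) / (1 - 2 * \<alpha>). \<exists>z\<^sub>0. \<forall>z > z\<^sub>0.
           measure M {w \<in> space M. X w > z} \<le> K * measure N {w \<in> space N. Z w > z}"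
proof (intro allI impI)
  fix K assume K: "(1 - \<alpha>) / (1 - 2 * \<alpha>) < K"
  interpret isonormal M W
    using assms(4,5) by (simp add: isonormal_def isonormal_axioms_def)
  interpret pearson_density \<rho> a \<alpha> \<beta> \<gamma>
    by (rule centered_pearson_density(1)[OF assms(1,2)])
  note ibp = malliavin_integration_by_parts[OF _ _ _ assms(8,11,12,13)]
  \<comment> \<open>The zero test function meets the three hypotheses on \<open>\<phi>\<close> and
    releases the square integrability of \<open>X\<close>, \<open>DX\<close> and
    \<open>DLX\<close>.\<close>
  note L2s = ibp(2-4)[of "\<lambda>_. 0" "\<lambda>_. 0" 0, simplified]
  \<comment> \<open>The numerator exceeds \<open>(1 + \<alpha>) * (1 - 2 * \<alpha>)\<close> by
    \<open>2 * \<alpha>\<^sup>2\<close>, and the denominator is positive.\<close>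
  have "1 + \<alpha> \<le> (1 - \<alpha>) / (1 - 2 * \<alpha>)"
    using assms(3) by (simp add: pos_le_divide_eq algebra_simps)
  with K have K': "1 + \<alpha> < K" by linarith
  \<comment> \<open>Almost surely \<open>X\<close> lies in the support, where \<open>stein_g\<close>
    equals the polynomial.\<close>
  have Gg: "AE w in M. DX w \<bullet> (- DLX w) \<le> stein_poly (X w)"
    using assms(10,14) by eventually_elim (simp add: pearson stein_poly_def)
  have tail: "measure M {w \<in> space M. X w > z} * z * F z \<le> upper_mean z" if "0 < z" for z
    by (rule tail_le[OF assms(4) L2_integrable[OF L2s(1)] assms(8,10) L2_inner_integrable[OF L2s(2) L2_uminus[OF L2s(3)]] ibp(1) Gg that])
  have "\<forall>\<^sub>F z in at_top. measure M {w \<in> space M. X w > z} \<le> K * (1 - F z)"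
    by (rule eventually_tail_le[OF tail K'])
  then show "\<exists>z\<^sub>0. \<forall>z > z\<^sub>0. measure M {w \<in> space M. X w > z} \<le> K * measure N {w \<in> space N. Z w > z}"
    unfolding centered_pearson_density(2)[OF assms(1,2)] F_def eventually_at_top_dense .
qed

end
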